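(* Let $I \subseteq \mathbb{R}$ be an open interval and let $$P(t)(x) = x^n + \sum_{j=1}^n (-1)^j a_j(t)\, x^{n-j}, \qquad t\in I,$$ be a curve of hyperbolic polynomials with definable coefficients $a_j$. Let $p \in \mathbb{N}_{>0}$. If the $a_j$ are $C^{p+\Gamma(P)}$ on $I$, then the roots of $P$ can be parameterized globally by definable $C^{p+\gamma(P)}$ functions, i.e. there exist definable functions $\lambda_1,\dots,\lambda_n : I\to\mathbb{R}$ of class $C^{p+\gamma(P)}$ with $P(t)(x)=\prod_{j=1}^n(x-\lambda_j(t))$ for all $t\in I$.
   Context: A monic real polynomial is hyperbolic if all its roots are real; curves of polynomials have continuous coefficients. Fix an arbitrary o-minimal structure on $(\mathbb{R},+,\cdot)$: families $\mathcal{M}_n$ of subsets of $\mathbb{R}^n$ closed under finite set-theoretical operations, products and coordinate projections, containing all sets $\{f=0, g_1>0,\dots,g_l>0\}$ with $f,g_i$ real polynomials, and such that $\mathcal{M}_1$ consists exactly of the finite unions of open intervals and points. A set is definable if it belongs to some $\mathcal{M}_n$; a map is definable if its graph is. Multiplicity: for a continuous function $f$ defined near $t_0\in\mathbb{R}$, $m_{t_0}(f)\in\mathbb{N}\cup\{\infty\}$ is the supremum of all integers $q$ such that $f(t)=(t-t_0)^q g(t)$ near $t_0$ with $g$ continuous. Definition of $\Gamma_{t_0}(P)$ and $\gamma_{t_0}(P)$ (recursively, for $t_0\in I$ and a curve $P$ of monic hyperbolic polynomials with definable coefficients, defined near $t_0$): (I) If $P(t_0)$ has at least two distinct roots, factor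 $P(t)=P_1(t)P_2(t)$ near $t_0$ into curves of monic hyperbolic polynomials of positive degree with continuous coefficients (as regular as those of $P$) such that $P_1(t_0)$ and $P_2(t_0)$ have no common root, and set $\Gamma_{t_0}(P):=\max\{\Gamma_{t_0}(P_1),\Gamma_{t_0}(P_2)\}$ and $\gamma_{t_0}(P):=\Gamma_{t_0}(P)-\max\{\Gamma_{t_0}(P_1)-\gamma_{t_0}(P_1),\ \Gamma_{t_0}(P_2)-\gamma_{t_0}(P_2)\}$. (II) If $\deg P=n>1$ and all roots of $P(t_0)$ coincide, first replace $P(t)(x)$ by $P(t)(x+a_1(t)/n)$, so that $a_1=0$ identically (this by definition does not change $\Gamma_{t_0},\gamma_{t_0}$). If then $m_{t_0}(a_2)=2r<\infty$, write $a_k(t)=(t-t_0)^{kr}a_{(r),k}(t)$ with continuous $a_{(r),k}$, $2\le k\le n$, where $a_{(r),2}(t_0)\neq 0$, put $P_{(r)}(t)(x):=x^n+\sum_{k=2}^n(-1)^k a_{(r),k}(t)x^{n-k}$, and set $\Gamma_{t_0}(P):=\Gamma_{t_0}(P_{(r)})+n r$ and $\gamma_{t_0}(P):=\gamma_{t_0}(P_{(r)})+r$. If $m_{t_0}(a_2)=\infty$, set $\Gamma_{t_0}(P):=\gamma_{t_0}(P):=0$. (III) If $\deg P=1$, set $\Gamma_{t_0}(P):=\gamma_{t_0}(P):=0$. These integers are defined whenever the coefficients are differentiable enough for every step of the recursion to be possible; it suffices that the coefficients are $C^{\Gamma_{t_0}(P)+1}$ near $t_0$. The hypothesis that the $a_j$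 are $C^{p+\Gamma(P)}$ includes that the recursion can be carried out at every $t_0\in I$. Since the coefficients are definable, the set of $t_0\in I$ with $\Gamma_{t_0}(P)>0$ or $\gamma_{t_0}(P)>0$ is finite, and one defines the integers $$\Gamma(P):=\sup\{\Gamma_{t_0}(P):t_0\in I\},\qquad \gamma(P):=\Gamma(P)-\sup\{\Gamma_{t_0}(P)-\gamma_{t_0}(P):t_0\in I\}.$$ *)

theory Defs
  imports "HOL-Analysis.Analysis" "HOL-Computational_Algebra.Polynomial"
begin

section \<open>O-minimal structures\<close>

text \<open>Points of \<open>\<real>\<^sup>n\<close> are real lists of length \<open>n\<close>, so that \<open>n\<close> can vary.\<close>

inductive polynomial_on_lists :: "nat \<Rightarrow> (real list \<Rightarrow> real) \<Rightarrow> bool" for n where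
  const: "polynomial_on_lists n (\<lambda>x. c)"
| coord: "i < n \<Longrightarrow> polynomial_on_lists n (\<lambda>x. x ! i)"
| add: "polynomial_on_lists n f \<Longrightarrow> polynomial_on_lists n g \<Longrightarrow> polynomial_on_lists n (\<lambda>x. f x + g x)"
| mult: "polynomial_on_lists n f \<Longrightarrow> polynomial_on_lists n g \<Longrightarrow> polynomial_on_lists n (\<lambda>x. f x * g x)"

text \<open>Only the families \<open>M n\<close> with \<open>n \<ge> 1\<close> matter; \<open>M 0\<close> is unconstrained. Open intervals may
  be unbounded.\<close>

locale o_minimal =
  fixes M :: "nat \<Rightarrow> real list set set"
  assumes in_space: "n \<ge> 1 \<Longrightarrow> A \<in> M n \<Longrightarrow> A \<subseteq> {x. length x = n}"
    and closed_Un: "n \<ge> 1 \<Longrightarrow> A \<in> M n \<Longrightarrow> B \<in> M n \<Longrightarrow> A \<union> B \<in> M n"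
    and closed_Int: "n \<ge> 1 \<Longrightarrow> A \<in> M n \<Longrightarrow> B \<in> M n \<Longrightarrow> A \<inter> B \<in> M n"
    and closed_Diff: "n \<ge> 1 \<Longrightarrow> A \<in> M n \<Longrightarrow> B \<in> M n \<Longrightarrow> A - B \<in> M n"
    and closed_Times: "m \<ge> 1 \<Longrightarrow> n \<ge> 1 \<Longrightarrow> A \<in> M m \<Longrightarrow> B \<in> M n \<Longrightarrow>
           {x @ y |x y. x \<in> A \<and> y \<in> B} \<in> M (m + n)"
    and closed_proj: "n \<ge> 1 \<Longrightarrow> A \<in> M n \<Longrightarrow> ks \<noteq> [] \<Longrightarrow> sorted_wrt (<) ks \<Longrightarrow> set ks \<subseteq> {..<n} \<Longrightarrow>
           (\<lambda>x. map (\<lambda>k. x ! k) ks) ` A \<in> M (length ks)"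
    and polynomial_sets: "n \<ge> 1 \<Longrightarrow> polynomial_on_lists n f \<Longrightarrow> finite G \<Longrightarrow>
           (\<And>g. g \<in> G \<Longrightarrow> polynomial_on_lists n g) \<Longrightarrow>
           {x. length x = n \<and> f x = 0 \<and> (\<forall>g\<in>G. g x > 0)} \<in> M n"
    and one_dim: "A \<in> M 1 \<longleftrightarrow>
           (\<exists>F :: real set set. finite F \<and>
              (\<forall>J\<in>F. (open J \<and> is_interval J) \<or> (\<exists>s. J = {s})) \<and>
              A = (\<lambda>s. [s]) ` \<Union>F)"

definition definable :: "(nat \<Rightarrow> real list set set) \<Rightarrow> real list set \<Rightarrow> bool" where
  "definable M A \<longleftrightarrow> (\<exists>n\<ge>1. A \<in> M n)"

definition definable_on :: "(nat \<Rightarrow> real list set set) \<Rightarrow> real set \<Rightarrow> (real \<Rightarrow> real) \<Rightarrow> bool" where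
  "definable_on M S f \<longleftrightarrow> definable M {[t, f t] |t. t \<in> S}"


section \<open>Regularity and multiplicity\<close>

text \<open>\<open>f\<close> is of class \<open>C\<^sup>k\<close> on the open set \<open>S\<close>; values of \<open>f\<close> outside \<open>S\<close> are irrelevant.\<close>

primrec Ck_on :: "nat \<Rightarrow> real set \<Rightarrow> (real \<Rightarrow> real) \<Rightarrow> bool" where
  "Ck_on 0 S f \<longleftrightarrow> continuous_on S f"
| "Ck_on (Suc k) S f \<longleftrightarrow>
     (\<exists>f'. (\<forall>t\<in>S. (f has_real_derivative f' t) (at t)) \<and> Ck_on k S f')"

definition Ck_near :: "nat \<Rightarrow> real \<Rightarrow> (real \<Rightarrow> real) \<Rightarrow> bool" where
  "Ck_near k t0 f \<longleftrightarrow> (\<exists>e>0. Ck_on k (ball t0 e) f)"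

abbreviation continuous_near :: "real \<Rightarrow> (real \<Rightarrow> real) \<Rightarrow> bool" where
  "continuous_near \<equiv> Ck_near 0"

definition mult_at :: "real \<Rightarrow> (real \<Rightarrow> real) \<Rightarrow> enat" where
  "mult_at t0 f = Sup {enat q |q. \<exists>g. continuous_near t0 g \<and>
                                    (\<forall>\<^sub>F t in nhds t0. f t = (t - t0) ^ q * g t)}"


section \<open>Hyperbolic polynomials\<close>

definition hyperbolic :: "real poly \<Rightarrow> bool" where
  "hyperbolic p \<longleftrightarrow> lead_coeff p = 1 \<and>
     (\<forall>z :: complex. poly (map_poly of_real p) z = 0 \<longrightarrow> z \<in> \<real>)"

text \<open>For \<open>p\<close> monic of degree \<open>n\<close>, \<open>sgn_coeff n j p\<close> is the \<open>a\<^sub>j\<close> in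
  \<open>p = x^n + (\<Sum>j=1..n. (-1)^j * a\<^sub>j * x^(n-j))\<close>.\<close>

definition sgn_coeff :: "nat \<Rightarrow> nat \<Rightarrow> real poly \<Rightarrow> real" where
  "sgn_coeff n j p = (-1) ^ j * coeff p (n - j)"

definition hyp_curve_near :: "nat \<Rightarrow> real \<Rightarrow> (real \<Rightarrow> real poly) \<Rightarrow> bool" where
  "hyp_curve_near n t0 P \<longleftrightarrow>
     (\<forall>\<^sub>F t in nhds t0. hyperbolic (P t) \<and> degree (P t) = n) \<and>
     (\<forall>j. continuous_near t0 (\<lambda>t. coeff (P t) j))"

text \<open>The curve \<open>x \<mapsto> P(t)(x + a\<^sub>1(t)/n)\<close>, whose own first coefficient vanishes identically.\<close>

definition tschirnhausen :: "nat \<Rightarrow> (real \<Rightarrow> real poly) \<Rightarrow> real \<Rightarrow> real poly" where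
  "tschirnhausen n P t = pcompose (P t) [:sgn_coeff n 1 (P t) / real n, 1:]"


section \<open>The integers \<open>\<Gamma>\<close> and \<open>\<gamma>\<close>\<close>

text \<open>\<open>Gamma_rel t0 P G g\<close>: the recursion for the germ of \<open>P\<close> at \<open>t0\<close> can be carried out and
  yields \<open>\<Gamma>\<^bsub>t0\<^esub>(P) = G\<close> and \<open>\<gamma>\<^bsub>t0\<^esub>(P) = g\<close>. The subtractions on \<open>nat\<close> do not truncate, see
  \<open>Gamma_rel_le\<close> below.\<close>

inductive Gamma_rel :: "real \<Rightarrow> (real \<Rightarrow> real poly) \<Rightarrow> nat \<Rightarrow> nat \<Rightarrow> bool" for t0 where
  split:
    "\<lbrakk> hyp_curve_near n t0 P; card {x. poly (P t0) x = 0} \<ge> 2;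
       n1 > 0; hyp_curve_near n1 t0 P1; n2 > 0; hyp_curve_near n2 t0 P2;
       \<And>k. (\<forall>j. Ck_near k t0 (\<lambda>t. coeff (P t) j)) \<Longrightarrow>
             (\<forall>j. Ck_near k t0 (\<lambda>t. coeff (P1 t) j)) \<and> (\<forall>j. Ck_near k t0 (\<lambda>t. coeff (P2 t) j));
       \<forall>\<^sub>F t in nhds t0. P t = P1 t * P2 t;
       \<nexists>x. poly (P1 t0) x = 0 \<and> poly (P2 t0) x = 0;
       Gamma_rel t0 P1 G1 g1; Gamma_rel t0 P2 G2 g2 \<rbrakk>
     \<Longrightarrow> Gamma_rel t0 P (max G1 G2) (max G1 G2 - max (G1 - g1) (G2 - g2))"
| reduce:
    "\<lbrakk> hyp_curve_near n t0 P; n > 1; card {x. poly (P t0) x = 0} = 1;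
       Q = tschirnhausen n P;
       mult_at t0 (\<lambda>t. sgn_coeff n 2 (Q t)) = enat (2 * r);
       \<And>k. k \<in> {2..n} \<Longrightarrow> continuous_near t0 (b k);
       \<And>k. k \<in> {2..n} \<Longrightarrow> \<forall>\<^sub>F t in nhds t0. sgn_coeff n k (Q t) = (t - t0) ^ (k * r) * b k t;
       b 2 t0 \<noteq> 0;
       Gamma_rel t0 (\<lambda>t. monom 1 n + (\<Sum>k=2..n. monom ((-1) ^ k * b k t) (n - k))) G g \<rbrakk>
     \<Longrightarrow> Gamma_rel t0 P (G + n * r) (g + r)"
| flat:
    "\<lbrakk> hyp_curve_near n t0 P; n > 1; card {x. poly (P t0) x = 0} = 1;
       mult_at t0 (\<lambda>t. sgn_coeff n 2 (tschirnhausen n P t)) = \<infinity> \<rbrakk>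
     \<Longrightarrow> Gamma_rel t0 P 0 0"
| linear: "hyp_curve_near 1 t0 P \<Longrightarrow> Gamma_rel t0 P 0 0"

lemma Gamma_rel_le: "Gamma_rel t0 P G g \<Longrightarrow> g \<le> G"
proof (induction rule: Gamma_rel.induct)
  case (reduce n P Q r b G g)
  have "r \<le> n * r"
    using \<open>n > 1\<close> by simp
  with reduce.IH show ?case
    by (rule add_mono)
qed auto

definition Gamma_defined :: "real \<Rightarrow> (real \<Rightarrow> real poly) \<Rightarrow> bool" where
  "Gamma_defined t0 P \<longleftrightarrow> (\<exists>G g. Gamma_rel t0 P G g)"

definition Gamma_at :: "real \<Rightarrow> (real \<Rightarrow> real poly) \<Rightarrow> nat" where
  "Gamma_at t0 P = (THE G. \<exists>g. Gamma_rel t0 P G g)"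

definition gamma_at :: "real \<Rightarrow> (real \<Rightarrow> real poly) \<Rightarrow> nat" where
  "gamma_at t0 P = (THE g. \<exists>G. Gamma_rel t0 P G g)"

text \<open>For definable coefficients the suprema are over finite sets of values.\<close>

definition Gamma_on :: "real set \<Rightarrow> (real \<Rightarrow> real poly) \<Rightarrow> nat" where
  "Gamma_on I P = (SUP t\<in>I. Gamma_at t P)"

definition gamma_on :: "real set \<Rightarrow> (real \<Rightarrow> real poly) \<Rightarrow> nat" where
  "gamma_on I P = Gamma_on I P - (SUP t\<in>I. Gamma_at t P - gamma_at t P)"

end

theory Submission
  imports Defs "HOL-Computational_Algebra.Fundamental_Theorem_Algebra"
begin

text \<open>Near a point \<open>t0\<close> the recursion that defines \<open>\<Gamma>\<close> and \<open>\<gamma>\<close> also builds smooth roots. If the roots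
at \<open>t0\<close> are not all equal, the polynomial splits and the factors are treated separately. If they
are all equal, subtracting their mean and dividing by \<open>(t - t0)\<^sup>r\<close> leads to a reduced polynomial with
coefficients \<open>b\<^sub>k\<close>, where \<open>(t - t0)\<^bsup>kr\<^esup> b\<^sub>k\<close> is the \<open>k\<close>-th coefficient; the division costs at most
\<open>nr\<close> derivatives (\<open>Ck_near_divide_power\<close>). From roots \<open>\<nu>\<close> of the reduced polynomial one recovers
the roots \<open>(t - t0)\<^sup>r \<nu> + mean\<close> of the given one.

The gain in regularity is that multiplication with \<open>(t - t0)\<^sup>r\<close> turns a \<open>C\<^sup>m\<close> root \<open>\<nu>\<close> into a
\<open>C\<^bsup>m+r\<^esup>\<close> root (\<open>Ck_on_power_times\<close>), and this is where o-minimality enters. Away from \<open>t0\<close> the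
pattern of coincidences between the roots is constant on each side, because zero sets of definable
functions have this property; so there each root is a simple root of an iterated derivative of
the polynomial and as smooth as the coefficients (\<open>Ck_on_roots_of_constant_multiplicity\<close>). At \<open>t0\<close>
one needs \<open>(t - t0) h'(t) \<longlongrightarrow> 0\<close> for a continuous definable \<open>h\<close>. The left side is definable, so if
the limit were not \<open>0\<close>, its absolute value would stay above a positive constant \<open>c\<close> on one side,
\<open>\<bar>h'\<bar> \<ge> c / \<bar>t - t0\<bar>\<close> would hold there, and \<open>h\<close> would grow at least logarithmically
(\<open>definable_derivative_growth\<close>). The same argument treats the case of infinite multiplicity: there
the roots minus their mean are \<open>(t - t0)\<^sup>q\<close> times a continuous function for every \<open>q\<close>. Definable
flat functions that do not vanish identically exist in some o-minimal structures, so this case is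
not void. Altogether \<open>C\<^bsup>q+\<Gamma>\<^esup>\<close> coefficients have definable \<open>C\<^bsup>q+\<gamma>\<^esup>\<close> roots near \<open>t0\<close>
(\<open>Gamma_rel_smooth_roots\<close>).

For the global statement, \<open>\<Gamma>\<close> and \<open>\<gamma>\<close> must be well defined at each point. Two factorizations of
the same germ have a common refinement, whose factors are products over sets of root indices;
this gives uniqueness (\<open>Gamma_rel_unique\<close>). Off the finitely many frontier points of the
coincidence sets of the ordered roots, \<open>\<Gamma>\<close> vanishes and the ordered roots are smooth. At a
frontier point the local smooth roots are, on either side, a permutation of any other
definable choice of roots. Hence the choices on the two sides can be renumbered so that they fit
together (\<open>global_roots_glue\<close>), and an induction on the number of frontier points finishes the
proof.\<close>

section \<open>Functions of class \<open>C\<^sup>k\<close>\<close>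

lemma Ck_on_subset: "Ck_on k S f \<Longrightarrow> T \<subseteq> S \<Longrightarrow> Ck_on k T f"
  by (induction k arbitrary: f) (auto intro: continuous_on_subset)

lemma Ck_on_Suc_imp: "Ck_on (Suc k) S f \<Longrightarrow> Ck_on k S f"
proof (induction k arbitrary: f)
  case 0
  then show ?case
    using DERIV_isCont by (fastforce intro!: continuous_at_imp_continuous_on)
next
  case (Suc k)
  then obtain f' where "\<forall>t\<in>S. (f has_real_derivative f' t) (at t)" "Ck_on (Suc k) S f'"
    by auto
  with Suc.IH show ?case by auto
qed

lemma Ck_on_mono: "Ck_on k S f \<Longrightarrow> j \<le> k \<Longrightarrow> Ck_on j S f"
  by (induction k) (auto simp del: Ck_on.simps(2) simp: le_Suc_eq dest: Ck_on_Suc_imp)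

lemma Ck_on_imp_continuous_on: "Ck_on k S f \<Longrightarrow> continuous_on S f"
  using Ck_on_mono[of k S f 0] by simp

lemma Ck_on_cong:
  assumes "open S" "\<And>t. t \<in> S \<Longrightarrow> f t = g t"
  shows "Ck_on k S f \<longleftrightarrow> Ck_on k S g"
proof (cases k)
  case 0
  with assms show ?thesis by (auto cong: continuous_on_cong)
next
  case (Suc j)
  have "(f has_real_derivative d) (at t) \<longleftrightarrow> (g has_real_derivative d) (at t)" if "t \<in> S" for t d
    using has_field_derivative_transform_within_open[OF _ \<open>open S\<close> that, of f d g]
      has_field_derivative_transform_within_open[OF _ \<open>open S\<close> that, of g d f] assms(2) by auto
  with Suc show ?thesis by auto
qed

lemma Ck_on_const: "Ck_on k S (\<lambda>_. c)"
proof (induction k arbitrary: c)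
  case (Suc k)
  then show ?case by (auto intro!: exI[of _ "\<lambda>_. 0"])
qed simp

lemma Ck_on_ident: "Ck_on k S (\<lambda>t. t)"
  by (cases k) (auto intro!: exI[of _ "\<lambda>_. 1"] Ck_on_const)

lemma Ck_on_add: "Ck_on k S f \<Longrightarrow> Ck_on k S g \<Longrightarrow> Ck_on k S (\<lambda>t. f t + g t)"
proof (induction k arbitrary: f g)
  case 0
  then show ?case by (auto intro: continuous_intros)
next
  case (Suc k)
  then obtain f' g' where
    "\<forall>t\<in>S. (f has_real_derivative f' t) (at t)" "Ck_on k S f'"
    "\<forall>t\<in>S. (g has_real_derivative g' t) (at t)" "Ck_on k S g'"
    by auto
  with Suc.IH show ?case
    by (auto intro!: exI[of _ "\<lambda>t. f' t + g' t"] derivative_eq_intros)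
qed

lemma Ck_on_mult: "Ck_on k S f \<Longrightarrow> Ck_on k S g \<Longrightarrow> Ck_on k S (\<lambda>t. f t * g t)"
proof (induction k arbitrary: f g)
  case 0
  then show ?case by (auto intro: continuous_intros)
next
  case (Suc k)
  then obtain f' g' where *:
    "\<forall>t\<in>S. (f has_real_derivative f' t) (at t)" "Ck_on k S f'"
    "\<forall>t\<in>S. (g has_real_derivative g' t) (at t)" "Ck_on k S g'"
    by auto
  have "Ck_on k S f" "Ck_on k S g"
    using Suc.prems by (auto simp del: Ck_on.simps intro: Ck_on_Suc_imp)
  with * Suc.IH have "Ck_on k S (\<lambda>t. f' t * g t + g' t * f t)"
    by (intro Ck_on_add) auto
  with * show ?case
    by (auto intro!: exI[of _ "\<lambda>t. f' t * g t + g' t * f t"] derivative_eq_intros)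
qed

lemma Ck_on_inverse:
  "Ck_on k S f \<Longrightarrow> \<forall>t\<in>S. f t \<noteq> 0 \<Longrightarrow> Ck_on k S (\<lambda>t. inverse (f t))"
proof (induction k arbitrary: f)
  case 0
  then show ?case by (auto intro: continuous_intros)
next
  case (Suc k)
  then obtain f' where *: "\<forall>t\<in>S. (f has_real_derivative f' t) (at t)" "Ck_on k S f'"
    by auto
  have "Ck_on k S f"
    using Suc.prems by (auto simp del: Ck_on.simps intro: Ck_on_Suc_imp)
  then have "Ck_on k S (\<lambda>t. (- 1) * (f' t * (inverse (f t) * inverse (f t))))"
    using Suc * by (intro Ck_on_mult Ck_on_const) auto
  with * Suc.prems show ?case
    by (auto intro!: exI[of _ "\<lambda>t. (- 1) * (f' t * (inverse (f t) * inverse (f t)))"] derivative_eq_intros)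
qed

lemma Ck_on_sum: "(\<And>i. i \<in> A \<Longrightarrow> Ck_on k S (f i)) \<Longrightarrow> Ck_on k S (\<lambda>t. \<Sum>i\<in>A. f i t)"
  by (induction A rule: infinite_finite_induct) (auto intro: Ck_on_add Ck_on_const)

lemma Ck_on_power: "Ck_on k S f \<Longrightarrow> Ck_on k S (\<lambda>t. f t ^ m)"
  by (induction m) (auto intro: Ck_on_mult Ck_on_const)

lemma Ck_on_linear_power: "Ck_on k S (\<lambda>t. (t - t0) ^ m)"
proof -
  have "Ck_on k S (\<lambda>t. (t + (- t0)) ^ m)"
    by (intro Ck_on_power Ck_on_add Ck_on_ident Ck_on_const)
  then show ?thesis by simp
qed

text \<open>The derivative may be taken as \<open>deriv f\<close>, which glues the local derivatives.\<close>

lemma Ck_on_local: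
  assumes "\<And>t. t \<in> S \<Longrightarrow> Ck_near k t f"
  shows "Ck_on k S f"
  using assms
proof (induction k arbitrary: f)
  case 0
  have "isCont f t" if t: "t \<in> S" for t
  proof -
    obtain e where "e > 0" "continuous_on (ball t e) f"
      using 0[OF t] by (auto simp: Ck_near_def)
    then show ?thesis
      by (simp add: continuous_on_eq_continuous_at)
  qed
  then show ?case by (simp add: continuous_at_imp_continuous_on)
next
  case (Suc k)
  have *: "(f has_real_derivative deriv f t) (at t) \<and> Ck_near k t (deriv f)" if t: "t \<in> S" for t
  proof -
    obtain e f' where e: "e > 0" and f': "\<forall>s\<in>ball t e. (f has_real_derivative f' s) (at s)"
      "Ck_on k (ball t e) f'"
      using Suc.prems[OF t] by (auto simp: Ck_near_def)
    then have "\<And>s. s \<in> ball t e \<Longrightarrow> f' s = deriv f s"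
      by (metis DERIV_imp_deriv)
    with e f' Ck_on_cong[of "ball t e" f' "deriv f" k] show ?thesis
      by (auto simp: Ck_near_def)
  qed
  with Suc.IH[of "deriv f"] show ?case by auto
qed

lemma Ck_on_imp_near:
  assumes "open S" "t \<in> S" "Ck_on k S f"
  shows "Ck_near k t f"
  using assms unfolding Ck_near_def by (meson Ck_on_subset openE)

text \<open>This is l'Hopital's rule applied to the difference quotient.\<close>

lemma DERIV_of_limit:
  fixes f :: "real \<Rightarrow> real"
  assumes "isCont f a" "\<forall>\<^sub>F t in at a. (f has_real_derivative g t) (at t)" "(g \<longlongrightarrow> L) (at a)"
  shows "(f has_real_derivative L) (at a)"
proof -
  have "((\<lambda>t. (f t - f a) / (t - a)) \<longlongrightarrow> L) (at a)"
  proof (rule lhopital[where f' = g and g' = "\<lambda>_. 1"])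
    show "((\<lambda>t. f t - f a) \<longlongrightarrow> 0) (at a)"
      using assms(1) by (simp add: isCont_def LIM_zero)
    show "((\<lambda>t. t - a) \<longlongrightarrow> 0) (at a)"
      by (simp add: LIM_zero)
    show "\<forall>\<^sub>F t in at a. t - a \<noteq> 0"
      by (auto simp: eventually_at intro: exI[of _ 1])
    show "\<forall>\<^sub>F t in at a. ((\<lambda>t. f t - f a) has_real_derivative g t) (at t)"
      using assms(2) by eventually_elim (auto intro!: derivative_eq_intros)
    show "\<forall>\<^sub>F t in at a. ((\<lambda>t. t - a) has_real_derivative 1) (at t)"
      by (auto intro!: derivative_eq_intros always_eventually)
  qed (use assms(3) in auto)
  then show ?thesis by (simp add: has_field_derivative_iff)
qed

lemma eventually_at_ball: "0 < e \<Longrightarrow> (\<And>t. t \<in> ball a e \<Longrightarrow> t \<noteq> a \<Longrightarrow> Q t) \<Longrightarrow> eventually Q (at (a::real))"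
  unfolding eventually_at by (rule exI[of _ e]) (auto simp: dist_commute)

lemma Ck_on_Suc_puncture:
  assumes "e > 0" "continuous_on (ball t0 e) f" "Ck_on k (ball t0 e) g"
    and "\<And>t. t \<in> ball t0 e \<Longrightarrow> t \<noteq> t0 \<Longrightarrow> (f has_real_derivative g t) (at t)"
  shows "Ck_on (Suc k) (ball t0 e) f"
proof -
  have "continuous_on (ball t0 e) g"
    using assms(3) by (rule Ck_on_imp_continuous_on)
  then have "isCont g t0" "isCont f t0"
    using assms(1,2) by (simp_all add: continuous_on_eq_continuous_at)
  moreover have "\<forall>\<^sub>F t in at t0. (f has_real_derivative g t) (at t)"
    by (rule eventually_at_ball[OF assms(1)]) (rule assms(4))
  ultimately have "(f has_real_derivative g t0) (at t0)"
    by (intro DERIV_of_limit) (simp_all add: isCont_def)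
  with assms(4) have "\<forall>t\<in>ball t0 e. (f has_real_derivative g t) (at t)" by blast
  with assms(3) show ?thesis by auto
qed

lemma quotient_rule_cancel:
  fixes d x y :: real
  assumes "d \<noteq> 0"
  shows "(x * d - d * y * 1) / (d * d) = (x - y) / d"
  using assms by (simp add: divide_simps algebra_simps)

text \<open>With \<open>t\<close> in place of \<open>t - t0\<close>, the equation is \<open>t g' + c g = h\<close> off the origin. Differentiation preserves the
form of the equation: \<open>t g'' + (c + 1) g' = h'\<close>, which permits induction. That \<open>g'\<close> has a limit
at the origin is l'Hopital's rule for \<open>g' = t\<^sup>c (h - c g) / t\<^bsup>c+1\<^esup>\<close>, since the numerator has the
derivative \<open>t\<^sup>c h'\<close>.\<close>

lemma Ck_on_Euler_equation:
  assumes "e > 0" "c > 0" "Ck_on N (ball t0 e) h" "continuous_on (ball t0 e) g"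
    and "\<And>t. t \<in> ball t0 e \<Longrightarrow> t \<noteq> t0 \<Longrightarrow>
           (g has_real_derivative (h t - real c * g t) / (t - t0)) (at t)"
  shows "Ck_on N (ball t0 e) g"
  using assms
proof (induction N arbitrary: c h g)
  case (Suc N)
  let ?B = "ball t0 e"
  obtain h' where h': "\<And>t. t \<in> ?B \<Longrightarrow> (h has_real_derivative h' t) (at t)" "Ck_on N ?B h'"
    using Suc.prems(3) unfolding Ck_on.simps by blast
  \<comment> \<open>The candidate for \<open>g'\<close>; its value at \<open>t0\<close> is forced by the differentiated equation.\<close>
  define k where "k t = (if t = t0 then h' t0 / real (Suc c) else (h t - real c * g t) / (t - t0))" for t
  have k_off: "k t = (h t - real c * g t) / (t - t0)" if "t \<noteq> t0" for t
    using that by (simp add: k_def)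
  have dg: "(g has_real_derivative k t) (at t)" if "t \<in> ?B" "t \<noteq> t0" for t
    using Suc.prems(5)[OF that] k_off[OF that(2)] by simp
  have dk: "(k has_real_derivative (h' t - real (Suc c) * k t) / (t - t0)) (at t)"
    if t: "t \<in> ?B" "t \<noteq> t0" for t
  proof -
    have "((\<lambda>t. (h t - real c * g t) / (t - t0)) has_real_derivative
            ((h' t - real c * k t) * (t - t0) - (h t - real c * g t) * 1) / ((t - t0) * (t - t0))) (at t)"
      using t h'(1)[OF t(1)] dg[OF t] by (auto intro!: derivative_eq_intros)
    moreover have "((h' t - real c * k t) * (t - t0) - (h t - real c * g t) * 1) / ((t - t0) * (t - t0))
          = (h' t - real (Suc c) * k t) / (t - t0)"
    proof -
      have "h t - real c * g t = (t - t0) * k t"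
        using t k_off[OF t(2)] by simp
      then have "((h' t - real c * k t) * (t - t0) - (h t - real c * g t) * 1) / ((t - t0) * (t - t0))
          = (h' t - real c * k t - k t) / (t - t0)"
        using quotient_rule_cancel[of "t - t0" "h' t - real c * k t" "k t"] t by (simp only:)
      also have "h' t - real c * k t - k t = h' t - real (Suc c) * k t"
        by (simp add: algebra_simps)
      finally show ?thesis .
    qed
    ultimately have "((\<lambda>t. (h t - real c * g t) / (t - t0)) has_real_derivative
          (h' t - real (Suc c) * k t) / (t - t0)) (at t)" by simp
    then show ?thesis
      by (rule has_field_derivative_transform_within_open[of _ _ _ "- {t0}"]) (use t k_off in auto)
  qed
  have h'_cont: "isCont h' t0"
    using Ck_on_imp_continuous_on[OF h'(2)] Suc.prems(1) by (simp add: continuous_on_eq_continuous_at)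
  have g_cont: "isCont g t0"
    using Suc.prems(4) Suc.prems(1) by (simp add: continuous_on_eq_continuous_at)
  have h_cont: "isCont h t0"
    using h'(1)[of t0] Suc.prems(1) by (auto intro: DERIV_isCont)
  have ne: "\<forall>\<^sub>F t in at t0. t \<noteq> t0"
    by (simp add: eventually_at_filter)
  have "((\<lambda>t. (t - t0) ^ c * (h t - real c * g t) / (t - t0) ^ Suc c) \<longlongrightarrow> h' t0 / real (Suc c)) (at t0)"
  proof (rule lhopital[where f' = "\<lambda>t. (t - t0) ^ c * h' t" and g' = "\<lambda>t. real (Suc c) * (t - t0) ^ c"])
    have "isCont (\<lambda>t. (t - t0) ^ c * (h t - real c * g t)) t0"
      using g_cont h_cont by (intro continuous_intros)
    then show "((\<lambda>t. (t - t0) ^ c * (h t - real c * g t)) \<longlongrightarrow> 0) (at t0)"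
      using \<open>c > 0\<close> by (simp add: isCont_def zero_power)
    have "isCont (\<lambda>t. (t - t0) ^ Suc c) t0"
      by (intro continuous_intros)
    then show "((\<lambda>t. (t - t0) ^ Suc c) \<longlongrightarrow> 0) (at t0)"
      by (simp add: isCont_def)
    show "\<forall>\<^sub>F t in at t0. (t - t0) ^ Suc c \<noteq> 0"
      using ne by eventually_elim simp
    show "\<forall>\<^sub>F t in at t0. real (Suc c) * (t - t0) ^ c \<noteq> 0"
      using ne by eventually_elim simp
    show "\<forall>\<^sub>F t in at t0. ((\<lambda>t. (t - t0) ^ Suc c) has_real_derivative real (Suc c) * (t - t0) ^ c) (at t)"
      by (rule always_eventually) (auto intro!: derivative_eq_intros simp del: power_Suc)
    show "\<forall>\<^sub>F t in at t0. ((\<lambda>t. (t - t0) ^ c * (h t - real c * g t)) has_real_derivative (t - t0) ^ c * h' t) (at t)"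
    proof (rule eventually_at_ball[OF \<open>e > 0\<close>])
      fix t assume t: "t \<in> ?B" "t \<noteq> t0"
      have "((\<lambda>t. (t - t0) ^ c * (h t - real c * g t)) has_real_derivative
        real c * (t - t0) ^ (c - 1) * (h t - real c * g t) + (h' t - real c * k t) * (t - t0) ^ c) (at t)"
        using h'(1)[OF t(1)] dg[OF t] by (auto intro!: derivative_eq_intros)
      moreover have "real c * (t - t0) ^ (c - 1) * (h t - real c * g t) + (h' t - real c * k t) * (t - t0) ^ c
          = (t - t0) ^ c * h' t"
      proof -
        have pw: "(t - t0) ^ c = (t - t0) ^ (c - 1) * (t - t0)"
          using \<open>c > 0\<close> by (metis power_minus_mult)
        have hk: "h t - real c * g t = k t * (t - t0)"
          using k_off[OF t(2)] t by simp
        show ?thesis unfolding pw hk by (simp add: algebra_simps)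
      qed
      ultimately show "((\<lambda>t. (t - t0) ^ c * (h t - real c * g t)) has_real_derivative (t - t0) ^ c * h' t) (at t)"
        by (simp only:)
    qed
    have "((\<lambda>t. h' t / real (Suc c)) \<longlongrightarrow> h' t0 / real (Suc c)) (at t0)"
      using h'_cont by (intro tendsto_intros) (auto simp: isCont_def)
    then show "((\<lambda>t. (t - t0) ^ c * h' t / (real (Suc c) * (t - t0) ^ c)) \<longlongrightarrow> h' t0 / real (Suc c)) (at t0)"
      by (rule Lim_transform_eventually) (use ne in eventually_elim, simp)
  qed
  then have "(k \<longlongrightarrow> h' t0 / real (Suc c)) (at t0)"
    by (rule Lim_transform_eventually) (use ne in eventually_elim, simp add: k_off)
  then have "isCont k t0"
    by (simp add: isCont_def k_def)
  then have "isCont k t" if "t \<in> ?B" for t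
    using that dk[of t] by (cases "t = t0") (auto intro: DERIV_isCont)
  then have "continuous_on ?B k"
    by (simp add: continuous_at_imp_continuous_on)
  then have "Ck_on N ?B k"
    using Suc.IH[of "Suc c" h' k] Suc.prems(1) h'(2) dk by auto
  then show ?case
    using Ck_on_Suc_puncture[OF Suc.prems(1,4), of N k] dg by blast
qed simp

text \<open>Here \<open>f' = (t - t0) g' + g\<close> is the Euler equation with \<open>c = 1\<close>.\<close>

lemma Ck_on_divide_linear:
  assumes "e > 0" "Ck_on (Suc N) (ball t0 e) f" "continuous_on (ball t0 e) g"
    and "\<And>t. t \<in> ball t0 e \<Longrightarrow> f t = (t - t0) * g t"
  shows "Ck_on N (ball t0 e) g"
proof -
  let ?B = "ball t0 e"
  obtain f' where f': "\<And>t. t \<in> ?B \<Longrightarrow> (f has_real_derivative f' t) (at t)" "Ck_on N ?B f'"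
    using assms(2) unfolding Ck_on.simps by blast
  show ?thesis
  proof (rule Ck_on_Euler_equation[OF assms(1) _ f'(2) assms(3), of 1])
    fix t assume t: "t \<in> ?B" "t \<noteq> t0"
    have "((\<lambda>t. f t / (t - t0)) has_real_derivative (f' t * (t - t0) - f t * 1) / ((t - t0) * (t - t0))) (at t)"
      using t f'(1)[OF t(1)] by (auto intro!: derivative_eq_intros)
    moreover have "(f' t * (t - t0) - f t * 1) / ((t - t0) * (t - t0)) = (f' t - real 1 * g t) / (t - t0)"
      unfolding assms(4)[OF t(1)] using quotient_rule_cancel[of "t - t0" "f' t" "g t"] t by simp
    ultimately have "((\<lambda>t. f t / (t - t0)) has_real_derivative (f' t - real 1 * g t) / (t - t0)) (at t)"
      by simp
    then show "(g has_real_derivative (f' t - real 1 * g t) / (t - t0)) (at t)"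
      by (rule has_field_derivative_transform_within_open[of _ _ _ "?B - {t0}"])
         (use t assms(4) in \<open>auto simp: open_delete\<close>)
  qed simp
qed

lemma Ck_on_divide_power:
  assumes "e > 0" "Ck_on (N + m) (ball t0 e) f" "continuous_on (ball t0 e) g"
    and "\<And>t. t \<in> ball t0 e \<Longrightarrow> f t = (t - t0) ^ m * g t"
  shows "Ck_on N (ball t0 e) g"
  using assms(2,4)
proof (induction m arbitrary: f)
  case 0
  then show ?case using Ck_on_cong[of "ball t0 e" f g N] by auto
next
  case (Suc m)
  have "Ck_on (N + m) (ball t0 e) (\<lambda>t. (t - t0) ^ m * g t)"
    by (rule Ck_on_divide_linear[OF assms(1), of _ _ f])
       (use Suc.prems assms(3) in \<open>auto intro!: continuous_intros simp del: Ck_on.simps simp: mult.assoc\<close>)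
  then show ?case by (rule Suc.IH) auto
qed

text \<open>Implicit differentiation of a root that is known to be continuous. With the quotients
\<open>(x\<^sup>j - y\<^sup>j) / (x - y)\<close> written as sums, the equation at \<open>s\<close> minus the one at \<open>t\<close> determines the
difference quotient of \<open>u\<close>, and the resulting formula for \<open>u'\<close> involves \<open>u\<close> and the first
derivatives of the \<open>c\<^sub>j\<close> only, so that the regularity of \<open>u\<close> rises step by step.\<close>

lemma Ck_on_simple_root:
  fixes c :: "nat \<Rightarrow> real \<Rightarrow> real"
  assumes "open S" "\<And>j. j \<le> n \<Longrightarrow> Ck_on k S (c j)" "continuous_on S u"
    and root: "\<And>t. t \<in> S \<Longrightarrow> (\<Sum>j\<le>n. c j t * u t ^ j) = 0"
    and simple: "\<And>t. t \<in> S \<Longrightarrow> (\<Sum>j\<le>n. c j t * (real j * u t ^ (j - 1))) \<noteq> 0"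
  shows "Ck_on k S u"
  using assms(2)
proof (induction k)
  case (Suc k)
  obtain c' where c': "\<And>j t. j \<le> n \<Longrightarrow> t \<in> S \<Longrightarrow> (c j has_real_derivative c' j t) (at t)"
    "\<And>j. j \<le> n \<Longrightarrow> Ck_on k S (c' j)"
  proof -
    have "\<exists>c'. (\<forall>t\<in>S. (c j has_real_derivative c' t) (at t)) \<and> Ck_on k S c'" if "j \<le> n" for j
      using Suc.prems[OF that] by simp
    then show ?thesis using that by metis
  qed
  define q where "q j x y = (\<Sum>i<j. y ^ (j - Suc i) * x ^ i)" for j and x y :: real
  have q_diff: "x ^ j - y ^ j = (x - y) * q j x y" for j x y
    unfolding q_def by (rule power_diff_sumr2)
  have q_diag: "q j x x = real j * x ^ (j - 1)" for j x
  proof -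
    have "q j x x = (\<Sum>i<j. x ^ (j - 1))"
      unfolding q_def by (intro sum.cong) (auto simp flip: power_add)
    then show ?thesis by simp
  qed
  have u_cont: "isCont u t" if "t \<in> S" for t
    using assms(1,3) that by (simp add: continuous_on_eq_continuous_at)
  define u' where "u' t = - (\<Sum>j\<le>n. c' j t * u t ^ j) * inverse (\<Sum>j\<le>n. c j t * (real j * u t ^ (j - 1)))" for t
  have du: "(u has_real_derivative u' t) (at t)" if t: "t \<in> S" for t
  proof -
    define A where "A s = (\<Sum>j\<le>n. (c j s - c j t) / (s - t) * u s ^ j)" for s
    define D where "D s = (\<Sum>j\<le>n. c j t * q j (u s) (u t))" for s
    have "(A \<longlongrightarrow> (\<Sum>j\<le>n. c' j t * u t ^ j)) (at t)"
      unfolding A_def using u_cont[OF t] c'(1)[OF _ t]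
      by (intro tendsto_intros) (auto simp: isCont_def has_field_derivative_iff)
    moreover have "(D \<longlongrightarrow> (\<Sum>j\<le>n. c j t * q j (u t) (u t))) (at t)"
      unfolding D_def q_def using u_cont[OF t]
      by (intro tendsto_intros) (auto simp: isCont_def)
    moreover have nz: "(\<Sum>j\<le>n. c j t * q j (u t) (u t)) \<noteq> 0"
      using simple[OF t] by (simp add: q_diag)
    ultimately have "((\<lambda>s. - A s * inverse (D s)) \<longlongrightarrow> u' t) (at t)"
      unfolding u'_def q_diag by (intro tendsto_intros) (auto simp: q_diag)
    moreover have "\<forall>\<^sub>F s in at t. D s \<noteq> 0"
      using \<open>(D \<longlongrightarrow> _) (at t)\<close> nz by (rule tendsto_imp_eventually_ne)
    moreover have "\<forall>\<^sub>F s in at t. s \<in> S"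
      using assms(1) t by (rule eventually_at_in_open')
    moreover have "\<forall>\<^sub>F s in at t. s \<noteq> t"
      by (simp add: eventually_at_filter)
    ultimately have "((\<lambda>s. (u s - u t) / (s - t)) \<longlongrightarrow> u' t) (at t)"
    proof -
      assume lim: "((\<lambda>s. - A s * inverse (D s)) \<longlongrightarrow> u' t) (at t)"
        and ev: "\<forall>\<^sub>F s in at t. D s \<noteq> 0" "\<forall>\<^sub>F s in at t. s \<in> S" "\<forall>\<^sub>F s in at t. s \<noteq> t"
      have "\<forall>\<^sub>F s in at t. - A s * inverse (D s) = (u s - u t) / (s - t)"
        using ev
      proof eventually_elim
        case (elim s)
        have "0 = (\<Sum>j\<le>n. c j s * u s ^ j) - (\<Sum>j\<le>n. c j t * u t ^ j)"
          using root t elim by simp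
        also have "\<dots> = (\<Sum>j\<le>n. (c j s - c j t) * u s ^ j + c j t * (u s ^ j - u t ^ j))"
          by (simp add: sum_subtractf algebra_simps)
        also have "\<dots> = (\<Sum>j\<le>n. (s - t) * ((c j s - c j t) / (s - t) * u s ^ j) + (u s - u t) * (c j t * q j (u s) (u t)))"
          using elim by (intro sum.cong refl) (simp add: q_diff)
        also have "\<dots> = (s - t) * A s + (u s - u t) * D s"
          by (simp add: A_def D_def sum.distrib sum_distrib_left)
        finally have "(u s - u t) * D s = - (s - t) * A s" by linarith
        then show ?case
          using elim by (simp add: field_simps)
      qed
      with lim show ?thesis
        by (rule Lim_transform_eventually)
    qed
    then show ?thesis by (simp add: has_field_derivative_iff)
  qed
  have ck: "Ck_on k S (c j)" if "j \<le> n" for j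
    using Suc.prems[OF that] by (rule Ck_on_Suc_imp)
  then have uk: "Ck_on k S u"
    using Suc.IH by auto
  have "Ck_on k S (\<lambda>t. (-1) * (\<Sum>j\<le>n. c' j t * u t ^ j) * inverse (\<Sum>j\<le>n. c j t * (real j * u t ^ (j - 1))))"
    using ck uk c'(2) simple
    by (intro Ck_on_mult Ck_on_inverse Ck_on_sum Ck_on_power Ck_on_const) auto
  then have "Ck_on k S u'"
    by (simp add: u'_def[abs_def])
  with du show ?case by auto
qed (use assms in simp)

section \<open>Products of linear factors and hyperbolic polynomials\<close>

abbreviation root_prod :: "nat set \<Rightarrow> (nat \<Rightarrow> real) \<Rightarrow> real poly" where
  "root_prod A u \<equiv> (\<Prod>i\<in>A. [:- u i, 1:])"

lemma poly_root_prod: "poly (root_prod A u) x = (\<Prod>i\<in>A. x - u i)"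
  by (simp add: poly_prod)

lemma poly_root_prod_eq_0: "finite A \<Longrightarrow> poly (root_prod A u) x = 0 \<longleftrightarrow> (\<exists>i\<in>A. u i = x)"
  by (auto simp: poly_root_prod)

lemma degree_root_prod: "degree (root_prod A u) = card A"
  by (subst degree_prod_eq_sum_degree) auto

lemma lead_coeff_root_prod: "lead_coeff (root_prod A u) = 1"
  by (simp add: lead_coeff_prod)

lemma poly_of_real_eq: "poly (map_poly of_real p) (complex_of_real x) = of_real (poly p x)"
  by (induction p) (auto simp: map_poly_pCons)

lemma map_poly_of_real_mult:
  "map_poly complex_of_real (p * q) = map_poly of_real p * map_poly of_real q"
  by (rule poly_eqI) (simp add: coeff_map_poly coeff_mult)

lemma hyperbolic_root_prod: "finite A \<Longrightarrow> hyperbolic (root_prod A u)"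
proof -
  assume A: "finite A"
  have "z \<in> \<real>" if "poly (map_poly of_real (root_prod A u)) z = 0" for z :: complex
    using A that
  proof (induction A)
    case (insert i A)
    have "map_poly complex_of_real [:- u i, 1:] = [:- of_real (u i), 1:]"
      by (simp add: map_poly_pCons)
    with insert show ?case
      by (auto simp: map_poly_of_real_mult simp del: mult_pCons_left)
  qed simp
  with lead_coeff_root_prod[where A = A and u = u] show ?thesis
    unfolding hyperbolic_def by blast
qed

lemma hyperbolic_nonzero: "hyperbolic p \<Longrightarrow> p \<noteq> 0"
  by (auto simp: hyperbolic_def)

lemma hyperbolic_has_root:
  assumes "hyperbolic p" "degree p > 0"
  shows "\<exists>x. poly p x = 0"
proof -
  have "\<not> constant (poly (map_poly complex_of_real p))"
    using assms by (simp add: constant_degree degree_map_poly)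
  then obtain z where z: "poly (map_poly complex_of_real p) z = 0"
    using fundamental_theorem_of_algebra by blast
  with assms(1) obtain x where "z = of_real x"
    unfolding hyperbolic_def by (metis Reals_cases)
  with z show ?thesis
    by (auto simp: poly_of_real_eq)
qed

lemma hyperbolic_divisor:
  assumes "hyperbolic (p * q)" "lead_coeff p = 1"
  shows "hyperbolic p"
  using assms by (auto simp: hyperbolic_def map_poly_of_real_mult)

definition max_root :: "real poly \<Rightarrow> real" where
  "max_root p = Max {x. poly p x = 0}"

text \<open>The roots in descending order, with multiplicities, by successive division by the largest one.\<close>

primrec desc_root :: "nat \<Rightarrow> real poly \<Rightarrow> real" where
  "desc_root 0 p = max_root p"
| "desc_root (Suc i) p = desc_root i (synthetic_div p (max_root p))"

lemma max_root:
  assumes "hyperbolic p" "degree p > 0"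
  shows "poly p (max_root p) = 0" and "\<And>x. poly p x = 0 \<Longrightarrow> x \<le> max_root p"
proof -
  have "finite {x. poly p x = 0}" "{x. poly p x = 0} \<noteq> {}"
    using assms hyperbolic_has_root by (auto simp: hyperbolic_nonzero poly_roots_finite)
  then show "poly p (max_root p) = 0" "\<And>x. poly p x = 0 \<Longrightarrow> x \<le> max_root p"
    using Max_in[of "{x. poly p x = 0}"] by (auto simp: max_root_def)
qed

lemma synthetic_div_max_root:
  assumes "hyperbolic p" "degree p = Suc n"
  shows "p = [:- max_root p, 1:] * synthetic_div p (max_root p)"
    and "hyperbolic (synthetic_div p (max_root p))" "degree (synthetic_div p (max_root p)) = n"
proof -
  let ?q = "synthetic_div p (max_root p)"
  show eq: "p = [:- max_root p, 1:] * ?q"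
    using synthetic_div_correct'[of "max_root p" p] max_root(1)[of p] assms by simp
  show "degree ?q = n"
    using assms by (simp add: degree_synthetic_div)
  have "lead_coeff ([:- max_root p, 1:] * ?q) = lead_coeff ?q"
    by (subst lead_coeff_mult) simp
  then have "lead_coeff p = lead_coeff ?q"
    using eq by metis
  then show "hyperbolic ?q"
    using hyperbolic_divisor[of ?q "[:- max_root p, 1:]"] eq assms(1)
    unfolding hyperbolic_def mult.commute[of ?q] by metis
qed

lemma hyperbolic_eq_root_prod:
  assumes "hyperbolic p" "degree p = n"
  shows "p = root_prod {..<n} (\<lambda>i. desc_root i p)"
  using assms
proof (induction n arbitrary: p)
  case 0
  then show ?case
    by (auto simp: hyperbolic_def elim!: degree_eq_zeroE)
next
  case (Suc n)
  let ?q = "synthetic_div p (max_root p)"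
  note q = synthetic_div_max_root[OF Suc.prems]
  have "p = [:- max_root p, 1:] * root_prod {..<n} (\<lambda>i. desc_root i ?q)"
    using q Suc.IH[OF q(2,3)] by simp
  also have "\<dots> = root_prod {..<Suc n} (\<lambda>i. desc_root i p)"
    by (subst prod.lessThan_Suc_shift) simp
  finally show ?case .
qed

lemma coeff_linear_mult:
  "coeff ([:a, 1:] * q) i = a * coeff q i + (if i = 0 then 0 else coeff q (i - 1))" for a :: real
  by (simp add: coeff_pCons split: nat.split)

lemma pcompose_root_prod:
  "pcompose (root_prod A u) [:c, 1:] = root_prod A (\<lambda>i. u i - c)"
  unfolding pcompose_prod by (intro prod.cong refl) (simp add: pcompose_pCons)

lemma coeffs_root_prod_nonneg:
  "finite A \<Longrightarrow> (\<And>i. i \<in> A \<Longrightarrow> u i \<le> 0) \<Longrightarrow> coeff (root_prod A u) j \<ge> 0"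
proof (induction A arbitrary: j rule: finite_induct)
  case (insert i A)
  then have "u i * coeff (root_prod A u) j \<le> 0" "0 \<le> coeff (root_prod A u) (j - 1)"
    by (auto intro!: mult_nonpos_nonneg)
  then have "0 \<le> - u i * coeff (root_prod A u) j + (if j = 0 then 0 else coeff (root_prod A u) (j - 1))"
    by (cases "j = 0") simp_all
  also have "\<dots> = coeff (root_prod (insert i A) u) j"
    using insert.hyps by (simp add: coeff_linear_mult del: mult_pCons_left)
  finally show ?case .
qed (simp add: coeff_pCons split: nat.split)

lemma coeffs_root_prod_pos:
  "finite A \<Longrightarrow> (\<And>i. i \<in> A \<Longrightarrow> u i < 0) \<Longrightarrow> j \<le> card A \<Longrightarrow> coeff (root_prod A u) j > 0"
proof (induction A arbitrary: j rule: finite_induct)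
  case (insert i A)
  have nn: "0 \<le> - u i * coeff (root_prod A u) j"
    using insert.prems insert.hyps by (intro mult_nonneg_nonneg coeffs_root_prod_nonneg) (auto intro: less_imp_le)
  have *: "coeff (root_prod (insert i A) u) j
      = - u i * coeff (root_prod A u) j + (if j = 0 then 0 else coeff (root_prod A u) (j - 1))"
    using insert.hyps by (simp add: coeff_linear_mult del: mult_pCons_left)
  show ?case
  proof (cases "j = 0")
    case True
    then have "0 < - u i * coeff (root_prod A u) j"
      using insert by (intro mult_pos_pos) auto
    with * True show ?thesis by simp
  next
    case False
    then have "0 < coeff (root_prod A u) (j - 1)"
      using insert by auto
    with * False nn show ?thesis by simp
  qed
qed simp

lemma no_positive_root_of_nonneg_coeffs:
  fixes q :: "real poly"
  assumes "\<And>i. coeff q i \<ge> 0" "lead_coeff q = 1" "poly q x = 0"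
  shows "x \<le> 0"
proof (rule ccontr)
  assume "\<not> x \<le> 0"
  then have x: "x > 0" by simp
  have "0 < lead_coeff q * x ^ degree q"
    using x assms(2) by simp
  also have "\<dots> \<le> (\<Sum>i\<le>degree q. coeff q i * x ^ i)"
    using x assms(1) by (intro member_le_sum) auto
  also have "\<dots> = poly q x"
    by (simp add: poly_altdef)
  finally show False using assms(3) by simp
qed

text \<open>Expanding at \<open>c\<close> expresses a bound for the largest root by the signs of finitely many Taylor
coefficients. This condition is closed in the coefficients, and the one in the next lemma is
open; together they give the continuity of the largest root.\<close>

lemma max_root_le_iff:
  assumes "hyperbolic p" "degree p > 0"
  shows "max_root p \<le> c \<longleftrightarrow> (\<forall>i. coeff (pcompose p [:c, 1:]) i \<ge> 0)"
proof
  have p: "p = root_prod {..<degree p} (\<lambda>i. desc_root i p)" (is "_ = root_prod ?A ?u")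
    using hyperbolic_eq_root_prod[OF assms(1) refl] .
  have shift: "pcompose p [:c, 1:] = root_prod ?A (\<lambda>i. ?u i - c)"
    by (subst p) (rule pcompose_root_prod)
  {
    assume le: "max_root p \<le> c"
    have "?u i \<le> c" if "i \<in> ?A" for i
    proof -
      have "poly p (?u i) = 0"
        using that by (subst p, subst poly_root_prod_eq_0) auto
      with max_root(2)[OF assms] le show ?thesis by fastforce
    qed
    then show "\<forall>i. coeff (pcompose p [:c, 1:]) i \<ge> 0"
      unfolding shift by (intro allI coeffs_root_prod_nonneg) auto
  next
    assume nn: "\<forall>i. coeff (pcompose p [:c, 1:]) i \<ge> 0"
    have "max_root p - c \<le> 0"
    proof (rule no_positive_root_of_nonneg_coeffs[of "pcompose p [:c, 1:]"])
      show "lead_coeff (pcompose p [:c, 1:]) = 1"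
        unfolding shift by (rule lead_coeff_root_prod)
      show "poly (pcompose p [:c, 1:]) (max_root p - c) = 0"
        using max_root(1)[OF assms] by (simp add: poly_pcompose)
    qed (use nn in auto)
    then show "max_root p \<le> c" by simp
  }
qed

lemma max_root_less_iff:
  assumes "hyperbolic p" "degree p > 0"
  shows "max_root p < c \<longleftrightarrow> (\<forall>i\<le>degree p. coeff (pcompose p [:c, 1:]) i > 0)"
proof
  have p: "p = root_prod {..<degree p} (\<lambda>i. desc_root i p)" (is "_ = root_prod ?A ?u")
    using hyperbolic_eq_root_prod[OF assms(1) refl] .
  have shift: "pcompose p [:c, 1:] = root_prod ?A (\<lambda>i. ?u i - c)"
    by (subst p) (rule pcompose_root_prod)
  {
    assume less: "max_root p < c"
    have "?u i < c" if "i \<in> ?A" for i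
    proof -
      have "poly p (?u i) = 0"
        using that by (subst p, subst poly_root_prod_eq_0) auto
      with max_root(2)[OF assms] less show ?thesis by fastforce
    qed
    then show "\<forall>i\<le>degree p. coeff (pcompose p [:c, 1:]) i > 0"
      unfolding shift by (intro allI impI coeffs_root_prod_pos) auto
  next
    assume pos: "\<forall>i\<le>degree p. coeff (pcompose p [:c, 1:]) i > 0"
    have "coeff (pcompose p [:c, 1:]) i \<ge> 0" for i
    proof (cases "i \<le> degree p")
      case False
      then have "coeff (pcompose p [:c, 1:]) i = 0"
        by (intro coeff_eq_0) (simp add: degree_pcompose)
      then show ?thesis by simp
    qed (use pos in \<open>auto intro: less_imp_le\<close>)
    then have "max_root p \<le> c"
      using max_root_le_iff[OF assms] by blast
    moreover have "poly p c = coeff (pcompose p [:c, 1:]) 0"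
      by (simp add: poly_pcompose flip: poly_0_coeff_0)
    then have "poly p c \<noteq> 0" using pos by (metis less_irrefl zero_le)
    then have "max_root p \<noteq> c" using max_root(1)[OF assms] by auto
    ultimately show "max_root p < c" by simp
  }
qed

section \<open>Rings of functions\<close>

text \<open>Continuous functions, \<open>C\<^sup>k\<close> functions, definable functions and their germs all form rings. The
coefficients of the polynomials below are obtained from given ones by ring operations, so one
proof covers all these classes. The set \<open>S\<close> is where the functions matter.\<close>

definition fun_ring_on :: "real set \<Rightarrow> ((real \<Rightarrow> real) \<Rightarrow> bool) \<Rightarrow> bool" where
  "fun_ring_on S K \<longleftrightarrow> (\<forall>c. K (\<lambda>_. c)) \<and>
     (\<forall>f g. K f \<longrightarrow> K g \<longrightarrow> K (\<lambda>t. f t + g t)) \<and>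
     (\<forall>f g. K f \<longrightarrow> K g \<longrightarrow> K (\<lambda>t. f t * g t)) \<and>
     (\<forall>f g. (\<forall>t\<in>S. f t = g t) \<longrightarrow> K f \<longrightarrow> K g)"

abbreviation coeffs_in :: "((real \<Rightarrow> real) \<Rightarrow> bool) \<Rightarrow> (real \<Rightarrow> real poly) \<Rightarrow> bool" where
  "coeffs_in K P \<equiv> (\<forall>j. K (\<lambda>t. coeff (P t) j))"

lemma fun_ring_onD:
  assumes "fun_ring_on S K"
  shows "K (\<lambda>_. c)" "K f \<Longrightarrow> K g \<Longrightarrow> K (\<lambda>t. f t + g t)" "K f \<Longrightarrow> K g \<Longrightarrow> K (\<lambda>t. f t * g t)"
    "K f \<Longrightarrow> (\<And>t. t \<in> S \<Longrightarrow> f t = g t) \<Longrightarrow> K g"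
proof -
  note K = assms[unfolded fun_ring_on_def]
  show "K (\<lambda>_. c)"
    by (rule K[THEN conjunct1, THEN spec])
  show "K f \<Longrightarrow> K g \<Longrightarrow> K (\<lambda>t. f t + g t)"
    by (rule K[THEN conjunct2, THEN conjunct1, rule_format])
  show "K f \<Longrightarrow> K g \<Longrightarrow> K (\<lambda>t. f t * g t)"
    by (rule K[THEN conjunct2, THEN conjunct2, THEN conjunct1, rule_format])
  show "K f \<Longrightarrow> (\<And>t. t \<in> S \<Longrightarrow> f t = g t) \<Longrightarrow> K g"
    by (rule K[THEN conjunct2, THEN conjunct2, THEN conjunct2, rule_format, of f g])
qed

lemma fun_ring_on_sum:
  "fun_ring_on S K \<Longrightarrow> (\<And>i. i \<in> A \<Longrightarrow> K (f i)) \<Longrightarrow> K (\<lambda>t. \<Sum>i\<in>A. f i t)"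
proof (induction A rule: infinite_finite_induct)
  case (insert i A)
  then have "K (\<lambda>t. f i t + (\<Sum>i\<in>A. f i t))"
    by (intro fun_ring_onD(2)[OF insert.prems(1)]) simp_all
  with insert.hyps show ?case by simp
qed (simp_all add: fun_ring_onD(1))

lemma fun_ring_on_power: "fun_ring_on S K \<Longrightarrow> K f \<Longrightarrow> K (\<lambda>t. f t ^ m)"
proof (induction m)
  case (Suc m)
  then have "K (\<lambda>t. f t * f t ^ m)"
    by (intro fun_ring_onD(3)[OF Suc.prems(1)])
  then show ?case by simp
qed (simp add: fun_ring_onD(1))

lemma fun_ring_on_uminus: "fun_ring_on S K \<Longrightarrow> K f \<Longrightarrow> K (\<lambda>t. - f t)"
  using fun_ring_onD(3)[of S K "\<lambda>_. -1" f] fun_ring_onD(1)[of S K "-1"] by auto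

lemma fun_ring_on_scale: "fun_ring_on S K \<Longrightarrow> K f \<Longrightarrow> K (\<lambda>t. c * f t)"
  by (rule fun_ring_onD(3)[of S K "\<lambda>_. c" f]) (simp_all add: fun_ring_onD(1))

lemma fun_ring_on_diff: "fun_ring_on S K \<Longrightarrow> K f \<Longrightarrow> K g \<Longrightarrow> K (\<lambda>t. f t - g t)"
  using fun_ring_onD(2)[of S K f "\<lambda>t. - g t"] fun_ring_on_uminus[of S K g] by simp

lemma coeffs_in_mult: "fun_ring_on S K \<Longrightarrow> coeffs_in K P \<Longrightarrow> coeffs_in K Q \<Longrightarrow> coeffs_in K (\<lambda>t. P t * Q t)"
  unfolding coeff_mult by (intro allI fun_ring_on_sum[of S K] fun_ring_onD(3)[of S K]) simp_all

lemma coeffs_in_const: "fun_ring_on S K \<Longrightarrow> coeffs_in K (\<lambda>_. p)"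
  by (simp add: fun_ring_onD(1))

lemma coeffs_in_linear:
  assumes "fun_ring_on S K" "K u"
  shows "coeffs_in K (\<lambda>t. [:u t, 1:])"
proof
  fix j
  show "K (\<lambda>t. coeff [:u t, 1:] j)"
    using assms by (cases j; cases "j - 1") (simp_all add: fun_ring_onD(1))
qed

lemma coeffs_in_sum:
  "fun_ring_on S K \<Longrightarrow> (\<And>i. i \<in> A \<Longrightarrow> coeffs_in K (P i)) \<Longrightarrow> coeffs_in K (\<lambda>t. \<Sum>i\<in>A. P i t)"
  unfolding coeff_sum by (intro allI fun_ring_on_sum[of S K]) simp_all

lemma coeffs_in_prod:
  "fun_ring_on S K \<Longrightarrow> (\<And>i. i \<in> A \<Longrightarrow> coeffs_in K (P i)) \<Longrightarrow> coeffs_in K (\<lambda>t. \<Prod>i\<in>A. P i t)"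
proof (induction A rule: infinite_finite_induct)
  case (insert i A)
  then have "coeffs_in K (\<lambda>t. P i t * (\<Prod>i\<in>A. P i t))"
    by (intro coeffs_in_mult[OF insert.prems(1)]) simp_all
  with insert.hyps show ?case by simp
qed (use coeffs_in_const[of S K 1] in simp_all)

lemma coeffs_in_root_prod:
  "fun_ring_on S K \<Longrightarrow> (\<And>i. i \<in> A \<Longrightarrow> K (u i)) \<Longrightarrow> coeffs_in K (\<lambda>t. root_prod A (\<lambda>i. u i t))"
  by (rule coeffs_in_prod[of S K], assumption, rule coeffs_in_linear[of S K], assumption, rule fun_ring_on_uminus[of S K])
    simp_all

lemma pcompose_eq_sum:
  fixes p :: "real poly"
  assumes "degree p \<le> n"
  shows "pcompose p q = (\<Sum>i\<le>n. smult (coeff p i) (q ^ i))"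
proof -
  have "pcompose p q = (\<Sum>i\<le>degree p. smult (coeff p i) (q ^ i))"
    by (simp add: pcompose_altdef poly_altdef coeff_map_poly degree_map_poly)
  also have "\<dots> = (\<Sum>i\<le>n. smult (coeff p i) (q ^ i))"
    using assms by (intro sum.mono_neutral_left) (auto simp: coeff_eq_0)
  finally show ?thesis .
qed

lemma coeffs_in_pcompose:
  assumes K: "fun_ring_on S K" and "coeffs_in K P" "K c" "\<And>t. t \<in> S \<Longrightarrow> degree (P t) \<le> n"
  shows "coeffs_in K (\<lambda>t. pcompose (P t) [:c t, 1:])"
proof
  fix j
  have "coeffs_in K (\<lambda>t. \<Sum>i\<le>n. [:coeff (P t) i:] * (\<Prod>_\<in>{..<i}. [:c t, 1:]))"
  proof (intro coeffs_in_sum[OF K] coeffs_in_mult[OF K] coeffs_in_prod[OF K] coeffs_in_linear[OF K] assms(3))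
    fix i
    have "K (\<lambda>t. coeff [:coeff (P t) i:] j)" for j
      using assms(2) fun_ring_onD(1)[OF K] by (cases j) auto
    then show "coeffs_in K (\<lambda>t. [:coeff (P t) i:])" by blast
  qed
  then have "K (\<lambda>t. coeff (\<Sum>i\<le>n. [:coeff (P t) i:] * (\<Prod>_\<in>{..<i}. [:c t, 1:])) j)"
    by blast
  then show "K (\<lambda>t. coeff (pcompose (P t) [:c t, 1:]) j)"
    by (rule fun_ring_onD(4)[OF K]) (simp add: pcompose_eq_sum[OF assms(4)])
qed

lemma poly_eq_sum:
  fixes p :: "real poly"
  assumes "degree p \<le> n"
  shows "poly p x = (\<Sum>i\<le>n. coeff p i * x ^ i)"
proof -
  have "poly p x = (\<Sum>i\<le>degree p. coeff p i * x ^ i)"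
    by (rule poly_altdef)
  also have "\<dots> = (\<Sum>i\<le>n. coeff p i * x ^ i)"
    using assms by (intro sum.mono_neutral_left) (auto simp: coeff_eq_0)
  finally show ?thesis .
qed

text \<open>Horner's scheme: division by a linear factor uses ring operations only.\<close>

lemma coeff_synthetic_div:
  fixes p :: "real poly"
  assumes "degree p \<le> n"
  shows "coeff (synthetic_div p c) i = (\<Sum>k<n. coeff p (Suc (i + k)) * c ^ k)"
proof -
  let ?q = "synthetic_div p c"
  have rec: "coeff ?q i = coeff p (Suc i) + c * coeff ?q (Suc i)" for i
  proof -
    have "coeff p (Suc i) = coeff ([:-c, 1:] * ?q + [:poly p c:]) (Suc i)"
      by (simp only: synthetic_div_correct')
    then show ?thesis by simp
  qed
  have iter: "coeff ?q i = (\<Sum>k<m. coeff p (Suc (i + k)) * c ^ k) + c ^ m * coeff ?q (i + m)" for m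
  proof (induction m)
    case (Suc m)
    then show ?case by (simp add: rec[of "i + m"] algebra_simps)
  qed simp
  have "coeff ?q (i + n) = 0"
  proof (cases "degree p = 0")
    case True
    then show ?thesis by (simp add: synthetic_div_eq_0_iff[THEN iffD2])
  next
    case False
    with assms show ?thesis
      by (intro coeff_eq_0) (simp add: degree_synthetic_div)
  qed
  then show ?thesis using iter[of n] by simp
qed

text \<open>A function class that contains the largest root contains all ordered roots, because the
coefficients of the quotients by linear factors stay in the class.\<close>

lemma desc_root_in_fun_ring:
  assumes K: "fun_ring_on S K"
    and max: "\<And>P n. coeffs_in K P \<Longrightarrow> (\<And>t. t \<in> S \<Longrightarrow> hyperbolic (P t) \<and> degree (P t) = Suc n) \<Longrightarrow>
               K (\<lambda>t. max_root (P t))"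
    and P: "coeffs_in K P" "\<And>t. t \<in> S \<Longrightarrow> hyperbolic (P t) \<and> degree (P t) = n"
    and "i < n"
  shows "K (\<lambda>t. desc_root i (P t))"
  using P \<open>i < n\<close>
proof (induction i arbitrary: n P)
  case 0
  then show ?case using max[of P "n - 1"] by simp
next
  case (Suc i)
  then obtain m where n: "n = Suc m" by (cases n) auto
  have mr: "K (\<lambda>t. max_root (P t))"
    using max[of P m] Suc.prems n by simp
  have "K (\<lambda>t. desc_root i (synthetic_div (P t) (max_root (P t))))"
  proof (rule Suc.IH)
    show "coeffs_in K (\<lambda>t. synthetic_div (P t) (max_root (P t)))"
    proof
      fix j
      have "K (\<lambda>t. \<Sum>k<n. coeff (P t) (Suc (j + k)) * max_root (P t) ^ k)"
        using Suc.prems(1) mr by (intro fun_ring_on_sum[OF K] fun_ring_onD(3)[OF K] fun_ring_on_power[OF K]) auto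
      then show "K (\<lambda>t. coeff (synthetic_div (P t) (max_root (P t))) j)"
        by (rule fun_ring_onD(4)[OF K]) (simp add: coeff_synthetic_div[of _ n] Suc.prems(2))
    qed
    fix t assume "t \<in> S"
    with Suc.prems(2) n show "hyperbolic (synthetic_div (P t) (max_root (P t))) \<and>
        degree (synthetic_div (P t) (max_root (P t))) = m"
      using synthetic_div_max_root[of "P t" m] by auto
  qed (use Suc.prems n in auto)
  then show ?case by simp
qed

lemma fun_ring_continuous_on: "fun_ring_on S (continuous_on S)"
  unfolding fun_ring_on_def by (auto intro: continuous_intros cong: continuous_on_cong)

lemma continuous_on_max_root:
  assumes P: "coeffs_in (continuous_on S) P" "\<And>t. t \<in> S \<Longrightarrow> hyperbolic (P t) \<and> degree (P t) = Suc n"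
  shows "continuous_on S (\<lambda>t. max_root (P t))"
  unfolding continuous_on_def
proof
  fix t0 assume t0: "t0 \<in> S"
  have lim: "((\<lambda>t. coeff (pcompose (P t) [:c, 1:]) i) \<longlongrightarrow> coeff (pcompose (P t0) [:c, 1:]) i) (at t0 within S)" for c i
    using coeffs_in_pcompose[OF fun_ring_continuous_on P(1), of "\<lambda>_. c" "Suc n"] P(2) t0
    unfolding continuous_on_def by auto
  have inS: "\<forall>\<^sub>F t in at t0 within S. t \<in> S"
    by (simp add: eventually_at_filter)
  show "((\<lambda>t. max_root (P t)) \<longlongrightarrow> max_root (P t0)) (at t0 within S)"
  proof (rule order_tendstoI)
    fix b assume "max_root (P t0) < b"
    then have "\<forall>i\<le>Suc n. coeff (pcompose (P t0) [:b, 1:]) i > 0"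
      using max_root_less_iff[of "P t0"] P(2)[OF t0] by simp
    then have "\<forall>i\<in>{..Suc n}. \<forall>\<^sub>F t in at t0 within S. coeff (pcompose (P t) [:b, 1:]) i > 0"
      using order_tendstoD(1)[OF lim] by auto
    then have "\<forall>\<^sub>F t in at t0 within S. \<forall>i\<in>{..Suc n}. coeff (pcompose (P t) [:b, 1:]) i > 0"
      by (intro eventually_ball_finite) auto
    then show "\<forall>\<^sub>F t in at t0 within S. max_root (P t) < b"
      using inS by eventually_elim (use max_root_less_iff P(2) in auto)
  next
    fix a assume "a < max_root (P t0)"
    then have "\<not> (\<forall>i. 0 \<le> coeff (pcompose (P t0) [:a, 1:]) i)"
      using max_root_le_iff[of "P t0" a] P(2)[OF t0] by simp
    then obtain i where "coeff (pcompose (P t0) [:a, 1:]) i < 0"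
      by (auto simp: not_le)
    then have "\<forall>\<^sub>F t in at t0 within S. coeff (pcompose (P t) [:a, 1:]) i < 0"
      using order_tendstoD(2)[OF lim] by auto
    then show "\<forall>\<^sub>F t in at t0 within S. a < max_root (P t)"
      using inS
    proof eventually_elim
      case (elim t)
      then have "\<not> (\<forall>i. 0 \<le> coeff (pcompose (P t) [:a, 1:]) i)"
        by (metis not_le)
      moreover have "max_root (P t) \<le> a \<longleftrightarrow> (\<forall>i. 0 \<le> coeff (pcompose (P t) [:a, 1:]) i)"
        using P(2)[of t] elim by (intro max_root_le_iff) auto
      ultimately have "\<not> max_root (P t) \<le> a" by blast
      then show ?case by simp
    qed
  qed
qed

lemma continuous_on_desc_root:
  assumes "coeffs_in (continuous_on S) P" "\<And>t. t \<in> S \<Longrightarrow> hyperbolic (P t) \<and> degree (P t) = n" "i < n"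
  shows "continuous_on S (\<lambda>t. desc_root i (P t))"
  by (rule desc_root_in_fun_ring[OF fun_ring_continuous_on _ assms]) (rule continuous_on_max_root)

section \<open>Factors\<close>

lemma root_prod_dvd_factor:
  fixes p q :: "real poly"
  assumes "finite A" "root_prod A u dvd p * q" "\<And>i. i \<in> A \<Longrightarrow> poly q (u i) \<noteq> 0"
  shows "root_prod A u dvd p"
  using assms
proof (induction A arbitrary: p rule: finite_induct)
  case (insert i A)
  have i: "root_prod (insert i A) u = [:- u i, 1:] * root_prod A u"
    using insert.hyps by simp
  have "[:- u i, 1:] dvd p * q"
    using insert.prems(1) unfolding i by (rule dvd_mult_left)
  then have "poly (p * q) (u i) = 0"
    unfolding poly_eq_0_iff_dvd .
  then have "poly p (u i) = 0"
    using insert.prems(2)[of i] by simp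
  then obtain p' where p': "p = [:- u i, 1:] * p'"
    unfolding poly_eq_0_iff_dvd by (rule dvdE)
  have "[:- u i, 1:] * root_prod A u dvd [:- u i, 1:] * (p' * q)"
    using insert.prems(1) unfolding i p' mult.assoc .
  then have "root_prod A u dvd p' * q"
    using dvd_mult_cancel_left[of "[:- u i, 1:]" "root_prod A u" "p' * q"]
    by (simp del: mult_pCons_left)
  then have "root_prod A u dvd p'"
    by (rule insert.IH) (rule insert.prems(2), rule insertI2)
  then show ?case
    unfolding i p' by (rule mult_dvd_mono[OF dvd_refl])
qed simp

text \<open>The cofactors are units, and a monic unit is \<open>1\<close>.\<close>

lemma monic_cofactors:
  fixes p1 p2 q1 q2 :: "real poly"
  assumes "q1 dvd p1" "q2 dvd p2" "p1 * p2 = q1 * q2"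
    "lead_coeff p1 = 1" "lead_coeff p2 = 1" "lead_coeff q1 = 1" "lead_coeff q2 = 1"
  shows "p1 = q1 \<and> p2 = q2"
proof -
  obtain r1 r2 where r: "p1 = q1 * r1" "p2 = q2 * r2"
    using assms(1,2) by (metis dvdE)
  have q: "q1 \<noteq> 0" "q2 \<noteq> 0" using assms by auto
  have "(q1 * q2) * (r1 * r2) = q1 * q2 * 1"
    using assms(3) r by (simp add: algebra_simps)
  then have "r1 * r2 = 1"
    using mult_left_cancel[of "q1 * q2" "r1 * r2" 1] q by simp
  then have "is_unit r1" "is_unit r2"
    using dvd_triv_left[of r1 r2] dvd_triv_right[of r2 r1] by simp_all
  then obtain c1 c2 where "r1 = [:c1:]" "r2 = [:c2:]"
    by (auto simp: is_unit_poly_iff)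
  moreover have "lead_coeff r1 = 1" "lead_coeff r2 = 1"
    using assms r by (simp_all add: lead_coeff_mult)
  ultimately show ?thesis using r by simp
qed

lemma coeff_root_prod_scale:
  assumes "finite A" "i \<le> card A"
  shows "coeff (root_prod A (\<lambda>i. s * u i)) i = s ^ (card A - i) * coeff (root_prod A u) i"
  using assms
proof (induction A arbitrary: i rule: finite_induct)
  case (insert k A)
  have eq: "coeff (root_prod (insert k A) v) i
      = - v k * coeff (root_prod A v) i + (if i = 0 then 0 else coeff (root_prod A v) (i - 1))" for v
    using insert.hyps by (simp add: coeff_linear_mult del: mult_pCons_left)
  have c: "card (insert k A) = Suc (card A)" using insert.hyps by simp
  have 1: "s * coeff (root_prod A (\<lambda>i. s * u i)) i = s ^ (Suc (card A) - i) * coeff (root_prod A u) i"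
  proof (cases "i \<le> card A")
    case True
    then show ?thesis using insert.IH[of i] by (simp add: Suc_diff_le)
  next
    case False
    then have "coeff (root_prod A v) i = 0" for v
      by (intro coeff_eq_0) (simp add: degree_root_prod)
    then show ?thesis by simp
  qed
  have 2: "coeff (root_prod A (\<lambda>i. s * u i)) (i - 1) = s ^ (Suc (card A) - i) * coeff (root_prod A u) (i - 1)"
    if "i \<noteq> 0"
    using that insert.IH[of "i - 1"] insert.prems c by (cases i) auto
  have "coeff (root_prod (insert k A) (\<lambda>i. s * u i)) i
      = - u k * (s * coeff (root_prod A (\<lambda>i. s * u i)) i)
        + (if i = 0 then 0 else coeff (root_prod A (\<lambda>i. s * u i)) (i - 1))"
    unfolding eq by simp
  also have "\<dots> = s ^ (Suc (card A) - i) * coeff (root_prod (insert k A) u) i"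
    unfolding eq 1 using 2 by (cases "i = 0") (simp_all add: algebra_simps)
  finally show ?case unfolding c .
qed simp

lemma coeff_root_prod_sub1:
  "n \<ge> 1 \<Longrightarrow> coeff (root_prod {..<n} u) (n - 1) = - (\<Sum>i<n. u i)"
proof (induction n)
  case (Suc n)
  have "coeff (root_prod {..<n} u) n = 1"
    using lead_coeff_root_prod[of u "{..<n}"] by (simp add: degree_root_prod)
  moreover have "coeff (root_prod {..<Suc n} u) (Suc n - 1)
      = - u n * coeff (root_prod {..<n} u) n + (if n = 0 then 0 else coeff (root_prod {..<n} u) (n - 1))"
    by (simp add: lessThan_Suc coeff_linear_mult del: mult_pCons_left)
  ultimately show ?case using Suc.IH by (cases "n = 0") auto
qed simp

text \<open>Newton's identity for the second power sum. It controls all roots by the second coefficient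
once their sum is \<open>0\<close>.\<close>

lemma coeff_root_prod_sub2:
  "n \<ge> 2 \<Longrightarrow> 2 * coeff (root_prod {..<n} u) (n - 2) = (\<Sum>i<n. u i)\<^sup>2 - (\<Sum>i<n. (u i)\<^sup>2)"
proof (induction n rule: nat_induct_at_least)
  case base
  then show ?case by (simp add: numeral_2_eq_2 lessThan_Suc power2_eq_square algebra_simps)
next
  case (Suc n)
  have "coeff (root_prod {..<Suc n} u) (Suc n - 2)
      = - u n * coeff (root_prod {..<n} u) (n - 1) + coeff (root_prod {..<n} u) (n - 2)"
    using Suc.hyps by (simp add: lessThan_Suc coeff_linear_mult numeral_2_eq_2 Suc_diff_Suc del: mult_pCons_left)
  then show ?case
    using Suc coeff_root_prod_sub1[of n u] by (simp add: power2_eq_square algebra_simps)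
qed

text \<open>In particular the derivative of order \<open>m - 1\<close> has a simple root where the polynomial has one
of order \<open>m\<close>.\<close>

lemma order_higher_pderiv:
  fixes p :: "real poly"
  assumes "p \<noteq> 0" "k \<le> order a p"
  shows "(pderiv ^^ k) p \<noteq> 0 \<and> order a ((pderiv ^^ k) p) = order a p - k"
  using assms(2)
proof (induction k)
  case (Suc k)
  let ?q = "(pderiv ^^ k) p"
  have q: "?q \<noteq> 0" "order a ?q = order a p - k" using Suc by auto
  then have o: "order a ?q \<noteq> 0" using Suc.prems by simp
  then have root: "poly ?q a = 0" using order_root by blast
  have "pderiv ?q \<noteq> 0"
  proof
    assume "pderiv ?q = 0"
    then have "degree ?q = 0" by (simp add: pderiv_eq_0_iff)
    with root q show False by (auto elim!: degree_eq_zeroE)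
  qed
  with order_pderiv[OF q(1) root] q show ?case by simp
qed (use assms in simp)

lemma poly_pderiv_eq_sum:
  fixes p :: "real poly"
  assumes "degree p \<le> n"
  shows "poly (pderiv p) x = (\<Sum>j\<le>n. coeff p j * (real j * x ^ (j - 1)))"
proof -
  have "poly (pderiv p) x = (\<Sum>j\<le>n. coeff (pderiv p) j * x ^ j)"
    using assms by (intro poly_eq_sum) (simp add: degree_pderiv)
  also have "\<dots> = (\<Sum>j<n. coeff (pderiv p) j * x ^ j) + coeff (pderiv p) n * x ^ n"
    by (simp flip: lessThan_Suc_atMost)
  also have "coeff (pderiv p) n = 0"
    using assms by (simp add: coeff_pderiv coeff_eq_0)
  also have "(\<Sum>j<n. coeff (pderiv p) j * x ^ j) + 0 * x ^ n
      = (\<Sum>j<n. coeff p (Suc j) * (real (Suc j) * x ^ (Suc j - 1)))"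
    by (simp add: coeff_pderiv algebra_simps)
  also have "\<dots> = (\<Sum>j<Suc n. coeff p j * (real j * x ^ (j - 1)))"
    by (subst sum.lessThan_Suc_shift) simp
  finally show ?thesis by (simp add: lessThan_Suc_atMost)
qed

section \<open>Definable sets, terms and functions\<close>

context o_minimal
begin

abbreviation dset :: "nat \<Rightarrow> (real list \<Rightarrow> bool) \<Rightarrow> bool" where
  "dset n Q \<equiv> {x. length x = n \<and> Q x} \<in> M n"

lemma dset_cong:
  "dset n Q \<Longrightarrow> (\<And>x. length x = n \<Longrightarrow> Q x \<longleftrightarrow> R x) \<Longrightarrow> dset n R"
proof -
  assume "dset n Q" and "\<And>x. length x = n \<Longrightarrow> Q x \<longleftrightarrow> R x"
  moreover from this(2) have "{x. length x = n \<and> Q x} = {x. length x = n \<and> R x}" by blast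
  ultimately show ?thesis by simp
qed

lemma dset_polynomial_eq_0: "n \<ge> 1 \<Longrightarrow> polynomial_on_lists n f \<Longrightarrow> dset n (\<lambda>x. f x = 0)"
  using polynomial_sets[of n f "{}"] by simp

lemma dset_polynomial_pos: "n \<ge> 1 \<Longrightarrow> polynomial_on_lists n f \<Longrightarrow> dset n (\<lambda>x. f x > 0)"
  using polynomial_sets[of n "\<lambda>_. 0" "{f}"] polynomial_on_lists.const[of n 0] by simp

lemma dset_True: "n \<ge> 1 \<Longrightarrow> dset n (\<lambda>_. True)"
  using dset_polynomial_eq_0[of n "\<lambda>_. 0"] polynomial_on_lists.const[of n 0] by simp

lemma dset_conj:
  assumes "n \<ge> 1" "dset n Q" "dset n R"
  shows "dset n (\<lambda>x. Q x \<and> R x)"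
proof -
  have "{x. length x = n \<and> Q x} \<inter> {x. length x = n \<and> R x} = {x. length x = n \<and> Q x \<and> R x}"
    by blast
  with closed_Int[OF assms] show ?thesis by simp
qed

lemma dset_not:
  assumes "n \<ge> 1" "dset n Q"
  shows "dset n (\<lambda>x. \<not> Q x)"
proof -
  have "{x. length x = n \<and> True} - {x. length x = n \<and> Q x} = {x. length x = n \<and> \<not> Q x}"
    by blast
  with closed_Diff[OF assms(1) dset_True[OF assms(1)] assms(2)] show ?thesis by simp
qed

lemma dset_disj:
  assumes "n \<ge> 1" "dset n Q" "dset n R"
  shows "dset n (\<lambda>x. Q x \<or> R x)"
  by (rule dset_cong[OF dset_not[OF assms(1) dset_conj[OF assms(1) dset_not[OF assms(1,2)] dset_not[OF assms(1,3)]]]])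
    simp

lemma dset_imp:
  assumes "n \<ge> 1" "dset n Q" "dset n R"
  shows "dset n (\<lambda>x. Q x \<longrightarrow> R x)"
  by (rule dset_cong[OF dset_disj[OF assms(1) dset_not[OF assms(1,2)] assms(3)]]) simp

lemma dset_all_less: "n \<ge> 1 \<Longrightarrow> (\<And>i. i < m \<Longrightarrow> dset n (Q i)) \<Longrightarrow> dset n (\<lambda>x. \<forall>i<m. Q i x)"
  for m :: nat
proof (induction m)
  case 0
  then show ?case using dset_True by simp
next
  case (Suc m)
  have "dset n (\<lambda>x. (\<forall>i<m. Q i x) \<and> Q m x)"
    using Suc by (intro dset_conj) auto
  then show ?case by (rule dset_cong) (auto simp: less_Suc_eq)
qed

lemma polynomial_on_lists_diff:
  assumes "polynomial_on_lists n f" "polynomial_on_lists n g"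
  shows "polynomial_on_lists n (\<lambda>x. f x - g x)"
proof -
  have "polynomial_on_lists n (\<lambda>x. f x + (- 1) * g x)"
    by (intro polynomial_on_lists.intros assms)
  then show ?thesis by simp
qed

lemma dset_eq_coord: "i < n \<Longrightarrow> j < n \<Longrightarrow> dset n (\<lambda>x. x ! i = x ! j)"
  by (rule dset_cong[OF dset_polynomial_eq_0[of n "\<lambda>x. x ! i - x ! j"]])
     (auto intro!: polynomial_on_lists_diff polynomial_on_lists.coord)

lemma dset_ex:
  assumes "n \<ge> 1" "dset (Suc n) Q"
  shows "dset n (\<lambda>x. \<exists>y. Q (x @ [y]))"
proof -
  have "(\<lambda>x. map (\<lambda>k. x ! k) [0..<n]) ` {x. length x = Suc n \<and> Q x} \<in> M (length [0..<n])"
    by (rule closed_proj) (use assms in auto)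
  moreover have "(\<lambda>x. map (\<lambda>k. x ! k) [0..<n]) ` {x. length x = Suc n \<and> Q x}
      = {x. length x = n \<and> (\<exists>y. Q (x @ [y]))}" (is "?f ` ?A = ?B")
  proof (intro equalityI subsetI)
    fix z assume "z \<in> ?f ` ?A"
    then obtain x where x: "length x = Suc n" "Q x" "z = map (\<lambda>k. x ! k) [0..<n]" by auto
    then have "x = take n x @ [x ! n]"
      by (metis lessI take_Suc_conv_app_nth take_all_iff le_refl)
    moreover have "z = take n x"
      using x by (intro nth_equalityI) auto
    ultimately have "z = take n x" "Q (take n x @ [x ! n])" using x by auto
    then show "z \<in> ?B" using x(1) by (auto intro!: exI[of _ "x ! n"])
  next
    fix z assume "z \<in> ?B"
    then obtain y where y: "length z = n" "Q (z @ [y])" by auto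
    moreover have "z = ?f (z @ [y])"
      using y by (intro nth_equalityI) (auto simp: nth_append)
    ultimately show "z \<in> ?f ` ?A" by (intro image_eqI[of _ _ "z @ [y]"]) auto
  qed
  ultimately show ?thesis by simp
qed

lemma dset_all:
  assumes "n \<ge> 1" "dset (Suc n) Q"
  shows "dset n (\<lambda>x. \<forall>y. Q (x @ [y]))"
proof -
  have "dset n (\<lambda>x. \<not> (\<exists>y. \<not> Q (x @ [y])))"
    using assms by (intro dset_not dset_ex[of n "\<lambda>x. \<not> Q x"]) auto
  then show ?thesis by simp
qed

text \<open>Renaming, repeating and permuting coordinates. Projections of an o-minimal structure only forget
coordinates; so the renamed point is appended as a second block, tied to the first block by
equations, and then projected away.\<close>

lemma dset_subst:
  assumes "n \<ge> 1" "ks \<noteq> []" "set ks \<subseteq> {..<n}" "dset (length ks) Q"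
  shows "dset n (\<lambda>x. Q (map (\<lambda>k. x ! k) ks))"
proof -
  let ?k = "length ks"
  let ?T = "{x @ y |x y. x \<in> {x. length x = n \<and> True} \<and> y \<in> {y. length y = ?k \<and> Q y}}"
  let ?E = "{v. length v = n + ?k \<and> (\<forall>i<?k. v ! (n + i) = v ! (ks ! i))}"
  let ?f = "\<lambda>x. map (\<lambda>k. x ! k) [0..<n] :: real list"
  have ks: "ks ! i < n" if "i < ?k" for i
    using that assms(3) by (auto simp: subset_iff)
  have "?T \<in> M (n + ?k)"
    using assms by (intro closed_Times dset_True) (auto simp: Suc_le_eq)
  moreover have "?E \<in> M (n + ?k)"
    using assms(1) ks by (intro dset_all_less dset_eq_coord) (auto intro: trans_less_add1)
  ultimately have "?T \<inter> ?E \<in> M (n + ?k)"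
    using assms(1) by (intro closed_Int) auto
  then have "?f ` (?T \<inter> ?E) \<in> M (length [0..<n])"
    using assms(1) by (intro closed_proj) auto
  moreover have "?f ` (?T \<inter> ?E) = {x. length x = n \<and> Q (map (\<lambda>k. x ! k) ks)}" (is "_ = ?B")
  proof (intro equalityI subsetI)
    fix z assume "z \<in> ?f ` (?T \<inter> ?E)"
    then obtain x y where xy: "length x = n" "length y = ?k" "Q y" "z = ?f (x @ y)"
      "\<forall>i<?k. (x @ y) ! (n + i) = (x @ y) ! (ks ! i)" by auto
    then have "z = x" by (intro nth_equalityI) (auto simp: nth_append)
    moreover have "y = map (\<lambda>k. x ! k) ks"
      using xy ks by (intro nth_equalityI) (auto simp: nth_append)
    ultimately show "z \<in> ?B" using xy by auto
  next
    fix z assume z: "z \<in> ?B"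
    let ?v = "z @ map (\<lambda>k. z ! k) ks"
    have "length (map (\<lambda>k. z ! k) ks) = ?k" by simp
    with z have "?v \<in> ?T" by blast
    moreover have "?v \<in> ?E" using z ks by (auto simp: nth_append)
    moreover have "z = ?f ?v"
      using z by (intro nth_equalityI) (auto simp: nth_append)
    ultimately show "z \<in> ?f ` (?T \<inter> ?E)" by blast
  qed
  ultimately show ?thesis by simp
qed

text \<open>Terms are total functions, which frees them from side conditions; functions that are definable
on a set only enter through their extension by zero below. The last coordinate is the value.\<close>

definition dterm :: "nat \<Rightarrow> (real list \<Rightarrow> real) \<Rightarrow> bool" where
  "dterm n F \<longleftrightarrow> dset (Suc n) (\<lambda>x. x ! n = F (take n x))"

lemma dterm_coord: "i < n \<Longrightarrow> dterm n (\<lambda>x. x ! i)"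
  unfolding dterm_def by (rule dset_cong[OF dset_eq_coord[of n "Suc n" i]]) auto

lemma dterm_const: "dterm n (\<lambda>_. c)"
  unfolding dterm_def
  by (rule dset_cong[OF dset_polynomial_eq_0[of "Suc n" "\<lambda>x. x ! n - c"]])
     (auto intro!: polynomial_on_lists_diff polynomial_on_lists.coord polynomial_on_lists.const)

lemma dset_term:
  assumes n: "n \<ge> 1" and Q: "dset 1 (\<lambda>x. Q (x ! 0))" and F: "dterm n F"
  shows "dset n (\<lambda>x. Q (F x))"
proof -
  have "dset (Suc n) (\<lambda>x. Q (map (\<lambda>k. x ! k) [n] ! 0))"
    using Q by (intro dset_subst) auto
  then have "dset (Suc n) (\<lambda>x. x ! n = F (take n x) \<and> Q (map (\<lambda>k. x ! k) [n] ! 0))"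
    using F by (intro dset_conj) (auto simp: dterm_def)
  then have "dset n (\<lambda>x. \<exists>y. (x @ [y]) ! n = F (take n (x @ [y])) \<and> Q (map (\<lambda>k. (x @ [y]) ! k) [n] ! 0))"
    by (rule dset_ex[OF n])
  then show ?thesis
    by (rule dset_cong) (auto simp: nth_append)
qed

text \<open>The two values are existentially quantified as additional coordinates.\<close>

lemma dterm_binary:
  assumes n: "n \<ge> 1"
    and R: "dset 3 R" "\<And>u v z. R [u, v, z] \<longleftrightarrow> z = opr u v"
    and F: "dterm n F" and G: "dterm n G"
  shows "dterm n (\<lambda>x. opr (F x) (G x))"
proof -
  let ?N = "Suc (Suc (Suc n))"
  let ?F = "\<lambda>x. x ! n = F (take n x)" and ?G = "\<lambda>x. x ! n = G (take n x)"
  let ?m = "\<lambda>ks x. map (\<lambda>k. (x :: real list) ! k) ks"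
  let ?C = "\<lambda>x. ?F (?m ([0..<n] @ [Suc n]) x) \<and> ?G (?m ([0..<n] @ [Suc (Suc n)]) x)
               \<and> R (?m [Suc n, Suc (Suc n), n] x)"
  have 1: "dset ?N (\<lambda>x. ?F (?m ([0..<n] @ [Suc n]) x))"
    using F by (intro dset_subst) (auto simp: dterm_def)
  have 2: "dset ?N (\<lambda>x. ?G (?m ([0..<n] @ [Suc (Suc n)]) x))"
    using G by (intro dset_subst) (auto simp: dterm_def)
  have 3: "dset ?N (\<lambda>x. R (?m [Suc n, Suc (Suc n), n] x))"
    using R(1) by (intro dset_subst) (auto simp: eval_nat_numeral)
  have "dset ?N ?C"
    by (intro dset_conj 1 2 3) auto
  then have "dset (Suc (Suc n)) (\<lambda>x. \<exists>y. ?C (x @ [y]))"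
    by (intro dset_ex[where Q = ?C]) simp_all
  then have "dset (Suc n) (\<lambda>x. \<exists>y'. \<exists>y. ?C ((x @ [y']) @ [y]))"
    by (intro dset_ex[where Q = "\<lambda>x. \<exists>y. ?C (x @ [y])"]) simp_all
  then show ?thesis
    unfolding dterm_def
  proof (rule dset_cong)
    fix x :: "real list" assume x: "length x = Suc n"
    have 1: "?m ([0..<n] @ [Suc n]) ((x @ [y']) @ [y]) = take n x @ [y']" for y y'
      using x by (intro nth_equalityI) (auto simp: nth_append)
    have 2: "?m ([0..<n] @ [Suc (Suc n)]) ((x @ [y']) @ [y]) = take n x @ [y]" for y y'
      using x by (intro nth_equalityI) (auto simp: nth_append)
    have 3: "?m [Suc n, Suc (Suc n), n] ((x @ [y']) @ [y]) = [y', y, x ! n]" for y y'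
      using x by (auto simp: nth_append)
    show "(\<exists>y'. \<exists>y. ?C ((x @ [y']) @ [y])) \<longleftrightarrow> x ! n = opr (F (take n x)) (G (take n x))"
      unfolding 1 2 3 R(2) using x by (auto simp: nth_append)
  qed
qed

lemma polynomial_graph_dset:
  "polynomial_on_lists 3 f \<Longrightarrow> dset 3 (\<lambda>x. x ! 2 = f x)"
  by (rule dset_cong[OF dset_polynomial_eq_0[of 3 "\<lambda>x. x ! 2 - f x"]])
     (auto intro!: polynomial_on_lists_diff polynomial_on_lists.coord)

lemma dterm_add: "n \<ge> 1 \<Longrightarrow> dterm n F \<Longrightarrow> dterm n G \<Longrightarrow> dterm n (\<lambda>x. F x + G x)"
  by (rule dterm_binary[OF _ polynomial_graph_dset[of "\<lambda>x. x ! 0 + x ! 1"]])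
     (auto intro!: polynomial_on_lists.intros)

lemma dterm_mult: "n \<ge> 1 \<Longrightarrow> dterm n F \<Longrightarrow> dterm n G \<Longrightarrow> dterm n (\<lambda>x. F x * G x)"
  by (rule dterm_binary[OF _ polynomial_graph_dset[of "\<lambda>x. x ! 0 * x ! 1"]])
     (auto intro!: polynomial_on_lists.intros)

lemma dterm_diff: "n \<ge> 1 \<Longrightarrow> dterm n F \<Longrightarrow> dterm n G \<Longrightarrow> dterm n (\<lambda>x. F x - G x)"
  by (rule dterm_binary[OF _ polynomial_graph_dset[of "\<lambda>x. x ! 0 - x ! 1"]])
     (auto intro!: polynomial_on_lists.intros polynomial_on_lists_diff)

lemma dterm_inverse:
  assumes "n \<ge> 1" "dterm n F"
  shows "dterm n (\<lambda>x. inverse (F x))"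
proof (rule dterm_binary[OF assms(1) _ _ assms(2) assms(2), where opr = "\<lambda>u v. inverse u"])
  have "dset 3 (\<lambda>x. x ! 0 * x ! 2 - 1 = 0)" "dset 3 (\<lambda>x. x ! 0 = 0)" "dset 3 (\<lambda>x. x ! 2 = 0)"
    by (intro dset_polynomial_eq_0 polynomial_on_lists_diff polynomial_on_lists.intros; simp)+
  then show "dset 3 (\<lambda>x. x ! 0 * x ! 2 - 1 = 0 \<or> x ! 0 = 0 \<and> x ! 2 = 0)"
    by (intro dset_disj dset_conj) simp_all
  show "[u, v, z] ! 0 * [u, v, z] ! 2 - 1 = 0 \<or> [u, v, z] ! 0 = 0 \<and> [u, v, z] ! 2 = 0 \<longleftrightarrow> z = inverse u"
    for u v z :: real
    by (cases "u = 0") (auto simp: field_simps)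
qed

lemma dterm_sum:
  "n \<ge> 1 \<Longrightarrow> (\<And>i. i \<in> A \<Longrightarrow> dterm n (F i)) \<Longrightarrow> dterm n (\<lambda>x. \<Sum>i\<in>A. F i x)"
  by (induction A rule: infinite_finite_induct) (auto intro: dterm_add dterm_const)

lemma dterm_power: "n \<ge> 1 \<Longrightarrow> dterm n F \<Longrightarrow> dterm n (\<lambda>x. F x ^ m)"
  by (induction m) (auto intro: dterm_mult dterm_const)

lemma dset_pos: "n \<ge> 1 \<Longrightarrow> dterm n F \<Longrightarrow> dset n (\<lambda>x. F x > 0)"
  by (rule dset_term) (auto intro!: dset_polynomial_pos polynomial_on_lists.intros)

lemma dset_eq_0: "n \<ge> 1 \<Longrightarrow> dterm n F \<Longrightarrow> dset n (\<lambda>x. F x = 0)"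
  by (rule dset_term) (auto intro!: dset_polynomial_eq_0 polynomial_on_lists.intros)

lemma dset_less: "n \<ge> 1 \<Longrightarrow> dterm n F \<Longrightarrow> dterm n G \<Longrightarrow> dset n (\<lambda>x. F x < G x)"
  by (rule dset_cong[OF dset_pos[OF _ dterm_diff[of n G F]]]) auto

lemma dset_eq: "n \<ge> 1 \<Longrightarrow> dterm n F \<Longrightarrow> dterm n G \<Longrightarrow> dset n (\<lambda>x. F x = G x)"
  by (rule dset_cong[OF dset_eq_0[OF _ dterm_diff[of n G F]]]) auto

abbreviation dreal :: "real set \<Rightarrow> bool" where
  "dreal S \<equiv> dset 1 (\<lambda>x. x ! 0 \<in> S)"

lemma dset_mem: "n \<ge> 1 \<Longrightarrow> dreal S \<Longrightarrow> dterm n F \<Longrightarrow> dset n (\<lambda>x. F x \<in> S)"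
  by (rule dset_term[where Q = "\<lambda>y. y \<in> S"])

definition zext :: "real set \<Rightarrow> (real \<Rightarrow> real) \<Rightarrow> real \<Rightarrow> real" where
  "zext S f t = (if t \<in> S then f t else 0)"

lemma graph_eq: "{[t, f t] |t. t \<in> S} = {x. length x = 2 \<and> x ! 0 \<in> S \<and> x ! 1 = f (x ! 0)}"
  by (auto simp: length_Suc_conv numeral_2_eq_2)

text \<open>A nonempty graph determines its dimension, so definability of a function means membership of its
graph in the planar family.\<close>

lemma definable_on_iff_dset:
  "definable_on M S f \<longleftrightarrow> dset 2 (\<lambda>x. x ! 0 \<in> S \<and> x ! 1 = f (x ! 0))"
proof
  assume "definable_on M S f"
  then obtain n where n: "n \<ge> 1" "{[t, f t] |t. t \<in> S} \<in> M n"
    by (auto simp: definable_on_def definable_def)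
  show "dset 2 (\<lambda>x. x ! 0 \<in> S \<and> x ! 1 = f (x ! 0))"
  proof (cases "S = {}")
    case True
    then show ?thesis using dset_not[OF _ dset_True, of 2] by simp
  next
    case False
    then obtain t where "t \<in> S" by auto
    then have "[t, f t] \<in> {x. length x = n}"
      using in_space[OF n] by blast
    then have "n = 2" by simp
    with n(2) show ?thesis by (simp add: graph_eq)
  qed
next
  assume "dset 2 (\<lambda>x. x ! 0 \<in> S \<and> x ! 1 = f (x ! 0))"
  then show "definable_on M S f"
    unfolding definable_on_def definable_def graph_eq by (auto intro!: exI[of _ 2])
qed

lemma definable_on_domain:
  assumes "definable_on M S f"
  shows "dreal S"
proof -
  have "dset 1 (\<lambda>x. \<exists>y. (x @ [y]) ! 0 \<in> S \<and> (x @ [y]) ! 1 = f ((x @ [y]) ! 0))"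
    using assms by (intro dset_ex) (auto simp: definable_on_iff_dset eval_nat_numeral)
  then show ?thesis by (rule dset_cong) (auto simp: nth_append)
qed

lemma dterm_zext:
  assumes f: "definable_on M S f" and n: "n \<ge> 1" and F: "dterm n F"
  shows "dterm n (\<lambda>x. zext S f (F x))"
proof (rule dterm_binary[OF n _ _ F F, where opr = "\<lambda>u v. zext S f u"])
  let ?g = "\<lambda>x. x ! 0 \<in> S \<and> x ! 1 = f (x ! 0)"
  have 1: "dset 3 (\<lambda>x. ?g (map (\<lambda>k. x ! k) [0, 2]))"
    using f by (intro dset_subst) (auto simp: definable_on_iff_dset numeral_2_eq_2)
  have 2: "dset 3 (\<lambda>x. x ! 0 \<in> S)"
    by (intro dset_mem[OF _ definable_on_domain[OF f]] dterm_coord) auto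
  have 3: "dset 3 (\<lambda>x. x ! 2 = 0)"
    by (intro dset_eq dterm_coord dterm_const) auto
  show "dset 3 (\<lambda>x. ?g (map (\<lambda>k. x ! k) [0, 2]) \<or> x ! 0 \<notin> S \<and> x ! 2 = 0)"
    by (rule dset_disj[OF _ 1 dset_conj[OF _ dset_not[OF _ 2] 3]]) simp_all
qed (auto simp: zext_def)

lemma definable_onI:
  assumes "dreal S" "dterm 1 F" "\<And>t. t \<in> S \<Longrightarrow> f t = F [t]"
  shows "definable_on M S f"
proof -
  have "dset 2 (\<lambda>x. x ! 0 \<in> S \<and> x ! 1 = F (take 1 x))"
    using assms(2) by (intro dset_conj dset_mem[OF _ assms(1)] dterm_coord) (auto simp: dterm_def numeral_2_eq_2)
  moreover have "take 1 x = [x ! 0]" if "length x = 2" for x :: "real list"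
    using that by (auto simp: length_Suc_conv numeral_2_eq_2)
  ultimately show ?thesis
    unfolding definable_on_iff_dset using assms(3) by (elim dset_cong) auto
qed

lemma definable_on_cong: "definable_on M S f \<Longrightarrow> (\<And>t. t \<in> S \<Longrightarrow> f t = g t) \<Longrightarrow> definable_on M S g"
  unfolding definable_on_iff_dset by (erule dset_cong) auto

lemma definable_on_subset:
  assumes "definable_on M S f" "dreal T" "T \<subseteq> S"
  shows "definable_on M T f"
  by (rule definable_onI[OF assms(2) dterm_zext[OF assms(1) _ dterm_coord[of 0]]])
     (use assms(3) in \<open>auto simp: zext_def\<close>)

lemma definable_on_Un: "definable_on M S f \<Longrightarrow> definable_on M T f \<Longrightarrow> definable_on M (S \<union> T) f"
  unfolding definable_on_iff_dset
  by (rule dset_cong[OF dset_disj[of 2 "\<lambda>x. x ! 0 \<in> S \<and> x ! 1 = f (x ! 0)" "\<lambda>x. x ! 0 \<in> T \<and> x ! 1 = f (x ! 0)"]])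
    auto

lemma fun_ring_definable_on: "dreal S \<Longrightarrow> fun_ring_on S (definable_on M S)"
  unfolding fun_ring_on_def
proof (intro conjI allI impI)
  assume S: "dreal S"
  show "definable_on M S (\<lambda>_. c)" for c
    by (rule definable_onI[OF S dterm_const]) simp
  fix f g assume fg: "definable_on M S f" "definable_on M S g"
  note fg' = fg[THEN dterm_zext, of 1, OF _ dterm_coord[of 0]]
  show "definable_on M S (\<lambda>t. f t + g t)"
    by (rule definable_onI[OF S dterm_add[OF _ fg']]) (auto simp: zext_def)
  show "definable_on M S (\<lambda>t. f t * g t)"
    by (rule definable_onI[OF S dterm_mult[OF _ fg']]) (auto simp: zext_def)
next
  show "definable_on M S g" if "\<forall>t\<in>S. f t = g t" "definable_on M S f" for f g
    using that definable_on_cong by blast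
qed

lemma definable_on_ident: "dreal S \<Longrightarrow> definable_on M S (\<lambda>t. t)"
  by (rule definable_onI[OF _ dterm_coord[of 0]]) auto

lemma definable_on_inverse:
  assumes "definable_on M S f"
  shows "definable_on M S (\<lambda>t. inverse (f t))"
  by (rule definable_onI[OF definable_on_domain[OF assms] dterm_inverse[OF _ dterm_zext[OF assms _ dterm_coord[of 0]]]])
     (auto simp: zext_def)

text \<open>The largest root is defined by a first-order formula: it is a root, and no larger number is one.\<close>

lemma definable_on_max_root:
  assumes S: "dreal S"
    and P: "coeffs_in (definable_on M S) P" "\<And>t. t \<in> S \<Longrightarrow> hyperbolic (P t) \<and> degree (P t) = Suc n"
  shows "definable_on M S (\<lambda>t. max_root (P t))"
proof -
  let ?v = "\<lambda>t y. \<Sum>i\<le>Suc n. zext S (\<lambda>t. coeff (P t) i) t * y ^ i"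
  have v: "?v t y = poly (P t) y" if "t \<in> S" for t y
    using that P(2)[OF that] by (simp add: zext_def poly_eq_sum[of "P t" "Suc n"])
  have tm: "dterm m (\<lambda>x. ?v (x ! i) (x ! j))" if "i < m" "j < m" for m i j
    using that P(1) by (intro dterm_sum dterm_mult dterm_zext dterm_power dterm_coord) auto
  \<comment> \<open>The coordinates are the parameter, the root, and a competing larger number.\<close>
  have "dset 3 (\<lambda>x. x ! 1 < x ! 2 \<longrightarrow> \<not> ?v (x ! 0) (x ! 2) = 0)"
    by (intro dset_imp dset_not dset_less dset_eq_0 tm dterm_coord) auto
  then have "dset 2 (\<lambda>x. \<forall>y. (x @ [y]) ! 1 < (x @ [y]) ! 2 \<longrightarrow> \<not> ?v ((x @ [y]) ! 0) ((x @ [y]) ! 2) = 0)"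
    by (intro dset_all) (auto simp: eval_nat_numeral)
  then have "dset 2 (\<lambda>x. x ! 0 \<in> S \<and> ?v (x ! 0) (x ! 1) = 0 \<and>
      (\<forall>y. (x @ [y]) ! 1 < (x @ [y]) ! 2 \<longrightarrow> \<not> ?v ((x @ [y]) ! 0) ((x @ [y]) ! 2) = 0))"
    by (intro dset_conj dset_mem[OF _ S] dset_eq_0 tm dterm_coord) auto
  then show ?thesis
    unfolding definable_on_iff_dset
  proof (rule dset_cong)
    fix x :: "real list" assume x: "length x = 2"
    have "(x ! 0 \<in> S \<and> ?v (x ! 0) (x ! 1) = 0 \<and>
      (\<forall>y. (x @ [y]) ! 1 < (x @ [y]) ! 2 \<longrightarrow> \<not> ?v ((x @ [y]) ! 0) ((x @ [y]) ! 2) = 0))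
      \<longleftrightarrow> (x ! 0 \<in> S \<and> poly (P (x ! 0)) (x ! 1) = 0 \<and> (\<forall>y. x ! 1 < y \<longrightarrow> poly (P (x ! 0)) y \<noteq> 0))"
      using x v by (auto simp: nth_append simp del: sum.atMost_Suc)
    also have "\<dots> \<longleftrightarrow> (x ! 0 \<in> S \<and> x ! 1 = max_root (P (x ! 0)))"
    proof (cases "x ! 0 \<in> S")
      case True
      then have "hyperbolic (P (x ! 0))" "degree (P (x ! 0)) > 0"
        using P(2) by auto
      note mr = max_root[OF this]
      show ?thesis using True mr by (metis le_less_trans less_irrefl not_less order_le_less)
    qed simp
    finally show "(x ! 0 \<in> S \<and> ?v (x ! 0) (x ! 1) = 0 \<and>
      (\<forall>y. (x @ [y]) ! 1 < (x @ [y]) ! 2 \<longrightarrow> \<not> ?v ((x @ [y]) ! 0) ((x @ [y]) ! 2) = 0))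
      \<longleftrightarrow> (x ! 0 \<in> S \<and> x ! 1 = max_root (P (x ! 0)))" .
  qed
qed

lemma definable_on_desc_root:
  assumes "dreal S" "coeffs_in (definable_on M S) P"
    "\<And>t. t \<in> S \<Longrightarrow> hyperbolic (P t) \<and> degree (P t) = n" "i < n"
  shows "definable_on M S (\<lambda>t. desc_root i (P t))"
  by (rule desc_root_in_fun_ring[OF fun_ring_definable_on[OF assms(1)] _ assms(2-4)])
     (rule definable_on_max_root[OF assms(1)])

text \<open>The usual condition on the difference quotient, with squares in place of absolute values so that
only polynomial inequalities between definable terms occur.\<close>

lemma DERIV_iff_squares:
  fixes f :: "real \<Rightarrow> real"
  assumes "open S" "t \<in> S"
  shows "(f has_real_derivative d) (at t) \<longleftrightarrow>
     (\<forall>e. 0 < e \<longrightarrow> (\<exists>dl. 0 < dl \<and> (\<forall>s. s \<in> S \<and> (s - t)\<^sup>2 < dl \<longrightarrow>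
        \<not> e * (s - t)\<^sup>2 < (f s - f t - d * (s - t))\<^sup>2)))" (is "_ \<longleftrightarrow> ?R")
proof
  assume D: "(f has_real_derivative d) (at t)"
  show ?R
  proof (intro allI impI)
    fix e :: real assume e: "0 < e"
    then have "sqrt e > 0" by simp
    then have "\<exists>r>0. \<forall>s. norm (s - t) < r \<longrightarrow> norm (f s - f t - d * (s - t)) \<le> sqrt e * norm (s - t)"
      using D unfolding has_field_derivative_def has_derivative_at_alt by blast
    then obtain r where r: "r > 0" "\<And>s. \<bar>s - t\<bar> < r \<Longrightarrow> \<bar>f s - f t - d * (s - t)\<bar> \<le> sqrt e * \<bar>s - t\<bar>"
      by auto
    have "(f s - f t - d * (s - t))\<^sup>2 \<le> e * (s - t)\<^sup>2" if "(s - t)\<^sup>2 < r\<^sup>2" for s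
    proof -
      have "\<bar>s - t\<bar> < r" using that r(1) by (metis abs_le_square_iff abs_of_pos not_le)
      then have "\<bar>f s - f t - d * (s - t)\<bar>\<^sup>2 \<le> (sqrt e * \<bar>s - t\<bar>)\<^sup>2"
        using r(2) by (intro power_mono) auto
      then show ?thesis using e by (simp add: power_mult_distrib)
    qed
    with r(1) show "\<exists>dl. 0 < dl \<and> (\<forall>s. s \<in> S \<and> (s - t)\<^sup>2 < dl \<longrightarrow>
        \<not> e * (s - t)\<^sup>2 < (f s - f t - d * (s - t))\<^sup>2)"
      by (intro exI[of _ "r\<^sup>2"]) (auto simp: not_less)
  qed
next
  assume R: ?R
  obtain r0 where r0: "r0 > 0" "ball t r0 \<subseteq> S"
    using assms by (auto elim: openE)
  show "(f has_real_derivative d) (at t)"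
    unfolding has_field_derivative_def has_derivative_at_alt
  proof (intro conjI allI impI)
    show "bounded_linear ((*) d)" by (rule bounded_linear_mult_right)
    fix e :: real assume e: "0 < e"
    then obtain dl where dl: "0 < dl" "\<And>s. s \<in> S \<Longrightarrow> (s - t)\<^sup>2 < dl \<Longrightarrow>
        (f s - f t - d * (s - t))\<^sup>2 \<le> e\<^sup>2 * (s - t)\<^sup>2"
      using R[rule_format, of "e\<^sup>2"] by (force simp: not_less)
    show "\<exists>r>0. \<forall>s. norm (s - t) < r \<longrightarrow> norm (f s - f t - d * (s - t)) \<le> e * norm (s - t)"
    proof (intro exI[of _ "min r0 (sqrt dl)"] conjI allI impI)
      fix s assume s: "norm (s - t) < min r0 (sqrt dl)"
      then have "s \<in> S" using r0 by (auto simp: dist_real_def subset_iff abs_minus_commute)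
      moreover have "(s - t)\<^sup>2 < dl"
      proof -
        have "\<bar>s - t\<bar>\<^sup>2 < (sqrt dl)\<^sup>2"
          using s by (intro power_strict_mono) auto
        then show ?thesis using dl(1) by simp
      qed
      ultimately have "(f s - f t - d * (s - t))\<^sup>2 \<le> (e * (s - t))\<^sup>2"
        using dl(2) by (simp add: power_mult_distrib)
      then have "\<bar>f s - f t - d * (s - t)\<bar> \<le> \<bar>e * (s - t)\<bar>"
        by (simp add: abs_le_square_iff)
      with e show "norm (f s - f t - d * (s - t)) \<le> e * norm (s - t)"
        by (simp add: abs_mult)
    qed (use r0 dl in auto)
  qed
qed

text \<open>The quantifiers of the limit are eliminated one after the other, starting with the innermost.\<close>

lemma definable_on_deriv:
  assumes f: "definable_on M S f" and "open S" and d: "\<And>t. t \<in> S \<Longrightarrow> (f has_real_derivative f' t) (at t)"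
  shows "definable_on M S f'"
proof -
  note S = definable_on_domain[OF f]
  let ?f = "zext S f"
  \<comment> \<open>The coordinates are \<open>t\<close>, \<open>d\<close>, \<open>e\<close>, \<open>dl\<close>, \<open>s\<close>, in this order.\<close>
  have five: "dset 5 (\<lambda>x. x ! 4 \<in> S \<and> (x ! 4 - x ! 0)^2 < x ! 3 \<longrightarrow>
     \<not> x ! 2 * (x ! 4 - x ! 0)^2 < (?f (x ! 4) - ?f (x ! 0) - x ! 1 * (x ! 4 - x ! 0))^2)"
    by (intro dset_imp dset_conj dset_not dset_mem[OF _ S] dset_less dterm_power dterm_diff dterm_mult
          dterm_zext[OF f] dterm_coord) auto
  let ?Q5 = "\<lambda>x. x ! 4 \<in> S \<and> (x ! 4 - x ! 0)^2 < x ! 3 \<longrightarrow>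
     \<not> x ! 2 * (x ! 4 - x ! 0)^2 < (?f (x ! 4) - ?f (x ! 0) - x ! 1 * (x ! 4 - x ! 0))^2"
  have "dset 4 (\<lambda>x. \<forall>s. ?Q5 (x @ [s]))"
    using five by (intro dset_all) (auto simp: eval_nat_numeral)
  then have four: "dset 4 (\<lambda>x. 0 < x ! 3 \<and> (\<forall>s. ?Q5 (x @ [s])))"
    by (intro dset_conj dset_less dterm_const dterm_coord) auto
  let ?Q4 = "\<lambda>x. 0 < x ! 3 \<and> (\<forall>s. ?Q5 (x @ [s]))"
  have "dset 3 (\<lambda>x. \<exists>dl. ?Q4 (x @ [dl]))"
    using dset_ex[of 3 ?Q4] four by (simp add: eval_nat_numeral)
  then have three: "dset 3 (\<lambda>x. 0 < x ! 2 \<longrightarrow> (\<exists>dl. ?Q4 (x @ [dl])))"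
    by (intro dset_imp dset_less dterm_const dterm_coord) auto
  let ?Q3 = "\<lambda>x. 0 < x ! 2 \<longrightarrow> (\<exists>dl. ?Q4 (x @ [dl]))"
  have "dset 2 (\<lambda>x. \<forall>e. ?Q3 (x @ [e]))"
    using dset_all[of 2 ?Q3] three by (simp add: eval_nat_numeral)
  then have "dset 2 (\<lambda>x. x ! 0 \<in> S \<and> (\<forall>e. ?Q3 (x @ [e])))"
    by (intro dset_conj dset_mem[OF _ S] dterm_coord) auto
  then show ?thesis
    unfolding definable_on_iff_dset
  proof (rule dset_cong)
    fix x :: "real list" assume "length x = 2"
    then obtain t d' where x: "x = [t, d']"
      by (auto simp: length_Suc_conv numeral_2_eq_2)
    have "x ! 0 \<in> S \<and> (\<forall>e. ?Q3 (x @ [e])) \<longleftrightarrow> t \<in> S \<and> (\<forall>e. 0 < e \<longrightarrow> (\<exists>dl. 0 < dl \<and>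
        (\<forall>s. s \<in> S \<and> (s - t)\<^sup>2 < dl \<longrightarrow> \<not> e * (s - t)\<^sup>2 < (f s - f t - d' * (s - t))\<^sup>2)))"
      unfolding x by (auto simp: zext_def eval_nat_numeral cong: conj_cong)
    also have "\<dots> \<longleftrightarrow> t \<in> S \<and> (f has_real_derivative d') (at t)"
      using DERIV_iff_squares[OF \<open>open S\<close>, of t f d'] by blast
    also have "\<dots> \<longleftrightarrow> t \<in> S \<and> d' = f' t"
      using d DERIV_unique by blast
    finally show "x ! 0 \<in> S \<and> (\<forall>e. ?Q3 (x @ [e])) \<longleftrightarrow> x ! 0 \<in> S \<and> x ! 1 = f' (x ! 0)"
      unfolding x by simp
  qed
qed

end

section \<open>Definable sets of real numbers\<close>

lemma interval_eventually_at_right: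
  fixes J :: "real set"
  assumes "is_interval J"
  shows "(\<forall>\<^sub>F t in at_right t0. t \<in> J) \<or> (\<forall>\<^sub>F t in at_right t0. t \<notin> J)"
proof (rule disjCI)
  assume "\<not> (\<forall>\<^sub>F t in at_right t0. t \<notin> J)"
  then have *: "\<exists>y>t0. y < b \<and> y \<in> J" if "b > t0" for b
    using that unfolding eventually_at_right_field by blast
  obtain x where x: "x > t0" "x \<in> J" using *[of "t0 + 1"] by auto
  have "t \<in> J" if "t > t0" "t < x" for t
    using *[OF that(1)] that x mem_is_interval_1_I[OF assms, of _ x t] by fastforce
  with x show "\<forall>\<^sub>F t in at_right t0. t \<in> J"
    unfolding eventually_at_right_field by blast
qed

lemma interval_eventually_at_left:
  fixes J :: "real set"
  assumes "is_interval J"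
  shows "(\<forall>\<^sub>F t in at_left t0. t \<in> J) \<or> (\<forall>\<^sub>F t in at_left t0. t \<notin> J)"
proof (rule disjCI)
  assume "\<not> (\<forall>\<^sub>F t in at_left t0. t \<notin> J)"
  then have *: "\<exists>y>b. y < t0 \<and> y \<in> J" if "b < t0" for b
    using that unfolding eventually_at_left_field by blast
  obtain x where x: "x < t0" "x \<in> J" using *[of "t0 - 1"] by auto
  have "t \<in> J" if "t < t0" "x < t" for t
    using *[OF that(1)] that x mem_is_interval_1_I[OF assms, of x _ t] by fastforce
  with x show "\<forall>\<^sub>F t in at_left t0. t \<in> J"
    unfolding eventually_at_left_field by blast
qed

lemma eventually_mem_Union_dichotomy:
  assumes "finite F" "\<And>J. J \<in> F \<Longrightarrow> (\<forall>\<^sub>F t in G. t \<in> J) \<or> (\<forall>\<^sub>F t in G. t \<notin> J)"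
  shows "(\<forall>\<^sub>F t in G. t \<in> \<Union>F) \<or> (\<forall>\<^sub>F t in G. t \<notin> \<Union>F)"
proof (cases "\<exists>J\<in>F. \<forall>\<^sub>F t in G. t \<in> J")
  case True
  then obtain J where J: "J \<in> F" "\<forall>\<^sub>F t in G. t \<in> J" by blast
  have "\<forall>\<^sub>F t in G. t \<in> \<Union>F"
    using J(2) by eventually_elim (use J(1) in blast)
  then show ?thesis ..
next
  case False
  with assms(2) have "\<forall>J\<in>F. \<forall>\<^sub>F t in G. t \<notin> J" by blast
  then have "\<forall>\<^sub>F t in G. \<forall>J\<in>F. t \<notin> J"
    using assms(1) by (rule eventually_ball_finite[rotated])
  then have "\<forall>\<^sub>F t in G. t \<notin> \<Union>F"
    by eventually_elim blast
  then show ?thesis ..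
qed

text \<open>A frontier point of an interval is its infimum or its supremum.\<close>

lemma finite_frontier_interval:
  fixes J :: "real set"
  assumes "is_interval J"
  shows "finite (frontier J)"
proof -
  have "y \<in> {Inf J, Sup J}" if y: "y \<in> frontier J" for y
  proof (rule ccontr)
    assume n: "y \<notin> {Inf J, Sup J}"
    have cl: "\<exists>x\<in>J. dist x y < e" if "e > 0" for e
      using y that by (auto simp: frontier_def closure_approachable)
    have "\<exists>a\<in>J. a < y"
    proof (rule ccontr)
      assume "\<not> (\<exists>a\<in>J. a < y)"
      then have lb: "\<And>a. a \<in> J \<Longrightarrow> y \<le> a" by force
      have "Inf J = y"
      proof (rule cInf_eq)
        fix z assume z: "\<And>x. x \<in> J \<Longrightarrow> z \<le> x"
        show "z \<le> y"
        proof (rule ccontr)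
          assume "\<not> z \<le> y"
          then obtain x where "x \<in> J" "dist x y < z - y" using cl[of "z - y"] by auto
          then show False using z[of x] by (auto simp: dist_real_def)
        qed
      qed (use lb in auto)
      with n show False by simp
    qed
    then obtain a where a: "a \<in> J" "a < y" by blast
    have "\<exists>b\<in>J. y < b"
    proof (rule ccontr)
      assume "\<not> (\<exists>b\<in>J. y < b)"
      then have ub: "\<And>a. a \<in> J \<Longrightarrow> a \<le> y" by force
      have "Sup J = y"
      proof (rule cSup_eq)
        fix z assume z: "\<And>x. x \<in> J \<Longrightarrow> x \<le> z"
        show "y \<le> z"
        proof (rule ccontr)
          assume "\<not> y \<le> z"
          then obtain x where "x \<in> J" "dist x y < y - z" using cl[of "y - z"] by auto
          then show False using z[of x] by (auto simp: dist_real_def)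
        qed
      qed (use ub in auto)
      with n show False by simp
    qed
    then obtain b where b: "b \<in> J" "y < b" by blast
    have "{a<..<b} \<subseteq> J"
      using mem_is_interval_1_I[OF assms a(1) b(1)] by auto
    then have "y \<in> interior J"
      using a b by (meson greaterThanLessThan_iff interiorI open_greaterThanLessThan)
    with y show False by (simp add: frontier_def)
  qed
  then show ?thesis by (meson finite.emptyI finite.insertI finite_subset subsetI)
qed

lemma frontier_Union_subset:
  "finite F \<Longrightarrow> frontier (\<Union>F) \<subseteq> (\<Union>J\<in>F. frontier (J :: real set))"
proof (induction F rule: finite_induct)
  case (insert J F)
  have "frontier (\<Union>(insert J F)) \<subseteq> frontier J \<union> frontier (\<Union>F)"
    using frontier_Un_subset[of J "\<Union>F"] by simp
  with insert.IH show ?case by auto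
qed simp

context o_minimal
begin

lemma definable_on_const: "dreal S \<Longrightarrow> definable_on M S (\<lambda>_. c)"
  by (rule fun_ring_onD(1)[where K = "definable_on M S", OF fun_ring_definable_on])

lemma definable_on_add:
  assumes "definable_on M S f" "definable_on M S g"
  shows "definable_on M S (\<lambda>t. f t + g t)"
  by (rule fun_ring_onD(2)[where K = "definable_on M S", OF fun_ring_definable_on[OF definable_on_domain[OF assms(1)]] assms])

lemma definable_on_mult:
  assumes "definable_on M S f" "definable_on M S g"
  shows "definable_on M S (\<lambda>t. f t * g t)"
  by (rule fun_ring_onD(3)[where K = "definable_on M S", OF fun_ring_definable_on[OF definable_on_domain[OF assms(1)]] assms])

lemma definable_on_diff:
  assumes "definable_on M S f" "definable_on M S g"
  shows "definable_on M S (\<lambda>t. f t - g t)"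
  by (rule fun_ring_on_diff[where K = "definable_on M S", OF fun_ring_definable_on[OF definable_on_domain[OF assms(1)]] assms])

lemma definable_on_uminus:
  assumes "definable_on M S f"
  shows "definable_on M S (\<lambda>t. - f t)"
  by (rule fun_ring_on_uminus[where K = "definable_on M S", OF fun_ring_definable_on[OF definable_on_domain[OF assms(1)]] assms])

lemma definable_on_power:
  assumes "definable_on M S f"
  shows "definable_on M S (\<lambda>t. f t ^ m)"
  by (rule fun_ring_on_power[where K = "definable_on M S", OF fun_ring_definable_on[OF definable_on_domain[OF assms(1)]] assms])

lemma definable_on_linear_power: "dreal S \<Longrightarrow> definable_on M S (\<lambda>t. (t - t0) ^ r)"
  by (intro definable_on_power definable_on_diff definable_on_ident definable_on_const)

lemma dreal_iff:
  "dreal S \<longleftrightarrow> (\<exists>F. finite F \<and> (\<forall>J\<in>F. open J \<and> is_interval J \<or> (\<exists>s. J = {s})) \<and> S = \<Union>F)"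
proof -
  have eq: "{x. length x = 1 \<and> x ! 0 \<in> S} = (\<lambda>s. [s]) ` S"
    by (auto simp: length_Suc_conv)
  have "inj (\<lambda>s :: real. [s])" by (rule injI) simp
  then show ?thesis
    unfolding eq one_dim by (simp add: inj_image_eq_iff)
qed

lemma dreal_intervals:
  assumes "dreal S"
  obtains F where "finite F" "\<And>J. J \<in> F \<Longrightarrow> is_interval J" "S = \<Union>F"
proof -
  obtain F where F: "finite F" "\<forall>J\<in>F. open J \<and> is_interval J \<or> (\<exists>s. J = {s})" "S = \<Union>F"
    using assms unfolding dreal_iff by blast
  have "is_interval J" if "J \<in> F" for J
  proof -
    have "open J \<and> is_interval J \<or> (\<exists>s. J = {s})"
      using F(2) that by (rule bspec)
    moreover have "is_interval {s}" for s :: real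
      by (simp add: is_interval_convex_1)
    ultimately show ?thesis by blast
  qed
  then show ?thesis by (rule that[OF F(1) _ F(3)])
qed

lemma dreal_interval: "open J \<Longrightarrow> is_interval J \<Longrightarrow> dreal J"
  unfolding dreal_iff by (intro exI[of _ "{J}"]) auto

lemma dreal_singleton: "dreal {s}"
  unfolding dreal_iff by (intro exI[of _ "{{s}}"]) auto

lemma dreal_diff: "dreal S \<Longrightarrow> dreal T \<Longrightarrow> dreal (S - T)"
  by (rule dset_cong[OF dset_conj[OF _ _ dset_not]]) auto

lemma dreal_ball: "dreal (ball t e)"
  by (rule dreal_interval) (auto simp: ball_eq_greaterThanLessThan is_interval_1)

lemma dreal_at_right:
  "dreal S \<Longrightarrow> (\<forall>\<^sub>F t in at_right t0. t \<in> S) \<or> (\<forall>\<^sub>F t in at_right t0. t \<notin> S)"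
  by (erule dreal_intervals) (simp only: eventually_mem_Union_dichotomy interval_eventually_at_right)

lemma dreal_at_left:
  "dreal S \<Longrightarrow> (\<forall>\<^sub>F t in at_left t0. t \<in> S) \<or> (\<forall>\<^sub>F t in at_left t0. t \<notin> S)"
  by (erule dreal_intervals) (simp only: eventually_mem_Union_dichotomy interval_eventually_at_left)

lemma finite_frontier_dreal:
  assumes "dreal S"
  shows "finite (frontier S)"
proof -
  obtain F where F: "finite F" "\<And>J. J \<in> F \<Longrightarrow> is_interval J" "S = \<Union>F"
    by (rule dreal_intervals[OF assms]) blast
  have "finite (\<Union>J\<in>F. frontier J)"
    using F by (auto intro: finite_frontier_interval)
  with frontier_Union_subset[OF F(1)] F(3) show ?thesis
    by (auto intro: finite_subset)
qed

lemma dreal_zero_set: "definable_on M S f \<Longrightarrow> dreal {t\<in>S. f t = 0}"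
  by (rule dset_cong[OF dset_conj[OF _ dset_mem[OF _ definable_on_domain dterm_coord[of 0]]
          dset_eq_0[OF _ dterm_zext[OF _ _ dterm_coord[of 0]]]]])
     (auto simp: zext_def)

lemma dreal_superlevel_set: "definable_on M S f \<Longrightarrow> dreal {t\<in>S. c < f t}"
  by (rule dset_cong[OF dset_conj[OF _ dset_mem[OF _ definable_on_domain dterm_coord[of 0]]
          dset_less[OF _ dterm_const[of 1 c] dterm_zext[OF _ _ dterm_coord[of 0]]]]])
     (auto simp: zext_def)

end

section \<open>Derivatives of definable functions near an exceptional point\<close>

text \<open>If \<open>h' \<ge> c / (t - t0)\<close>, then by the mean value theorem \<open>h\<close> grows by at least \<open>c / 2\<close> between
\<open>t0 + r / 2\<close> and \<open>t0 + r\<close>, for arbitrarily small \<open>r\<close>.\<close>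

lemma no_logarithmic_growth_right:
  fixes h h' :: "real \<Rightarrow> real"
  assumes "isCont h t0" "c > 0"
    and "\<forall>\<^sub>F t in at_right t0. (h has_real_derivative h' t) (at t) \<and> c \<le> (t - t0) * h' t"
  shows False
proof -
  obtain b where b: "b > t0"
    "\<And>t. t0 < t \<Longrightarrow> t < b \<Longrightarrow> (h has_real_derivative h' t) (at t) \<and> c \<le> (t - t0) * h' t"
    using assms(3) unfolding eventually_at_right_field by blast
  obtain d where d: "d > 0" "\<And>t. dist t t0 < d \<Longrightarrow> dist (h t) (h t0) < c / 4"
    using assms(1,2) unfolding continuous_at_eps_delta by (metis divide_pos_pos zero_less_numeral)
  \<comment> \<open>Halving makes the comparison with \<open>b - t0\<close> and \<open>d\<close> strict.\<close>
  define r where "r = min (b - t0) d / 2"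
  have r: "0 < r" "r < b - t0" "r < d" using b(1) d(1) by (auto simp: r_def)
  \<comment> \<open>Only the increment over \<open>[t0 + r/2, t0 + r]\<close> is estimated, because \<open>h\<close> need not be differentiable at \<open>t0\<close>.\<close>
  have "\<exists>z. t0 + r / 2 < z \<and> z < t0 + r \<and> h (t0 + r) - h (t0 + r / 2) = (t0 + r - (t0 + r / 2)) * h' z"
    using r b(2) by (intro MVT2) auto
  then obtain z where z: "t0 + r / 2 < z" "z < t0 + r" "h (t0 + r) - h (t0 + r / 2) = r / 2 * h' z"
    by auto
  have hz: "c \<le> (z - t0) * h' z" using b(2)[of z] z r by auto
  then have "0 < (z - t0) * h' z" using assms(2) by linarith
  then have pos: "h' z > 0" using z r by (simp add: zero_less_mult_iff)
  then have "(z - t0) * h' z \<le> r * h' z" using z by (intro mult_right_mono) auto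
  with hz z have "c / 2 \<le> h (t0 + r) - h (t0 + r / 2)" by simp
  moreover have "dist (h (t0 + r)) (h t0) < c / 4" "dist (h (t0 + r / 2)) (h t0) < c / 4"
    using d(2) r by (auto simp: dist_real_def)
  ultimately show False unfolding dist_real_def by linarith
qed

lemma no_logarithmic_growth_left:
  fixes h h' :: "real \<Rightarrow> real"
  assumes "isCont h t0" "c > 0"
    and "\<forall>\<^sub>F t in at_left t0. (h has_real_derivative h' t) (at t) \<and> c \<le> (t - t0) * h' t"
  shows False
proof (rule no_logarithmic_growth_right[of "- t0" "\<lambda>s. h (- s)" c "\<lambda>s. - h' (- s)"])
  show "isCont (\<lambda>s. h (- s)) (- t0)"
    by (rule isCont_o2[where f = uminus and g = h]) (simp_all add: assms(1))
  show "\<forall>\<^sub>F t in at_right (- t0). ((\<lambda>s. h (- s)) has_real_derivative - h' (- t)) (at t) \<and>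
           c \<le> (t - - t0) * - h' (- t)"
    using assms(3) unfolding at_left_minus eventually_filtermap
    by eventually_elim (auto simp: DERIV_mirror algebra_simps)
qed (rule assms(2))

context o_minimal
begin

text \<open>For each \<open>c\<close> the set where \<open>(t - t0) h'(t) > c\<close> is definable, so it contains a one-sided
neighbourhood of \<open>t0\<close> or misses one. The first case contradicts the continuity of \<open>h\<close>.\<close>

lemma definable_derivative_growth:
  assumes "e > 0" and h: "definable_on M (ball t0 e) h" "isCont h t0"
    and d: "\<And>t. t \<in> ball t0 e \<Longrightarrow> t \<noteq> t0 \<Longrightarrow> (h has_real_derivative h' t) (at t)"
  shows "((\<lambda>t. (t - t0) * h' t) \<longlongrightarrow> 0) (at t0)"
proof -
  have main: "(\<forall>\<^sub>F t in at_right t0. (t - t0) * h' t \<le> c) \<and> (\<forall>\<^sub>F t in at_left t0. (t - t0) * h' t \<le> c)"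
    if h: "definable_on M (ball t0 e) h" "isCont h t0"
    and d: "\<And>t. t \<in> ball t0 e - {t0} \<Longrightarrow> (h has_real_derivative h' t) (at t)"
    and c: "c > 0" for h h' c
  proof -
    let ?S = "ball t0 e - {t0}"
    have S: "dreal ?S" by (intro dreal_diff dreal_ball dreal_singleton)
    have "definable_on M ?S h'"
      by (rule definable_on_deriv[OF definable_on_subset[OF h(1) S] _ d]) (auto simp: open_delete)
    moreover have "definable_on M ?S (\<lambda>t. t - t0)"
      by (intro definable_on_diff definable_on_ident definable_on_const S)
    ultimately have "definable_on M ?S (\<lambda>t. (t - t0) * h' t)"
      by (intro definable_on_mult)
    then have D: "dreal {t\<in>?S. c < (t - t0) * h' t}"
      by (rule dreal_superlevel_set)
    have R: "\<forall>\<^sub>F t in at_right t0. t \<in> ?S"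
      unfolding eventually_at_right_field using \<open>e > 0\<close>
      by (intro exI[of _ "t0 + e"]) (auto simp: dist_real_def)
    have L: "\<forall>\<^sub>F t in at_left t0. t \<in> ?S"
      unfolding eventually_at_left_field using \<open>e > 0\<close>
      by (intro exI[of _ "t0 - e"]) (auto simp: dist_real_def)
    have "\<not> (\<forall>\<^sub>F t in at_right t0. t \<in> {t\<in>?S. c < (t - t0) * h' t})"
    proof
      assume "\<forall>\<^sub>F t in at_right t0. t \<in> {t\<in>?S. c < (t - t0) * h' t}"
      then have "\<forall>\<^sub>F t in at_right t0. (h has_real_derivative h' t) (at t) \<and> c \<le> (t - t0) * h' t"
        by eventually_elim (use d in auto)
      then show False by (rule no_logarithmic_growth_right[OF h(2) c])
    qed
    then have "\<forall>\<^sub>F t in at_right t0. t \<notin> {t\<in>?S. c < (t - t0) * h' t}"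
      using dreal_at_right[OF D, of t0] by blast
    then have 1: "\<forall>\<^sub>F t in at_right t0. (t - t0) * h' t \<le> c"
      using R by eventually_elim auto
    have "\<not> (\<forall>\<^sub>F t in at_left t0. t \<in> {t\<in>?S. c < (t - t0) * h' t})"
    proof
      assume "\<forall>\<^sub>F t in at_left t0. t \<in> {t\<in>?S. c < (t - t0) * h' t}"
      then have "\<forall>\<^sub>F t in at_left t0. (h has_real_derivative h' t) (at t) \<and> c \<le> (t - t0) * h' t"
        by eventually_elim (use d in auto)
      then show False by (rule no_logarithmic_growth_left[OF h(2) c])
    qed
    then have "\<forall>\<^sub>F t in at_left t0. t \<notin> {t\<in>?S. c < (t - t0) * h' t}"
      using dreal_at_left[OF D, of t0] by blast
    then have 2: "\<forall>\<^sub>F t in at_left t0. (t - t0) * h' t \<le> c"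
      using L by eventually_elim auto
    from 1 2 show ?thesis by blast
  qed
  have small: "\<forall>\<^sub>F t in at t0. (t - t0) * h' t \<le> c" if "c > 0" for c
    using main[of h h' c] h d that by (simp add: eventually_at_split)
  have "definable_on M (ball t0 e) (\<lambda>t. - h t)"
    by (rule definable_on_uminus[OF h(1)])
  then have small': "\<forall>\<^sub>F t in at t0. (t - t0) * (- h' t) \<le> c" if "c > 0" for c
    using main[of "\<lambda>t. - h t" "\<lambda>t. - h' t" c] h(2) d that
    by (simp add: eventually_at_split DERIV_minus)
  show ?thesis
    unfolding tendsto_iff
  proof (intro allI impI)
    fix c :: real assume "c > 0"
    then have "c / 2 > 0" by simp
    show "\<forall>\<^sub>F t in at t0. dist ((t - t0) * h' t) 0 < c"
      using small[OF \<open>c / 2 > 0\<close>] small'[OF \<open>c / 2 > 0\<close>]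
    proof eventually_elim
      case (elim t)
      then show ?case using \<open>c > 0\<close> by (simp add: abs_if)
    qed
  qed
qed

text \<open>The derivative of \<open>(t - t0) g\<close> is \<open>g + (t - t0) g'\<close>, and \<open>g'\<close> is again definable; so the claim for
\<open>g\<close> follows from the one for \<open>g'\<close>, down to the case of a continuous \<open>g\<close>. Without definability
this fails, for instance for oscillating \<open>g\<close>.\<close>

lemma Ck_on_linear_times:
  assumes "e > 0" "definable_on M (ball t0 e) g" "Ck_on m (ball t0 e) g"
    "Ck_on (Suc m) (ball t0 e - {t0}) g"
  shows "Ck_on (Suc m) (ball t0 e) (\<lambda>t. (t - t0) * g t)"
  using assms(2-4)
proof (induction m arbitrary: g)
  case 0
  let ?B = "ball t0 e"
  obtain g' where g': "\<And>t. t \<in> ?B - {t0} \<Longrightarrow> (g has_real_derivative g' t) (at t)"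
    "continuous_on (?B - {t0}) g'"
    using 0(3) unfolding Ck_on.simps by blast
  have gc: "isCont g t" if "t \<in> ?B" for t
    using 0(2) that by (simp add: continuous_on_eq_continuous_at)
  have t0: "t0 \<in> ?B" using assms(1) by simp
  have lim: "((\<lambda>t. (t - t0) * g' t) \<longlongrightarrow> 0) (at t0)"
    by (rule definable_derivative_growth[OF assms(1) 0(1) gc[OF t0]]) (use g' in auto)
  define D where "D t = (if t = t0 then g t0 else g t + (t - t0) * g' t)" for t
  have "isCont D t" if t: "t \<in> ?B" for t
  proof (cases "t = t0")
    case True
    have "((\<lambda>t. g t + (t - t0) * g' t) \<longlongrightarrow> g t0 + 0) (at t0)"
      using gc[OF t0] lim by (intro tendsto_add) (auto simp: isCont_def)
    then have "(D \<longlongrightarrow> g t0) (at t0)"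
      by (simp, elim Lim_transform_eventually) (simp add: D_def eventually_at_filter)
    with True show ?thesis by (simp add: isCont_def D_def)
  next
    case False
    have "isCont g' t"
      using g'(2) False t by (auto simp: continuous_on_eq_continuous_at open_delete)
    then have "isCont (\<lambda>t. g t + (t - t0) * g' t) t"
      using gc[OF t] by (intro continuous_intros)
    moreover have "\<forall>\<^sub>F s in nhds t. g s + (s - t0) * g' s = D s"
      using t1_space_nhds[OF False] by eventually_elim (simp add: D_def)
    ultimately show ?thesis
      using isCont_cong[of "\<lambda>s. g s + (s - t0) * g' s" D t] by simp
  qed
  then have "Ck_on 0 ?B D"
    by (simp add: continuous_at_imp_continuous_on)
  moreover have "continuous_on ?B (\<lambda>t. (t - t0) * g t)"
    using 0(2) by (auto intro!: continuous_intros)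
  moreover have "((\<lambda>t. (t - t0) * g t) has_real_derivative D t) (at t)" if "t \<in> ?B" "t \<noteq> t0" for t
    using g'(1)[of t] that by (auto simp: D_def intro!: derivative_eq_intros)
  ultimately show ?case
    using Ck_on_Suc_puncture[OF assms(1), of t0 "\<lambda>t. (t - t0) * g t" 0 D] by blast
next
  case (Suc m)
  let ?B = "ball t0 e"
  obtain g' where g': "\<And>t. t \<in> ?B \<Longrightarrow> (g has_real_derivative g' t) (at t)" "Ck_on m ?B g'"
    using Suc.prems(2) unfolding Ck_on.simps by blast
  obtain g'' where g'': "\<And>t. t \<in> ?B - {t0} \<Longrightarrow> (g has_real_derivative g'' t) (at t)" "Ck_on (Suc m) (?B - {t0}) g''"
    using Suc.prems(3) unfolding Ck_on.simps(2)[of "Suc m"] by blast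
  have "g'' t = g' t" if "t \<in> ?B - {t0}" for t
    using g'(1) g''(1) that DERIV_unique by blast
  then have "Ck_on (Suc m) (?B - {t0}) g'"
    using Ck_on_cong[of "?B - {t0}" g'' g' "Suc m"] g''(2) by (simp only: open_delete open_ball)
  moreover have "definable_on M ?B g'"
    by (rule definable_on_deriv[OF Suc.prems(1) _ g'(1)]) auto
  ultimately have "Ck_on (Suc m) ?B (\<lambda>t. (t - t0) * g' t)"
    using Suc.IH g'(2) by blast
  then have "Ck_on (Suc m) ?B (\<lambda>t. g t + (t - t0) * g' t)"
    using Suc.prems(2) by (rule Ck_on_add[rotated])
  moreover have "\<forall>t\<in>?B. ((\<lambda>t. (t - t0) * g t) has_real_derivative g t + (t - t0) * g' t) (at t)"
    using g'(1) by (auto intro!: derivative_eq_intros)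
  ultimately show ?case
    unfolding Ck_on.simps(2)[of "Suc m"] by (intro exI[of _ "\<lambda>t. g t + (t - t0) * g' t"] conjI)
qed

lemma Ck_on_power_times:
  assumes "e > 0" "definable_on M (ball t0 e) g" "Ck_on m (ball t0 e) g"
    "Ck_on (m + r) (ball t0 e - {t0}) g"
  shows "Ck_on (m + r) (ball t0 e) (\<lambda>t. (t - t0) ^ r * g t)"
  using assms(4)
proof (induction r)
  case 0
  then show ?case using assms(3) by simp
next
  case (Suc r)
  let ?h = "\<lambda>t. (t - t0) ^ r * g t"
  have "Ck_on (m + r) (ball t0 e - {t0}) g"
    using Suc.prems by (rule Ck_on_mono) simp
  then have "Ck_on (m + r) (ball t0 e) ?h" by (rule Suc.IH)
  moreover have "definable_on M (ball t0 e) ?h"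
    by (intro definable_on_mult definable_on_linear_power dreal_ball assms(2))
  moreover have "Ck_on (Suc (m + r)) (ball t0 e - {t0}) ?h"
    using Suc.prems by (intro Ck_on_mult Ck_on_linear_power) (simp del: Ck_on.simps)
  ultimately have "Ck_on (Suc (m + r)) (ball t0 e) (\<lambda>t. (t - t0) * ?h t)"
    by (intro Ck_on_linear_times assms(1))
  then show ?case by (simp del: Ck_on.simps add: mult.assoc)
qed

end

section \<open>Germs of curves of hyperbolic polynomials\<close>

lemma Ck_near_cong:
  assumes "\<forall>\<^sub>F t in nhds t0. f t = g t" "Ck_near k t0 f"
  shows "Ck_near k t0 g"
proof -
  obtain d where d: "d > 0" "\<And>t. dist t t0 < d \<Longrightarrow> f t = g t"
    using assms(1) unfolding eventually_nhds_metric by blast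
  obtain e where e: "e > 0" "Ck_on k (ball t0 e) f"
    using assms(2) unfolding Ck_near_def by blast
  have "Ck_on k (ball t0 (min d e)) f"
    using e(2) by (rule Ck_on_subset) auto
  then have "Ck_on k (ball t0 (min d e)) g"
    using d by (subst (asm) Ck_on_cong[of _ f g]) (auto simp: dist_commute)
  with d e show ?thesis unfolding Ck_near_def by (intro exI[of _ "min d e"]) auto
qed

lemma Ck_near_binary:
  assumes "\<And>S. Ck_on k S f \<Longrightarrow> Ck_on k S g \<Longrightarrow> Ck_on k S h" "Ck_near k t0 f" "Ck_near k t0 g"
  shows "Ck_near k t0 h"
proof -
  obtain e1 e2 where e: "e1 > 0" "Ck_on k (ball t0 e1) f" "e2 > 0" "Ck_on k (ball t0 e2) g"
    using assms(2,3) unfolding Ck_near_def by blast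
  have "Ck_on k (ball t0 (min e1 e2)) h"
    by (rule assms(1)) (rule Ck_on_subset[OF e(2)] Ck_on_subset[OF e(4)]; auto)+
  with e show ?thesis unfolding Ck_near_def by (intro exI[of _ "min e1 e2"]) auto
qed

lemma Ck_near_mono: "Ck_near k t0 f \<Longrightarrow> j \<le> k \<Longrightarrow> Ck_near j t0 f"
  unfolding Ck_near_def using Ck_on_mono by blast

lemma Ck_near_of_all: "(\<And>S. Ck_on k S f) \<Longrightarrow> Ck_near k t0 f"
  unfolding Ck_near_def by (intro exI[of _ 1]) simp

lemma eventually_ball_nhds: "e > 0 \<Longrightarrow> \<forall>\<^sub>F t in nhds t0. t \<in> ball t0 e" for t0 :: real
  by (rule eventually_nhds_in_open) auto

lemma fun_ring_Ck_near:
  assumes "e > 0"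
  shows "fun_ring_on (ball t0 e) (Ck_near k t0)"
  unfolding fun_ring_on_def
proof (intro conjI allI impI)
  show "Ck_near k t0 (\<lambda>_. c)" for c by (rule Ck_near_of_all[OF Ck_on_const])
  show "Ck_near k t0 (\<lambda>t. f t + g t)" if "Ck_near k t0 f" "Ck_near k t0 g" for f g
    by (rule Ck_near_binary[OF Ck_on_add that])
  show "Ck_near k t0 (\<lambda>t. f t * g t)" if "Ck_near k t0 f" "Ck_near k t0 g" for f g
    by (rule Ck_near_binary[OF Ck_on_mult that])
  show "Ck_near k t0 g" if "\<forall>t\<in>ball t0 e. f t = g t" "Ck_near k t0 f" for f g
  proof (rule Ck_near_cong[OF _ that(2)])
    show "\<forall>\<^sub>F t in nhds t0. f t = g t"
      using eventually_ball_nhds[OF assms, of t0] by eventually_elim (use that(1) in blast)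
  qed
qed

lemma continuous_near_imp_isCont: "continuous_near t0 f \<Longrightarrow> isCont f t0"
  unfolding Ck_near_def by (auto simp: continuous_on_eq_continuous_at)

text \<open>Finitely many local properties that pass to smaller balls hold on one ball.\<close>

lemma common_ball:
  fixes Q :: "'a \<Rightarrow> real \<Rightarrow> bool"
  assumes "finite A" "\<And>j. j \<in> A \<Longrightarrow> \<exists>e>0. Q j e"
    "\<And>j d e. j \<in> A \<Longrightarrow> Q j e \<Longrightarrow> 0 < d \<Longrightarrow> d \<le> e \<Longrightarrow> Q j d"
  shows "\<exists>e>0. \<forall>j\<in>A. Q j e"
  using assms
proof (induction A rule: finite_induct)
  case empty
  show ?case by (intro exI[of _ 1]) simp
next
  case (insert j A)
  obtain e1 where e1: "e1 > 0" "\<forall>j\<in>A. Q j e1"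
    using insert.IH insert.prems by (metis insertI2)
  obtain e2 where e2: "e2 > 0" "Q j e2"
    using insert.prems(1)[of j] by auto
  have "Q j (min e1 e2)"
    using insert.prems(2)[of j e2 "min e1 e2"] e1 e2 by simp
  moreover have "Q i (min e1 e2)" if "i \<in> A" for i
    using insert.prems(2)[of i e1 "min e1 e2"] e1 e2 that by simp
  ultimately show ?case
    using e1(1) e2(1) by (intro exI[of _ "min e1 e2"]) auto
qed

text \<open>The germs of the coefficients live on different neighbourhoods, but only the first \<open>n + 1\<close>
coefficients of a polynomial of degree \<open>n\<close> matter.\<close>

lemma hyp_curve_near_ball:
  assumes "hyp_curve_near n t0 P" "coeffs_in (Ck_near k t0) P"
  shows "\<exists>e>0. (\<forall>t\<in>ball t0 e. hyperbolic (P t) \<and> degree (P t) = n) \<and> coeffs_in (Ck_on k (ball t0 e)) P"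
proof -
  obtain d where d: "d > 0" "\<And>t. t \<in> ball t0 d \<Longrightarrow> hyperbolic (P t) \<and> degree (P t) = n"
    using assms(1) unfolding hyp_curve_near_def eventually_nhds_metric by (auto simp: dist_commute)
  have "\<exists>e>0. \<forall>j\<in>{..n}. Ck_on k (ball t0 e) (\<lambda>t. coeff (P t) j)"
  proof (rule common_ball)
    show "\<exists>e>0. Ck_on k (ball t0 e) (\<lambda>t. coeff (P t) j)" for j
      using assms(2) unfolding Ck_near_def by blast
    show "Ck_on k (ball t0 d) (\<lambda>t. coeff (P t) j)"
      if "Ck_on k (ball t0 e) (\<lambda>t. coeff (P t) j)" "d \<le> e" for j d e
      using that(1) by (rule Ck_on_subset) (use that(2) in auto)
  qed simp
  then obtain e where e: "e > 0" "\<And>j. j \<le> n \<Longrightarrow> Ck_on k (ball t0 e) (\<lambda>t. coeff (P t) j)"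
    by auto
  have "Ck_on k (ball t0 (min d e)) (\<lambda>t. coeff (P t) j)" for j
  proof (cases "j \<le> n")
    case True
    show ?thesis
      by (rule Ck_on_subset[OF e(2)[OF True]]) auto
  next
    case False
    have "Ck_on k (ball t0 (min d e)) (\<lambda>t. 0)" by (rule Ck_on_const)
    then show ?thesis
      using d(2) False by (subst (asm) Ck_on_cong[of _ _ "\<lambda>t. coeff (P t) j"]) (auto simp: coeff_eq_0)
  qed
  with d e(1) show ?thesis by (intro exI[of _ "min d e"]) auto
qed

lemma hyp_curve_near_at:
  assumes "hyp_curve_near n t0 P"
  shows "hyperbolic (P t0)" "degree (P t0) = n"
  using assms eventually_nhds_x_imp_x unfolding hyp_curve_near_def by blast+

lemma hyp_curve_near_cong:
  assumes "\<forall>\<^sub>F t in nhds t0. P t = Q t" "hyp_curve_near n t0 P"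
  shows "hyp_curve_near n t0 Q"
  unfolding hyp_curve_near_def
proof (intro conjI allI)
  have "\<forall>\<^sub>F t in nhds t0. hyperbolic (P t) \<and> degree (P t) = n"
    using assms(2) unfolding hyp_curve_near_def by blast
  with assms(1) show "\<forall>\<^sub>F t in nhds t0. hyperbolic (Q t) \<and> degree (Q t) = n"
    by eventually_elim simp
  fix j
  have "\<forall>\<^sub>F t in nhds t0. coeff (P t) j = coeff (Q t) j"
    using assms(1) by eventually_elim simp
  moreover have "continuous_near t0 (\<lambda>t. coeff (P t) j)"
    using assms(2) unfolding hyp_curve_near_def by blast
  ultimately show "continuous_near t0 (\<lambda>t. coeff (Q t) j)"
    by (rule Ck_near_cong)
qed

lemma hyp_curve_near_root_prod:
  assumes "finite A" "\<And>i. i \<in> A \<Longrightarrow> continuous_near t0 (u i)"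
  shows "hyp_curve_near (card A) t0 (\<lambda>t. root_prod A (\<lambda>i. u i t))"
  unfolding hyp_curve_near_def
proof (intro conjI)
  show "\<forall>\<^sub>F t in nhds t0. hyperbolic (root_prod A (\<lambda>i. u i t)) \<and> degree (root_prod A (\<lambda>i. u i t)) = card A"
    using assms(1) by (simp add: hyperbolic_root_prod degree_root_prod)
  show "coeffs_in (continuous_near t0) (\<lambda>t. root_prod A (\<lambda>i. u i t))"
    by (rule coeffs_in_root_prod[OF fun_ring_Ck_near[of 1]]) (use assms(2) in auto)
qed

lemma hyp_curve_near_roots:
  assumes "hyp_curve_near n t0 P"
  obtains u where "\<And>i. i < n \<Longrightarrow> continuous_near t0 (u i)"
    "\<forall>\<^sub>F t in nhds t0. P t = root_prod {..<n} (\<lambda>i. u i t)"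
proof -
  have "coeffs_in (continuous_near t0) P"
    using assms unfolding hyp_curve_near_def by blast
  then obtain e where e: "e > 0" "\<And>t. t \<in> ball t0 e \<Longrightarrow> hyperbolic (P t) \<and> degree (P t) = n"
    "coeffs_in (continuous_on (ball t0 e)) P"
    using hyp_curve_near_ball[OF assms, of 0] by (auto simp del: mem_ball)
  show ?thesis
  proof (rule that[of "\<lambda>i t. desc_root i (P t)"])
    show "continuous_near t0 (\<lambda>t. desc_root i (P t))" if "i < n" for i
      using continuous_on_desc_root[OF e(3,2) that] e(1) unfolding Ck_near_def by auto
    show "\<forall>\<^sub>F t in nhds t0. P t = root_prod {..<n} (\<lambda>i. desc_root i (P t))"
      using eventually_ball_nhds[OF e(1)]
    proof eventually_elim
      case (elim t)
      with e(2) show ?case using hyperbolic_eq_root_prod by blast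
    qed
  qed
qed

lemma isCont_eventually_nonzero:
  fixes f :: "real \<Rightarrow> real"
  assumes "isCont f a" "f a \<noteq> 0"
  shows "\<forall>\<^sub>F t in nhds a. f t \<noteq> 0"
proof -
  have "(f \<longlongrightarrow> f a) (nhds a)"
    using assms(1) by (simp add: isCont_def tendsto_at_iff_tendsto_nhds)
  then show ?thesis using assms(2) by (rule tendsto_imp_eventually_ne)
qed

lemma isCont_poly_curve:
  assumes "hyp_curve_near n t0 P" "isCont v t0"
  shows "isCont (\<lambda>t. poly (P t) (v t)) t0"
proof -
  have "isCont (\<lambda>t. coeff (P t) i) t0" for i
    using assms(1) unfolding hyp_curve_near_def by (blast intro: continuous_near_imp_isCont)
  then have "isCont (\<lambda>t. \<Sum>i\<le>n. coeff (P t) i * v t ^ i) t0"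
    using assms(2) by (intro continuous_intros)
  moreover have "\<forall>\<^sub>F t in nhds t0. (\<Sum>i\<le>n. coeff (P t) i * v t ^ i) = poly (P t) (v t)"
  proof -
    have "\<forall>\<^sub>F t in nhds t0. hyperbolic (P t) \<and> degree (P t) = n"
      using assms(1) unfolding hyp_curve_near_def by blast
    then show ?thesis
    proof eventually_elim
      case (elim t)
      then show ?case using poly_eq_sum[of "P t" n "v t"] by simp
    qed
  qed
  ultimately show ?thesis
    using isCont_cong[of "\<lambda>t. \<Sum>i\<le>n. coeff (P t) i * v t ^ i" "\<lambda>t. poly (P t) (v t)" t0] by (simp only:)
qed

text \<open>A factorization into factors without common roots at \<open>t0\<close> splits any continuous family of roots:
a root goes to the factor that vanishes at its value at \<open>t0\<close>, and by continuity it is no root of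
the other factor nearby.\<close>

lemma factor_root_indices:
  assumes A: "finite A" and P1: "hyp_curve_near n1 t0 P1" and P2: "hyp_curve_near n2 t0 P2"
    and u: "\<And>i. i \<in> A \<Longrightarrow> isCont (u i) t0"
    and eq: "\<forall>\<^sub>F t in nhds t0. P1 t * P2 t = root_prod A (\<lambda>i. u i t)"
    and nc: "\<nexists>x. poly (P1 t0) x = 0 \<and> poly (P2 t0) x = 0"
  obtains S where "S \<subseteq> A" "\<forall>\<^sub>F t in nhds t0. P1 t = root_prod S (\<lambda>i. u i t)"
    "\<forall>\<^sub>F t in nhds t0. P2 t = root_prod (A - S) (\<lambda>i. u i t)"
proof -
  define S where "S = {i. i \<in> A \<and> poly (P1 t0) (u i t0) = 0}"
  have S: "S \<subseteq> A" "finite S" using A finite_subset by (auto simp: S_def)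
  have 1: "\<forall>\<^sub>F t in nhds t0. \<forall>i\<in>S. poly (P2 t) (u i t) \<noteq> 0"
  proof (rule eventually_ball_finite[OF S(2)], intro ballI)
    fix i assume "i \<in> S"
    then show "\<forall>\<^sub>F t in nhds t0. poly (P2 t) (u i t) \<noteq> 0"
      using nc by (intro isCont_eventually_nonzero isCont_poly_curve[OF P2] u) (auto simp: S_def)
  qed
  have 2: "\<forall>\<^sub>F t in nhds t0. \<forall>i\<in>A - S. poly (P1 t) (u i t) \<noteq> 0"
  proof (rule eventually_ball_finite, simp add: A, intro ballI)
    fix i assume "i \<in> A - S"
    then show "\<forall>\<^sub>F t in nhds t0. poly (P1 t) (u i t) \<noteq> 0"
      by (intro isCont_eventually_nonzero isCont_poly_curve[OF P1] u) (auto simp: S_def)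
  qed
  have h1: "\<forall>\<^sub>F t in nhds t0. hyperbolic (P1 t) \<and> degree (P1 t) = n1"
    and h2: "\<forall>\<^sub>F t in nhds t0. hyperbolic (P2 t) \<and> degree (P2 t) = n2"
    using P1 P2 unfolding hyp_curve_near_def by blast+
  have "\<forall>\<^sub>F t in nhds t0. P1 t = root_prod S (\<lambda>i. u i t) \<and> P2 t = root_prod (A - S) (\<lambda>i. u i t)"
    using 1 2 h1 h2 eq
  proof eventually_elim
    case (elim t)
    let ?Q1 = "root_prod S (\<lambda>i. u i t)" and ?Q2 = "root_prod (A - S) (\<lambda>i. u i t)"
    have eq': "P1 t * P2 t = ?Q1 * ?Q2"
      unfolding elim(5) using S(1) by (subst mult.commute) (rule prod.subset_diff[OF _ A])
    have "?Q1 dvd P1 t * P2 t" "?Q2 dvd P2 t * P1 t"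
      using dvd_triv_left[of ?Q1 ?Q2] dvd_triv_right[of ?Q2 ?Q1] eq' by (simp_all add: mult.commute)
    then have "?Q1 dvd P1 t" "?Q2 dvd P2 t"
      using elim(1,2) root_prod_dvd_factor[OF S(2), of "\<lambda>i. u i t" "P1 t" "P2 t"]
        root_prod_dvd_factor[OF finite_Diff[OF A, of S], of "\<lambda>i. u i t" "P2 t" "P1 t"] by auto
    then show ?case
      using elim(3,4) eq' lead_coeff_root_prod
      by (intro monic_cofactors) (auto simp: hyperbolic_def)
  qed
  then show ?thesis
    by (intro that[OF S(1)]) (auto elim: eventually_mono)
qed

section \<open>Uniqueness\<close>

text \<open>The recursion for the pair \<open>(\<Gamma>, \<Gamma> - \<gamma>)\<close>. In these variables both components of a product are
maxima, which is symmetric and associative. Factors with continuous coefficients are admitted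
whether or not they inherit the regularity of the product, so that the pieces of a common
refinement of two factorizations qualify at once. Uniqueness for this larger relation implies
uniqueness for \<open>\<Gamma>\<close> and \<open>\<gamma>\<close>.\<close>

inductive excess_rel :: "real \<Rightarrow> (real \<Rightarrow> real poly) \<Rightarrow> nat \<Rightarrow> nat \<Rightarrow> bool" for t0 where
  split:
    "\<lbrakk> hyp_curve_near n t0 P; card {x. poly (P t0) x = 0} \<ge> 2;
       n1 > 0; hyp_curve_near n1 t0 P1; n2 > 0; hyp_curve_near n2 t0 P2;
       \<forall>\<^sub>F t in nhds t0. P t = P1 t * P2 t;
       \<nexists>x. poly (P1 t0) x = 0 \<and> poly (P2 t0) x = 0;
       excess_rel t0 P1 G1 D1; excess_rel t0 P2 G2 D2 \<rbrakk>
     \<Longrightarrow> excess_rel t0 P (max G1 G2) (max D1 D2)"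
| reduce:
    "\<lbrakk> hyp_curve_near n t0 P; n > 1; card {x. poly (P t0) x = 0} = 1;
       mult_at t0 (\<lambda>t. sgn_coeff n 2 (tschirnhausen n P t)) = enat (2 * r);
       \<And>k. k \<in> {2..n} \<Longrightarrow> continuous_near t0 (b k);
       \<And>k. k \<in> {2..n} \<Longrightarrow> \<forall>\<^sub>F t in nhds t0. sgn_coeff n k (tschirnhausen n P t) = (t - t0) ^ (k * r) * b k t;
       excess_rel t0 (\<lambda>t. monom 1 n + (\<Sum>k=2..n. monom ((-1) ^ k * b k t) (n - k))) G D \<rbrakk>
     \<Longrightarrow> excess_rel t0 P (G + n * r) (D + (n - 1) * r)"
| flat:
    "\<lbrakk> hyp_curve_near n t0 P; n > 1; card {x. poly (P t0) x = 0} = 1;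
       mult_at t0 (\<lambda>t. sgn_coeff n 2 (tschirnhausen n P t)) = \<infinity> \<rbrakk>
     \<Longrightarrow> excess_rel t0 P 0 0"
| linear: "hyp_curve_near 1 t0 P \<Longrightarrow> excess_rel t0 P 0 0"

lemma Gamma_rel_imp_excess_rel: "Gamma_rel t0 P G g \<Longrightarrow> excess_rel t0 P G (G - g)"
proof (induction rule: Gamma_rel.induct)
  case (split n P n1 P1 n2 P2 G1 g1 G2 g2)
  have "excess_rel t0 P (max G1 G2) (max (G1 - g1) (G2 - g2))"
    by (rule excess_rel.split[OF split(1-6,8,9)]) (use split in auto)
  moreover have "max (G1 - g1) (G2 - g2) \<le> max G1 G2"
    unfolding max_def by auto
  then have "max G1 G2 - (max G1 G2 - max (G1 - g1) (G2 - g2)) = max (G1 - g1) (G2 - g2)"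
    by simp
  ultimately show ?case by simp
next
  case (reduce n P Q r b G g)
  have "excess_rel t0 P (G + n * r) (G - g + (n - 1) * r)"
    using reduce by (intro excess_rel.reduce) auto
  moreover have "G + n * r - (g + r) = G - g + (n - 1) * r"
    using Gamma_rel_le[OF reduce.hyps(9)] \<open>n > 1\<close> by (cases n) auto
  ultimately show ?case by simp
next
  case (flat n P)
  then show ?case by (auto intro: excess_rel.flat)
next
  case (linear P)
  then show ?case by (auto intro: excess_rel.linear)
qed

lemma mult_at_cong:
  assumes "\<forall>\<^sub>F t in nhds t0. f t = g t"
  shows "mult_at t0 f = mult_at t0 g"
proof -
  have "(\<forall>\<^sub>F t in nhds t0. f t = h t) \<longleftrightarrow> (\<forall>\<^sub>F t in nhds t0. g t = h t)" for h
    by (rule eventually_cong[OF assms]) simp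
  then show ?thesis unfolding mult_at_def by simp
qed

lemma excess_rel_cong:
  assumes "excess_rel t0 P G D" and eq: "\<forall>\<^sub>F t in nhds t0. P t = Q t"
  shows "excess_rel t0 Q G D"
proof -
  note hyp = hyp_curve_near_cong[OF eq]
  have t0: "P t0 = Q t0" using eq by (rule eventually_nhds_x_imp_x)
  have ts: "\<forall>\<^sub>F t in nhds t0. sgn_coeff n k (tschirnhausen n P t) = sgn_coeff n k (tschirnhausen n Q t)" for n k
    using eq by eventually_elim (simp add: tschirnhausen_def)
  note mult = mult_at_cong[OF ts]
  show ?thesis
    using assms(1)
  proof cases
    case (split n n1 P1 n2 P2 G1 D1 G2 D2)
    have "\<forall>\<^sub>F t in nhds t0. Q t = P1 t * P2 t"
      using eq split(9) by eventually_elim simp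
    show ?thesis
      unfolding split(1,2)
      by (rule excess_rel.split[OF hyp[OF split(3)] _ split(5-8) _ split(10-12)])
         (use split(4) t0 \<open>\<forall>\<^sub>F t in nhds t0. Q t = P1 t * P2 t\<close> in simp_all)
  next
    case (reduce n r b G' D')
    have "\<forall>\<^sub>F t in nhds t0. sgn_coeff n k (tschirnhausen n Q t) = (t - t0) ^ (k * r) * b k t"
      if "k \<in> {2..n}" for k
      using ts[of n k] reduce(8)[OF that] by eventually_elim simp
    then show ?thesis
      unfolding reduce(1,2)
      by (intro excess_rel.reduce[OF hyp[OF reduce(3)] reduce(4) _ _ reduce(7) _ reduce(9)])
         (use reduce(5,6) t0 mult[of n 2] in simp_all)
  next
    case (flat n)
    show ?thesis
      unfolding flat(1,2)
      by (rule excess_rel.flat[OF hyp[OF flat(3)] flat(4)]) (use flat(5,6) t0 mult[of n 2] in simp_all)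
  next
    case linear
    show ?thesis
      unfolding linear(1,2) by (rule excess_rel.linear[OF hyp[OF linear(3)]])
  qed
qed

lemma excess_rel_hyp: "excess_rel t0 P G D \<Longrightarrow> \<exists>n>0. hyp_curve_near n t0 P"
proof (induction rule: excess_rel.induct)
  case (split n P n1 P1 n2 P2 G1 D1 G2 D2)
  have "n \<noteq> 0"
  proof
    assume "n = 0"
    then have "hyperbolic (P t0)" "degree (P t0) = 0" using hyp_curve_near_at[OF split(1)] by auto
    then have "{x. poly (P t0) x = 0} = {}"
      by (auto elim!: degree_eq_zeroE simp: hyperbolic_def)
    with split(2) show False by simp
  qed
  with split(1) show ?case by blast
next
  case (reduce n P r b G D)
  then show ?case by (intro exI[of _ n]) simp
next
  case (flat n P)
  then show ?case by (intro exI[of _ n]) simp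
next
  case (linear P)
  then show ?case by (intro exI[of _ 1]) simp
qed

text \<open>Extension to curves of degree \<open>0\<close>, which occur in common refinements as empty intersections.\<close>

definition excess_rel0 :: "real \<Rightarrow> (real \<Rightarrow> real poly) \<Rightarrow> nat \<Rightarrow> nat \<Rightarrow> bool" where
  "excess_rel0 t0 P G D \<longleftrightarrow> excess_rel t0 P G D \<or> hyp_curve_near 0 t0 P \<and> G = 0 \<and> D = 0"

lemma hyp_curve_near_0: "hyp_curve_near 0 t0 P \<Longrightarrow> \<forall>\<^sub>F t in nhds t0. P t = 1"
proof -
  assume "hyp_curve_near 0 t0 P"
  then have "\<forall>\<^sub>F t in nhds t0. hyperbolic (P t) \<and> degree (P t) = 0"
    unfolding hyp_curve_near_def by blast
  then show ?thesis by eventually_elim (auto elim!: degree_eq_zeroE simp: hyperbolic_def)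
qed

lemma card_roots_product:
  assumes "hyperbolic p" "hyperbolic q" "degree p > 0" "degree q > 0"
    "\<nexists>x. poly p x = 0 \<and> poly q x = (0 :: real)"
  shows "card {x. poly (p * q) x = 0} \<ge> 2"
proof -
  obtain x y where xy: "poly p x = 0" "poly q y = 0"
    using assms hyperbolic_has_root by meson
  then have "x \<noteq> y" using assms(5) by blast
  then have "card {x, y} = 2" by simp
  moreover have "card {x, y} \<le> card {x. poly (p * q) x = 0}"
    using xy assms(1,2) by (intro card_mono poly_roots_finite) (auto simp: hyperbolic_nonzero)
  ultimately show ?thesis by simp
qed

lemma hyp_curve_near_unique: "hyp_curve_near n t0 P \<Longrightarrow> hyp_curve_near m t0 P \<Longrightarrow> n = m"
  using hyp_curve_near_at(2)[of n t0 P] hyp_curve_near_at(2)[of m t0 P] by simp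

lemma excess_rel0_cong:
  assumes "\<forall>\<^sub>F t in nhds t0. P t = Q t" "excess_rel0 t0 P G D"
  shows "excess_rel0 t0 Q G D"
  using assms(2) excess_rel_cong[OF _ assms(1), of G D] hyp_curve_near_cong[OF assms(1), of 0]
  unfolding excess_rel0_def by blast

lemma excess_rel0_degree_0:
  assumes "excess_rel0 t0 P G D" "hyp_curve_near 0 t0 P"
  shows "G = 0 \<and> D = 0"
proof -
  have "\<not> excess_rel t0 P G D"
  proof
    assume "excess_rel t0 P G D"
    then obtain n where "n > 0" "hyp_curve_near n t0 P"
      using excess_rel_hyp by blast
    with hyp_curve_near_unique[OF assms(2), of n] show False by simp
  qed
  with assms(1) show ?thesis unfolding excess_rel0_def by blast
qed

lemma excess_rel0_mult:
  assumes A: "excess_rel0 t0 A G1 D1" and B: "excess_rel0 t0 B G2 D2"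
    and P: "hyp_curve_near n t0 P" "\<forall>\<^sub>F t in nhds t0. P t = A t * B t"
    and nc: "\<nexists>x. poly (A t0) x = 0 \<and> poly (B t0) x = 0"
  shows "excess_rel0 t0 P (max G1 G2) (max D1 D2)"
proof (cases "hyp_curve_near 0 t0 A")
  case True
  have "\<forall>\<^sub>F t in nhds t0. B t = P t"
    using hyp_curve_near_0[OF True] P(2) by eventually_elim simp
  then have "excess_rel0 t0 P G2 D2"
    using B by (rule excess_rel0_cong)
  moreover have "G1 = 0" "D1 = 0"
    using excess_rel0_degree_0[OF A True] by auto
  ultimately show ?thesis by simp
next
  case A0: False
  show ?thesis
  proof (cases "hyp_curve_near 0 t0 B")
    case True
    have "\<forall>\<^sub>F t in nhds t0. A t = P t"
      using hyp_curve_near_0[OF True] P(2) by eventually_elim simp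
    then have "excess_rel0 t0 P G1 D1"
      using A by (rule excess_rel0_cong)
    moreover have "G2 = 0" "D2 = 0"
      using excess_rel0_degree_0[OF B True] by auto
    ultimately show ?thesis by simp
  next
    case False
    with A0 A B have AB: "excess_rel t0 A G1 D1" "excess_rel t0 B G2 D2"
      unfolding excess_rel0_def by auto
    obtain n1 n2 where n: "n1 > 0" "hyp_curve_near n1 t0 A" "n2 > 0" "hyp_curve_near n2 t0 B"
      using AB excess_rel_hyp by meson
    have "P t0 = A t0 * B t0" using P(2) by (rule eventually_nhds_x_imp_x)
    moreover have "2 \<le> card {x. poly (A t0 * B t0) x = 0}"
      using hyp_curve_near_at[OF n(2)] hyp_curve_near_at[OF n(4)] n(1,3) by (intro card_roots_product nc) auto
    ultimately have "card {x. poly (P t0) x = 0} \<ge> 2" by simp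
    then show ?thesis
      unfolding excess_rel0_def using excess_rel.split[OF P(1) _ n P(2) nc AB] by blast
  qed
qed

lemma excess_rel_trivial_factor:
  assumes P: "excess_rel t0 P G D" and "\<not> card {x. poly (P t0) x = 0} \<ge> 2"
    and A: "hyp_curve_near nA t0 A" and B: "hyp_curve_near nB t0 B"
    and eq: "\<forall>\<^sub>F t in nhds t0. P t = A t * B t"
    and nc: "\<nexists>x. poly (A t0) x = 0 \<and> poly (B t0) x = 0"
  shows "\<exists>GA DA GB DB. excess_rel0 t0 A GA DA \<and> excess_rel0 t0 B GB DB \<and> G = max GA GB \<and> D = max DA DB"
proof -
  have "P t0 = A t0 * B t0" using eq by (rule eventually_nhds_x_imp_x)
  have "nA = 0 \<or> nB = 0"
  proof (rule ccontr)
    assume "\<not> (nA = 0 \<or> nB = 0)"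
    then have "2 \<le> card {x. poly (A t0 * B t0) x = 0}"
      using hyp_curve_near_at[OF A] hyp_curve_near_at[OF B] by (intro card_roots_product nc) auto
    with assms(2) \<open>P t0 = A t0 * B t0\<close> show False by simp
  qed
  then show ?thesis
  proof
    assume "nA = 0"
    with A have A0: "hyp_curve_near 0 t0 A" by simp
    have "\<forall>\<^sub>F t in nhds t0. P t = B t"
      using hyp_curve_near_0[OF A0] eq by eventually_elim simp
    with P have "excess_rel t0 B G D" by (rule excess_rel_cong)
    with A0 show ?thesis unfolding excess_rel0_def by (intro exI[of _ 0] exI[of _ G] exI[of _ D]) auto
  next
    assume "nB = 0"
    with B have B0: "hyp_curve_near 0 t0 B" by simp
    have "\<forall>\<^sub>F t in nhds t0. P t = A t"
      using hyp_curve_near_0[OF B0] eq by eventually_elim simp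
    with P have "excess_rel t0 A G D" by (rule excess_rel_cong)
    with B0 show ?thesis unfolding excess_rel0_def by (intro exI[of _ 0] exI[of _ G] exI[of _ D]) auto
  qed
qed

text \<open>The values for a product are the maxima of the values for the factors, whichever factorization
is used. A factorization \<open>A B\<close> is compared with the one in the derivation, \<open>P1 P2\<close>: the induction
hypothesis splits \<open>P1\<close> and \<open>P2\<close> along \<open>A\<close> and \<open>B\<close>, and the four pieces are regrouped.\<close>

lemma excess_rel_factor:
  assumes "excess_rel t0 P G D"
    and "hyp_curve_near nA t0 A" "hyp_curve_near nB t0 B" "\<forall>\<^sub>F t in nhds t0. P t = A t * B t"
    and "\<nexists>x. poly (A t0) x = 0 \<and> poly (B t0) x = 0"
  shows "\<exists>GA DA GB DB. excess_rel0 t0 A GA DA \<and> excess_rel0 t0 B GB DB \<and> G = max GA GB \<and> D = max DA DB"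
  using assms
proof (induction arbitrary: A B nA nB rule: excess_rel.induct)
  case (split n P n1 P1 n2 P2 G1 D1 G2 D2)
  note AB = split.prems
  obtain u where u: "\<And>i. i < n \<Longrightarrow> continuous_near t0 (u i)"
    "\<forall>\<^sub>F t in nhds t0. P t = root_prod {..<n} (\<lambda>i. u i t)"
    using hyp_curve_near_roots[OF split(1)] by blast
  have uc: "isCont (u i) t0" if "i \<in> {..<n}" for i
    using u(1)[of i] that by (intro continuous_near_imp_isCont) simp
  let ?R = "\<lambda>T t. root_prod T (\<lambda>i. u i t)"
  have e1: "\<forall>\<^sub>F t in nhds t0. P1 t * P2 t = ?R {..<n} t"
    using u(2) split(7) by eventually_elim simp
  have e2: "\<forall>\<^sub>F t in nhds t0. A t * B t = ?R {..<n} t"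
    using u(2) AB(3) by eventually_elim simp
  obtain S where S: "S \<subseteq> {..<n}" "\<forall>\<^sub>F t in nhds t0. P1 t = ?R S t" "\<forall>\<^sub>F t in nhds t0. P2 t = ?R ({..<n} - S) t"
    using factor_root_indices[OF finite_lessThan split(4,6) uc e1 split(8)] by blast
  obtain T where T: "T \<subseteq> {..<n}" "\<forall>\<^sub>F t in nhds t0. A t = ?R T t" "\<forall>\<^sub>F t in nhds t0. B t = ?R ({..<n} - T) t"
    using factor_root_indices[OF finite_lessThan AB(1,2) uc e2 AB(4)] by blast
  have fin: "finite S" "finite T" using S(1) T(1) finite_subset by auto
  have hyp: "hyp_curve_near (card V) t0 (?R V)" if "V \<subseteq> {..<n}" for V
    using that u(1) finite_subset[OF that] by (intro hyp_curve_near_root_prod) auto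
  have roots: "P1 t0 = ?R S t0" "P2 t0 = ?R ({..<n} - S) t0" "A t0 = ?R T t0" "B t0 = ?R ({..<n} - T) t0"
    using S T eventually_nhds_x_imp_x by blast+
  have ncP: "u i t0 \<noteq> u j t0" if "i \<in> S" "j \<in> {..<n} - S" for i j
    using split(8) that fin unfolding roots by (auto simp: poly_root_prod_eq_0)
  have ncA: "u i t0 \<noteq> u j t0" if "i \<in> T" "j \<in> {..<n} - T" for i j
    using AB(4) that fin unfolding roots by (auto simp: poly_root_prod_eq_0)
  have nc: "\<nexists>x. poly (?R V t0) x = 0 \<and> poly (?R W t0) x = 0"
    if "V \<subseteq> {..<n}" "W \<subseteq> {..<n}" "\<And>i j. i \<in> V \<Longrightarrow> j \<in> W \<Longrightarrow> u i t0 \<noteq> u j t0" for V W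
    using that finite_subset[OF that(1)] finite_subset[OF that(2)] by (auto simp: poly_root_prod_eq_0)
  \<comment> \<open>The roots of \<open>P1\<close> have indices in \<open>S\<close>, those of \<open>A\<close> in \<open>T\<close>. The four pieces belong to \<open>S \<inter> T\<close>, \<open>S - T\<close>, \<open>T - S\<close> and the remaining indices.\<close>
  have "\<exists>GA DA GB DB. excess_rel0 t0 (?R (S \<inter> T)) GA DA \<and> excess_rel0 t0 (?R (S - T)) GB DB
      \<and> G1 = max GA GB \<and> D1 = max DA DB"
  proof (rule split.IH(1))
    show "\<forall>\<^sub>F t in nhds t0. P1 t = ?R (S \<inter> T) t * ?R (S - T) t"
      using S(2) by eventually_elim (simp add: prod.Int_Diff[OF fin(1)])
    show "\<nexists>x. poly (?R (S \<inter> T) t0) x = 0 \<and> poly (?R (S - T) t0) x = 0"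
      using S(1) by (intro nc ncA) auto
  qed (use S(1) in \<open>auto intro!: hyp\<close>)
  then obtain GA1 DA1 GB1 DB1 where 1: "excess_rel0 t0 (?R (S \<inter> T)) GA1 DA1"
    "excess_rel0 t0 (?R (S - T)) GB1 DB1" "G1 = max GA1 GB1" "D1 = max DA1 DB1" by blast
  have "\<exists>GA DA GB DB. excess_rel0 t0 (?R (T - S)) GA DA \<and> excess_rel0 t0 (?R ({..<n} - S - T)) GB DB
      \<and> G2 = max GA GB \<and> D2 = max DA DB"
  proof (rule split.IH(2))
    have "({..<n} - S) \<inter> T = T - S" using T(1) by auto
    then have split_eq: "?R ({..<n} - S) t = ?R (T - S) t * ?R ({..<n} - S - T) t" for t
      using prod.Int_Diff[of "{..<n} - S" "\<lambda>i. [:- u i t, 1:]" T] by simp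
    show "\<forall>\<^sub>F t in nhds t0. P2 t = ?R (T - S) t * ?R ({..<n} - S - T) t"
      using S(3) by eventually_elim (simp only: split_eq)
    show "\<nexists>x. poly (?R (T - S) t0) x = 0 \<and> poly (?R ({..<n} - S - T) t0) x = 0"
      using T(1) by (intro nc ncA) auto
    show "hyp_curve_near (card (T - S)) t0 (?R (T - S))"
      "hyp_curve_near (card ({..<n} - S - T)) t0 (?R ({..<n} - S - T))"
      using T(1) by (auto intro!: hyp)
  qed
  then obtain GA2 DA2 GB2 DB2 where 2: "excess_rel0 t0 (?R (T - S)) GA2 DA2"
    "excess_rel0 t0 (?R ({..<n} - S - T)) GB2 DB2" "G2 = max GA2 GB2" "D2 = max DA2 DB2" by blast
  have "excess_rel0 t0 A (max GA1 GA2) (max DA1 DA2)"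
  proof (rule excess_rel0_mult[OF 1(1) 2(1) AB(1)])
    have split_eq: "?R T t = ?R (S \<inter> T) t * ?R (T - S) t" for t
      using prod.Int_Diff[OF fin(2), of "\<lambda>i. [:- u i t, 1:]" S] by (simp only: Int_commute)
    show "\<forall>\<^sub>F t in nhds t0. A t = ?R (S \<inter> T) t * ?R (T - S) t"
      using T(2) by eventually_elim (simp only: split_eq)
    show "\<nexists>x. poly (?R (S \<inter> T) t0) x = 0 \<and> poly (?R (T - S) t0) x = 0"
      using T(1) S(1) by (intro nc ncP) auto
  qed
  moreover have "excess_rel0 t0 B (max GB1 GB2) (max DB1 DB2)"
  proof (rule excess_rel0_mult[OF 1(2) 2(2) AB(2)])
    have "({..<n} - T) \<inter> S = S - T" "({..<n} - T) - S = {..<n} - S - T" using S(1) by auto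
    then have split_eq: "?R ({..<n} - T) t = ?R (S - T) t * ?R ({..<n} - S - T) t" for t
      using prod.Int_Diff[of "{..<n} - T" "\<lambda>i. [:- u i t, 1:]" S] by simp
    show "\<forall>\<^sub>F t in nhds t0. B t = ?R (S - T) t * ?R ({..<n} - S - T) t"
      using T(3) by eventually_elim (simp only: split_eq)
    show "\<nexists>x. poly (?R (S - T) t0) x = 0 \<and> poly (?R ({..<n} - S - T) t0) x = 0"
      using S(1) by (intro nc ncP) auto
  qed
  moreover have "max G1 G2 = max (max GA1 GA2) (max GB1 GB2)" "max D1 D2 = max (max DA1 DA2) (max DB1 DB2)"
    unfolding 1(3,4) 2(3,4) by (simp_all add: max.assoc max.left_commute)
  ultimately show ?case by blast
next
  case (reduce n P r b G D)
  show ?case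
    by (rule excess_rel_trivial_factor[OF excess_rel.reduce[OF reduce(1-7)] _ reduce.prems]) (use reduce(3) in auto)
next
  case (flat n P)
  show ?case
    by (rule excess_rel_trivial_factor[OF excess_rel.flat[OF flat(1-4)] _ flat.prems]) (use flat(3) in auto)
next
  case (linear P)
  have "P t0 \<noteq> 0" "degree (P t0) = 1"
    using hyp_curve_near_at[OF linear(1)] hyperbolic_nonzero by auto
  then have "card {x. poly (P t0) x = 0} \<le> 1"
    using card_poly_roots_bound[of "P t0"] by simp
  then show ?case
    by (intro excess_rel_trivial_factor[OF excess_rel.linear[OF linear(1)] _ linear.prems]) auto
qed

text \<open>Division by \<open>t - t0\<close> is possible off \<open>t0\<close>, and continuity settles \<open>t0\<close> itself.\<close>

lemma continuous_near_eq_of_power_multiples: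
  assumes "continuous_near t0 f" "continuous_near t0 g"
    and "\<forall>\<^sub>F t in nhds t0. (t - t0) ^ m * f t = (t - t0) ^ m * g t"
  shows "\<forall>\<^sub>F t in nhds t0. f t = g t"
proof -
  have ev: "\<forall>\<^sub>F t in at t0. f t = g t"
    using assms(3) unfolding eventually_at_filter by eventually_elim auto
  have "(f \<longlongrightarrow> f t0) (at t0)" "(g \<longlongrightarrow> g t0) (at t0)"
    using assms(1,2) by (auto dest!: continuous_near_imp_isCont simp: isCont_def)
  then have "f t0 = g t0"
    using ev by (metis LIM_unique Lim_transform_eventually)
  show ?thesis
    using ev unfolding eventually_at_filter by eventually_elim (use \<open>f t0 = g t0\<close> in auto)
qed

lemma card_roots_linear:
  assumes "hyp_curve_near 1 t0 P"
  shows "card {x. poly (P t0) x = 0} \<le> 1"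
  using card_poly_roots_bound[of "P t0"] hyp_curve_near_at[OF assms] hyperbolic_nonzero by auto

lemma excess_rel_unique:
  assumes "excess_rel t0 P G D" "excess_rel t0 P G' D'"
  shows "G' = G \<and> D' = D"
  using assms
proof (induction arbitrary: G' D' rule: excess_rel.induct)
  case (split n P n1 P1 n2 P2 G1 D1 G2 D2)
  obtain GA DA GB DB where AB: "excess_rel0 t0 P1 GA DA" "excess_rel0 t0 P2 GB DB" "G' = max GA GB" "D' = max DA DB"
    using excess_rel_factor[OF split.prems split(4,6,7,8)] by blast
  have "excess_rel t0 P1 GA DA"
    using AB(1) hyp_curve_near_unique[OF split(4), of 0] split(3) unfolding excess_rel0_def by auto
  moreover have "excess_rel t0 P2 GB DB"
    using AB(2) hyp_curve_near_unique[OF split(6), of 0] split(5) unfolding excess_rel0_def by auto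
  ultimately show ?case using split.IH AB(3,4) by auto
next
  case (reduce n P r b G D)
  from reduce.prems show ?case
  proof cases
    case (split n' n1 P1 n2 P2 G1 D1 G2 D2)
    then show ?thesis using reduce(3) by simp
  next
    case (reduce n' r' b' G1 D1)
    have n': "n' = n" using reduce(3) \<open>hyp_curve_near n t0 P\<close> by (rule hyp_curve_near_unique)
    have r': "r' = r" using reduce(6) reduce.hyps(4) n' by simp
    have "\<forall>\<^sub>F t in nhds t0. \<forall>k\<in>{2..n}. b' k t = b k t"
    proof (rule eventually_ball_finite, simp, intro ballI)
      fix k assume k: "k \<in> {2..n}"
      have "\<forall>\<^sub>F t in nhds t0. (t - t0) ^ (k * r) * b' k t = (t - t0) ^ (k * r) * b k t"
        using reduce(8)[of k] reduce.hyps(6)[OF k] k unfolding n' r' by (auto elim: eventually_elim2)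
      then show "\<forall>\<^sub>F t in nhds t0. b' k t = b k t"
        using reduce(7)[of k] reduce.hyps(5)[OF k] k n'
        by (intro continuous_near_eq_of_power_multiples[of t0 "b' k" "b k" "k * r"]) auto
    qed
    then have "\<forall>\<^sub>F t in nhds t0. monom 1 n' + (\<Sum>k=2..n'. monom ((-1) ^ k * b' k t) (n' - k))
        = monom 1 n + (\<Sum>k=2..n. monom ((-1) ^ k * b k t) (n - k))"
      unfolding n' by eventually_elim simp
    with reduce(9) have "excess_rel t0 (\<lambda>t. monom 1 n + (\<Sum>k=2..n. monom ((-1) ^ k * b k t) (n - k))) G1 D1"
      by (rule excess_rel_cong)
    then have "G1 = G \<and> D1 = D" by (rule reduce.IH)
    then show ?thesis using reduce(1,2) n' r' by simp
  next
    case (flat n')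
    then have "n' = n" using \<open>hyp_curve_near n t0 P\<close> by (metis hyp_curve_near_unique)
    then show ?thesis using flat reduce.hyps(4) by simp
  next
    case linear
    then have "n = 1" using \<open>hyp_curve_near n t0 P\<close> by (metis hyp_curve_near_unique)
    then show ?thesis using \<open>n > 1\<close> by simp
  qed
next
  case (flat n P)
  from flat.prems show ?case
  proof cases
    case (reduce n' r' b' G1 D1)
    then have "n' = n" using \<open>hyp_curve_near n t0 P\<close> by (metis hyp_curve_near_unique)
    then show ?thesis using reduce flat.hyps(4) by simp
  qed (use flat.hyps(3) in auto)
next
  case (linear P)
  from linear.prems show ?case
  proof cases
    case (split n' n1 P1 n2 P2 G1 D1 G2 D2)
    then show ?thesis using card_roots_linear[OF linear.hyps] by simp
  next
    case (reduce n' r' b' G1 D1)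
    have "n' = 1" using reduce(3) linear.hyps by (rule hyp_curve_near_unique)
    then show ?thesis using reduce(4) by simp
  qed auto
qed

lemma Gamma_rel_unique:
  assumes "Gamma_rel t0 P G g" "Gamma_rel t0 P G' g'"
  shows "G' = G \<and> g' = g"
proof -
  have "G' = G \<and> G' - g' = G - g"
    using assms[THEN Gamma_rel_imp_excess_rel] by (rule excess_rel_unique)
  with assms[THEN Gamma_rel_le] show ?thesis by auto
qed

lemma Gamma_at_eq:
  assumes "Gamma_rel t0 P G g"
  shows "Gamma_at t0 P = G" "gamma_at t0 P = g"
proof -
  show "Gamma_at t0 P = G"
    unfolding Gamma_at_def
  proof (rule the_equality)
    show "\<exists>g. Gamma_rel t0 P G g" using assms by (rule exI)
    show "G' = G" if "\<exists>g. Gamma_rel t0 P G' g" for G'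
      using that Gamma_rel_unique[OF assms] by (elim exE) simp
  qed
  show "gamma_at t0 P = g"
    unfolding gamma_at_def
  proof (rule the_equality)
    show "\<exists>G. Gamma_rel t0 P G g" using assms by (rule exI)
    show "g' = g" if "\<exists>G. Gamma_rel t0 P G g'" for g'
      using that Gamma_rel_unique[OF assms] by (elim exE) simp
  qed
qed

section \<open>Roots whose coincidences do not vary\<close>

lemma Ck_on_Un:
  assumes "open S" "open T" "Ck_on k S f" "Ck_on k T f"
  shows "Ck_on k (S \<union> T) f"
  by (rule Ck_on_local) (use assms Ck_on_imp_near in blast)

lemma fun_ring_Ck_on: "open S \<Longrightarrow> fun_ring_on S (Ck_on k S)"
  unfolding fun_ring_on_def
proof (intro conjI allI impI)
  show "Ck_on k S g" if "open S" "\<forall>t\<in>S. f t = g t" "Ck_on k S f" for f g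
    using Ck_on_cong[of S f g k] that by blast
qed (rule Ck_on_const Ck_on_add Ck_on_mult; assumption)+

text \<open>If \<open>u i\<close> has constant multiplicity \<open>m\<close>, it is a simple root of the derivative of order \<open>m - 1\<close> with
respect to the variable of the polynomial, whose coefficients are multiples of those of \<open>P\<close>.\<close>

lemma Ck_on_roots_of_constant_multiplicity:
  assumes S: "open S" and i: "i < n" and u: "continuous_on S (u i)"
    and P: "\<And>t. t \<in> S \<Longrightarrow> P t = root_prod {..<n} (\<lambda>i. u i t)" "coeffs_in (Ck_on k S) P"
    and pattern: "\<And>j. j < n \<Longrightarrow> (\<forall>t\<in>S. u j t = u i t) \<or> (\<forall>t\<in>S. u j t \<noteq> u i t)"
  shows "Ck_on k S (u i)"
proof -
  define C where "C = {j. j < n \<and> (\<forall>t\<in>S. u j t = u i t)}"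
  have C: "C \<subseteq> {..<n}" "finite C" "i \<in> C" using i by (auto simp: C_def)
  define m where "m = card C"
  have m: "m > 0" using C by (auto simp: m_def card_gt_0_iff)
  have order: "order (u i t) (P t) = m" "P t \<noteq> 0" if t: "t \<in> S" for t
  proof -
    have "P t = root_prod ({..<n} - C) (\<lambda>i. u i t) * root_prod C (\<lambda>i. u i t)"
      unfolding P(1)[OF t] using C(1) by (intro prod.subset_diff) auto
    also have "root_prod C (\<lambda>i. u i t) = [:- u i t, 1:] ^ m"
      unfolding m_def using t by (subst prod_constant[symmetric]) (auto simp: C_def intro!: prod.cong)
    finally have eq: "P t = root_prod ({..<n} - C) (\<lambda>i. u i t) * [:- u i t, 1:] ^ m" .
    have "poly (root_prod ({..<n} - C) (\<lambda>i. u i t)) (u i t) \<noteq> 0"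
      using pattern t by (subst poly_root_prod_eq_0) (auto simp: C_def)
    then have "order (u i t) (root_prod ({..<n} - C) (\<lambda>i. u i t)) = 0" by (rule order_0I)
    moreover show "P t \<noteq> 0" unfolding P(1)[OF t] by simp
    ultimately show "order (u i t) (P t) = m"
      unfolding eq by (subst order_mult) (auto simp: order_power_n_n)
  qed
  define F where "F t = (pderiv ^^ (m - 1)) (P t)" for t
  have degree: "degree (P t) \<le> n" if "t \<in> S" for t
    using P(1)[OF that] by (simp add: degree_root_prod)
  have "degree ((pderiv ^^ l) p) \<le> degree p" for l and p :: "real poly"
    by (induction l) (auto simp: degree_pderiv intro: order_trans[OF diff_le_self])
  then have F_degree: "degree (F t) \<le> n" if "t \<in> S" for t
    unfolding F_def using degree[OF that] by (rule order_trans)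
  have F: "F t \<noteq> 0" "order (u i t) (F t) = 1" if "t \<in> S" for t
    using order_higher_pderiv[of "P t" "m - 1" "u i t"] order[OF that] m unfolding F_def by auto
  show ?thesis
  proof (rule Ck_on_simple_root[OF S, of n k "\<lambda>j t. coeff (F t) j"])
    show "Ck_on k S (\<lambda>t. coeff (F t) j)" for j
      unfolding F_def coeff_higher_pderiv
      by (rule Ck_on_mult[OF Ck_on_const]) (use P(2) in blast)
    fix t assume t: "t \<in> S"
    have root: "poly (F t) (u i t) = 0"
      using F[OF t] by (simp add: order_root)
    then show "(\<Sum>j\<le>n. coeff (F t) j * u i t ^ j) = 0"
      using poly_eq_sum[OF F_degree[OF t]] by simp
    have "pderiv (F t) \<noteq> 0"
    proof
      assume "pderiv (F t) = 0"
      then have "degree (F t) = 0" by (simp add: pderiv_eq_0_iff)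
      with root F(1)[OF t] show False by (auto elim!: degree_eq_zeroE)
    qed
    moreover have "order (u i t) (pderiv (F t)) = 0"
      using order_pderiv[OF F(1)[OF t] root] F(2)[OF t] by simp
    ultimately have "poly (pderiv (F t)) (u i t) \<noteq> 0"
      by (simp add: order_root)
    then show "(\<Sum>j\<le>n. coeff (F t) j * (real j * u i t ^ (j - 1))) \<noteq> 0"
      using poly_pderiv_eq_sum[OF F_degree[OF t]] by simp
  qed (rule u)
qed

lemma Ck_near_divide_power:
  assumes f: "Ck_near (N + m) t0 f" and g: "continuous_near t0 g"
    and eq: "\<forall>\<^sub>F t in nhds t0. f t = (t - t0) ^ m * g t"
  shows "Ck_near N t0 g"
proof -
  obtain e1 where e1: "e1 > 0" "Ck_on (N + m) (ball t0 e1) f"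
    using f unfolding Ck_near_def by blast
  obtain e2 where e2: "e2 > 0" "continuous_on (ball t0 e2) g"
    using g unfolding Ck_near_def by auto
  obtain e3 where e3: "e3 > 0" "\<And>t. dist t t0 < e3 \<Longrightarrow> f t = (t - t0) ^ m * g t"
    using eq unfolding eventually_nhds_metric by blast
  let ?e = "min e1 (min e2 e3)"
  have "Ck_on N (ball t0 ?e) g"
  proof (rule Ck_on_divide_power)
    show "Ck_on (N + m) (ball t0 ?e) f"
      by (rule Ck_on_subset[OF e1(2)]) auto
    show "continuous_on (ball t0 ?e) g"
      by (rule continuous_on_subset[OF e2(2)]) auto
  qed (use e1(1) e2(1) e3 in \<open>auto simp: dist_commute\<close>)
  then show ?thesis
    unfolding Ck_near_def using e1(1) e2(1) e3(1) by (intro exI[of _ ?e]) auto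
qed

lemma root_prod_append:
  "root_prod {..<m + n} (\<lambda>i. if i < m then v i else w (i - m)) = root_prod {..<m} v * root_prod {..<n} w"
proof (induction n)
  case 0
  then show ?case by (auto intro!: prod.cong)
next
  case (Suc n)
  have "root_prod {..<m + Suc n} (\<lambda>i. if i < m then v i else w (i - m))
      = root_prod {..<m + n} (\<lambda>i. if i < m then v i else w (i - m)) * [:- w n, 1:]"
    by (simp only: add_Suc_right prod.lessThan_Suc) simp
  then show ?case unfolding Suc.IH by (simp only: prod.lessThan_Suc mult.assoc)
qed

lemma coeffs_in_monom:
  assumes "fun_ring_on S K" "K f"
  shows "coeffs_in K (\<lambda>t. monom (f t) m)"
proof
  fix j
  show "K (\<lambda>t. coeff (monom (f t) m) j)"
    using assms by (cases "j = m") (simp_all add: fun_ring_onD(1))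
qed

lemma coeffs_in_monic:
  assumes K: "fun_ring_on S K" and b: "\<And>k. k \<in> A \<Longrightarrow> K (b k)"
    and P: "\<And>t. t \<in> S \<Longrightarrow> P t = monom 1 n + (\<Sum>k\<in>A. monom ((-1) ^ k * b k t) (n - k))"
  shows "coeffs_in K P"
proof
  fix j
  have s: "coeffs_in K (\<lambda>t. \<Sum>k\<in>A. monom ((-1) ^ k * b k t) (n - k))"
    by (intro coeffs_in_sum[OF K] coeffs_in_monom[OF K] fun_ring_on_scale[OF K] b)
  have "K (\<lambda>t. coeff (monom 1 n) j + coeff (\<Sum>k\<in>A. monom ((-1) ^ k * b k t) (n - k)) j)"
  proof (rule fun_ring_onD(2)[OF K])
    show "K (\<lambda>t. coeff (monom 1 n) j)" by (rule fun_ring_onD(1)[OF K])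
    show "K (\<lambda>t. coeff (\<Sum>k\<in>A. monom ((-1) ^ k * b k t) (n - k)) j)" by (rule s[THEN spec])
  qed
  then show "K (\<lambda>t. coeff (P t) j)"
    by (rule fun_ring_onD(4)[OF K]) (simp add: P)
qed

text \<open>This is the polynomial \<open>P\<^bsub>(r)\<^esub>\<close> of the recursion, with vanishing first coefficient.\<close>

abbreviation reduced_poly :: "nat \<Rightarrow> (nat \<Rightarrow> real) \<Rightarrow> real poly" where
  "reduced_poly n b \<equiv> monom 1 n + (\<Sum>k=2..n. monom ((-1) ^ k * b k) (n - k))"

lemma coeff_reduced_poly:
  assumes "n > 1"
  shows "coeff (reduced_poly n b) n = 1" "coeff (reduced_poly n b) (n - 1) = 0"
    "k \<in> {2..n} \<Longrightarrow> coeff (reduced_poly n b) (n - k) = (-1) ^ k * b k"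
    "degree (reduced_poly n b) = n"
proof -
  have c: "coeff (reduced_poly n b) j = (if j = n then 1 else 0) + (\<Sum>k=2..n. if n - k = j then (-1) ^ k * b k else 0)" for j
    by (auto simp: coeff_sum)
  have "(\<Sum>k=2..n. if n - k = n then (-1) ^ k * b k else 0) = 0"
    using assms by (intro sum.neutral) auto
  then show 1: "coeff (reduced_poly n b) n = 1" unfolding c by simp
  have "(\<Sum>k=2..n. if n - k = n - 1 then (-1) ^ k * b k else 0) = 0"
    using assms by (intro sum.neutral) auto
  then show "coeff (reduced_poly n b) (n - 1) = 0" unfolding c using assms by simp
  show "coeff (reduced_poly n b) (n - k) = (-1) ^ k * b k" if k: "k \<in> {2..n}"
  proof -
    have "(\<Sum>l=2..n. if n - l = n - k then (-1) ^ l * b l else 0) = (\<Sum>l=2..n. if l = k then (-1) ^ l * b l else 0)"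
      using k by (intro sum.cong refl) auto
    also have "\<dots> = (-1) ^ k * b k" using k by (simp add: sum.delta')
    finally show ?thesis unfolding c using k assms by auto
  qed
  have "degree (reduced_poly n b) \<le> n"
  proof (rule degree_le, intro allI impI)
    fix j assume "n < j"
    then show "coeff (reduced_poly n b) j = 0"
      unfolding c by (auto intro!: sum.neutral)
  qed
  moreover have "n \<le> degree (reduced_poly n b)"
    using 1 by (intro le_degree) simp
  ultimately show "degree (reduced_poly n b) = n" by simp
qed

lemma tschirnhausen_root_prod:
  assumes "n > 0" "P t = root_prod {..<n} v"
  shows "sgn_coeff n 1 (P t) = (\<Sum>i<n. v i)"
    and "tschirnhausen n P t = root_prod {..<n} (\<lambda>i. v i - (\<Sum>i<n. v i) / real n)"
    and "coeff (tschirnhausen n P t) (n - 1) = 0"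
    and "degree (tschirnhausen n P t) = n" "coeff (tschirnhausen n P t) n = 1"
proof -
  show s: "sgn_coeff n 1 (P t) = (\<Sum>i<n. v i)"
    using coeff_root_prod_sub1[of n v] assms by (simp add: sgn_coeff_def)
  show q: "tschirnhausen n P t = root_prod {..<n} (\<lambda>i. v i - (\<Sum>i<n. v i) / real n)"
    unfolding tschirnhausen_def s unfolding assms(2) by (rule pcompose_root_prod)
  show "coeff (tschirnhausen n P t) (n - 1) = 0"
    using coeff_root_prod_sub1[of n "\<lambda>i. v i - (\<Sum>i<n. v i) / real n"] assms(1)
    unfolding q by (simp only: sum_subtractf) simp
  show d: "degree (tschirnhausen n P t) = n"
    unfolding q degree_root_prod by simp
  show "coeff (tschirnhausen n P t) n = 1"
    using lead_coeff_root_prod[of "\<lambda>i. v i - (\<Sum>i<n. v i) / real n" "{..<n}"] unfolding q[symmetric] d .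
qed

text \<open>The \<open>k\<close>-th coefficient is homogeneous of degree \<open>k\<close> in the roots. So coefficients multiplied with
\<open>s\<^sup>k\<close> belong to roots multiplied with \<open>s\<close>, also when \<open>s = 0\<close>.\<close>

lemma poly_eq_of_scaled_reduced:
  assumes n: "n > 1" and R: "reduced_poly n b = root_prod {..<n} v"
    and Q: "coeff Q n = 1" "coeff Q (n - 1) = 0" "degree Q = n"
    and scale: "\<And>k. k \<in> {2..n} \<Longrightarrow> sgn_coeff n k Q = s ^ k * b k"
  shows "Q = root_prod {..<n} (\<lambda>i. s * v i)"
proof (rule poly_eqI)
  fix j
  note red = coeff_reduced_poly[OF n, where b = b]
  have sc: "coeff (root_prod {..<n} (\<lambda>i. s * v i)) j = s ^ (n - j) * coeff (reduced_poly n b) j" if "j \<le> n" for j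
    using coeff_root_prod_scale[of "{..<n}" j s v] that R by simp
  consider "j > n" | "j = n" | "j = n - 1" | "j \<le> n - 2" by linarith
  then show "coeff Q j = coeff (root_prod {..<n} (\<lambda>i. s * v i)) j"
  proof cases
    case 1
    then show ?thesis using Q(3) by (simp add: coeff_eq_0 degree_root_prod)
  next
    case 2
    then show ?thesis using sc[of n] red(1) Q(1) by simp
  next
    case 3
    then show ?thesis using sc[of "n - 1"] red(2) Q(2) by simp
  next
    case 4
    define k where "k = n - j"
    have k: "k \<in> {2..n}" "j = n - k" using 4 n by (auto simp: k_def)
    have "coeff Q j = (-1) ^ k * sgn_coeff n k Q"
      by (simp add: sgn_coeff_def k(2) flip: power_add mult.assoc)
    also have "\<dots> = s ^ k * ((-1) ^ k * b k)"
      using scale[OF k(1)] by simp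
    also have "\<dots> = coeff (root_prod {..<n} (\<lambda>i. s * v i)) j"
      using sc[of j] red(3)[OF k(1)] k by simp
    finally show ?thesis .
  qed
qed

lemma Gamma_rel_hyp: "Gamma_rel t0 P G g \<Longrightarrow> \<exists>n>0. hyp_curve_near n t0 P"
  using Gamma_rel_imp_excess_rel excess_rel_hyp by blast

context o_minimal
begin

definition definable_near :: "real \<Rightarrow> (real \<Rightarrow> real) \<Rightarrow> bool" where
  "definable_near t0 f \<longleftrightarrow> (\<exists>e>0. definable_on M (ball t0 e) f)"

lemma definable_on_smaller_ball: "definable_on M (ball t0 e) f \<Longrightarrow> d \<le> e \<Longrightarrow> definable_on M (ball t0 d) f"
  by (rule definable_on_subset[OF _ dreal_ball]) auto

lemma definable_near_cong:
  assumes "\<forall>\<^sub>F t in nhds t0. f t = g t" "definable_near t0 f"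
  shows "definable_near t0 g"
proof -
  obtain d where d: "d > 0" "\<And>t. dist t t0 < d \<Longrightarrow> f t = g t"
    using assms(1) unfolding eventually_nhds_metric by blast
  obtain e where e: "e > 0" "definable_on M (ball t0 e) f"
    using assms(2) unfolding definable_near_def by blast
  have "definable_on M (ball t0 (min d e)) f"
    by (rule definable_on_smaller_ball[OF e(2)]) simp
  then have "definable_on M (ball t0 (min d e)) g"
    by (rule definable_on_cong) (use d(2) in \<open>simp add: dist_commute\<close>)
  with d e show ?thesis unfolding definable_near_def by (intro exI[of _ "min d e"]) auto
qed

lemma definable_near_binary:
  assumes "\<And>S. definable_on M S f \<Longrightarrow> definable_on M S g \<Longrightarrow> definable_on M S h" "definable_near t0 f" "definable_near t0 g"
  shows "definable_near t0 h"
proof -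
  obtain e1 e2 where e: "e1 > 0" "definable_on M (ball t0 e1) f" "e2 > 0" "definable_on M (ball t0 e2) g"
    using assms(2,3) unfolding definable_near_def by blast
  have "definable_on M (ball t0 (min e1 e2)) h"
    by (rule assms(1)) (rule definable_on_smaller_ball[OF e(2)] definable_on_smaller_ball[OF e(4)]; simp)+
  with e show ?thesis unfolding definable_near_def by (intro exI[of _ "min e1 e2"]) auto
qed

lemma fun_ring_definable_near:
  assumes "e > 0"
  shows "fun_ring_on (ball t0 e) (definable_near t0)"
  unfolding fun_ring_on_def
proof (intro conjI allI impI)
  show "definable_near t0 (\<lambda>_. c)" for c
    unfolding definable_near_def by (intro exI[of _ 1] conjI definable_on_const dreal_ball) simp
  show "definable_near t0 (\<lambda>t. f t + g t)" if "definable_near t0 f" "definable_near t0 g" for f g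
    by (rule definable_near_binary[OF definable_on_add that])
  show "definable_near t0 (\<lambda>t. f t * g t)" if "definable_near t0 f" "definable_near t0 g" for f g
    by (rule definable_near_binary[OF definable_on_mult that])
  show "definable_near t0 g" if "\<forall>t\<in>ball t0 e. f t = g t" "definable_near t0 f" for f g
  proof (rule definable_near_cong[OF _ that(2)])
    show "\<forall>\<^sub>F t in nhds t0. f t = g t"
      using eventually_ball_nhds[OF assms, of t0] by eventually_elim (use that(1) in blast)
  qed
qed

text \<open>The value of \<open>g\<close> at \<open>t0\<close> is not determined by \<open>f\<close>, but a single point does not affect definability.\<close>

lemma definable_on_divide_power:
  assumes f: "definable_on M (ball t0 e) f"
    and eq: "\<And>t. t \<in> ball t0 e \<Longrightarrow> t \<noteq> t0 \<Longrightarrow> f t = (t - t0) ^ m * g t"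
  shows "definable_on M (ball t0 e) g"
proof -
  let ?S = "ball t0 e - {t0}"
  have S: "dreal ?S" by (intro dreal_diff dreal_ball dreal_singleton)
  have "definable_on M ?S (\<lambda>t. f t * inverse ((t - t0) ^ m))"
    by (intro definable_on_mult definable_on_inverse definable_on_linear_power S definable_on_subset[OF f S]) auto
  then have 1: "definable_on M ?S g"
    by (rule definable_on_cong) (use eq in simp)
  show ?thesis
  proof (cases "e > 0")
    case True
    have "definable_on M {t0} (\<lambda>_. g t0)" by (rule definable_on_const[OF dreal_singleton])
    then have "definable_on M {t0} g" by (rule definable_on_cong) simp
    with 1 have "definable_on M (?S \<union> {t0}) g" by (rule definable_on_Un)
    moreover have "?S \<union> {t0} = ball t0 e" using True by auto
    ultimately show ?thesis by simp
  next
    case False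
    then have "ball t0 e = ?S" by auto
    with 1 show ?thesis by simp
  qed
qed

lemma definable_near_divide_power:
  assumes f: "definable_near t0 f" and eq: "\<forall>\<^sub>F t in nhds t0. f t = (t - t0) ^ m * g t"
  shows "definable_near t0 g"
proof -
  obtain e1 where e1: "e1 > 0" "definable_on M (ball t0 e1) f"
    using f unfolding definable_near_def by blast
  obtain e2 where e2: "e2 > 0" "\<And>t. dist t t0 < e2 \<Longrightarrow> f t = (t - t0) ^ m * g t"
    using eq unfolding eventually_nhds_metric by blast
  have "definable_on M (ball t0 (min e1 e2)) g"
    by (rule definable_on_divide_power[OF definable_on_smaller_ball[OF e1(2)]])
       (use e2(2) in \<open>auto simp: dist_commute\<close>)
  with e1(1) e2(1) show ?thesis unfolding definable_near_def by (intro exI[of _ "min e1 e2"]) auto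
qed

lemma hyp_curve_near_definable_ball:
  assumes "hyp_curve_near n t0 P" "coeffs_in (Ck_near k t0) P" "coeffs_in (definable_near t0) P"
  shows "\<exists>e>0. (\<forall>t\<in>ball t0 e. hyperbolic (P t) \<and> degree (P t) = n) \<and>
           coeffs_in (Ck_on k (ball t0 e)) P \<and> coeffs_in (definable_on M (ball t0 e)) P"
proof -
  obtain d where d: "d > 0" "\<And>t. t \<in> ball t0 d \<Longrightarrow> hyperbolic (P t) \<and> degree (P t) = n"
    "coeffs_in (Ck_on k (ball t0 d)) P"
    using hyp_curve_near_ball[OF assms(1,2)] by blast
  have "\<exists>e>0. \<forall>j\<in>{..n}. definable_on M (ball t0 e) (\<lambda>t. coeff (P t) j)"
  proof (rule common_ball)
    show "\<exists>e>0. definable_on M (ball t0 e) (\<lambda>t. coeff (P t) j)" for j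
      using assms(3) unfolding definable_near_def by blast
  qed (auto intro: definable_on_smaller_ball)
  then obtain e where e: "e > 0" "\<And>j. j \<le> n \<Longrightarrow> definable_on M (ball t0 e) (\<lambda>t. coeff (P t) j)"
    by auto
  have "definable_on M (ball t0 (min d e)) (\<lambda>t. coeff (P t) j)" for j
  proof (cases "j \<le> n")
    case True
    show ?thesis
      by (rule definable_on_smaller_ball[OF e(2)[OF True]]) simp
  next
    case False
    have "definable_on M (ball t0 (min d e)) (\<lambda>t. 0)" by (rule definable_on_const[OF dreal_ball])
    then show ?thesis
      by (rule definable_on_cong) (use d(2) False in \<open>simp add: coeff_eq_0\<close>)
  qed
  moreover have "Ck_on k (ball t0 (min d e)) (\<lambda>t. coeff (P t) j)" for j
    by (rule Ck_on_subset[OF d(3)[rule_format]]) auto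
  ultimately show ?thesis
    using d(1,2) e(1) by (intro exI[of _ "min d e"]) auto
qed

lemma zero_pattern_near:
  assumes "e > 0" "finite A" "\<And>i. i \<in> A \<Longrightarrow> definable_on M (ball t0 e) (f i)"
  shows "\<exists>d>0. d \<le> e \<and> (\<forall>i\<in>A.
     ((\<forall>t\<in>{t0<..<t0 + d}. f i t = 0) \<or> (\<forall>t\<in>{t0<..<t0 + d}. f i t \<noteq> 0)) \<and>
     ((\<forall>t\<in>{t0 - d<..<t0}. f i t = 0) \<or> (\<forall>t\<in>{t0 - d<..<t0}. f i t \<noteq> 0)))"
proof -
  let ?Q = "\<lambda>i d.
     ((\<forall>t\<in>{t0<..<t0 + d}. f i t = 0) \<or> (\<forall>t\<in>{t0<..<t0 + d}. f i t \<noteq> 0)) \<and>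
     ((\<forall>t\<in>{t0 - d<..<t0}. f i t = 0) \<or> (\<forall>t\<in>{t0 - d<..<t0}. f i t \<noteq> 0))"
  have anti: "?Q i d'" if "?Q i d" "d' \<le> d" for i and d d' :: real
  proof -
    have "{t0<..<t0 + d'} \<subseteq> {t0<..<t0 + d}" "{t0 - d'<..<t0} \<subseteq> {t0 - d<..<t0}"
      using that(2) by auto
    with that(1) show ?thesis by (meson subsetD)
  qed
  have "\<exists>d>0. \<forall>i\<in>A. ?Q i d"
  proof (rule common_ball[OF assms(2)])
    fix i assume i: "i \<in> A"
    let ?Z = "{t\<in>ball t0 e. f i t = 0}"
    have Z: "dreal ?Z" by (rule dreal_zero_set[OF assms(3)[OF i]])
    obtain b where b: "b > t0" "(\<forall>t. t0 < t \<and> t < b \<longrightarrow> t \<in> ?Z) \<or> (\<forall>t. t0 < t \<and> t < b \<longrightarrow> t \<notin> ?Z)"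
      using dreal_at_right[OF Z, of t0] unfolding eventually_at_right_field by meson
    obtain a where a: "a < t0" "(\<forall>t. a < t \<and> t < t0 \<longrightarrow> t \<in> ?Z) \<or> (\<forall>t. a < t \<and> t < t0 \<longrightarrow> t \<notin> ?Z)"
      using dreal_at_left[OF Z, of t0] unfolding eventually_at_left_field by meson
    define d where "d = min e (min (b - t0) (t0 - a))"
    have d: "d > 0" "d \<le> e" "d \<le> b - t0" "d \<le> t0 - a" using a(1) b(1) assms(1) by (auto simp: d_def)
    have R: "t \<in> ball t0 e \<and> t0 < t \<and> t < b" if "t \<in> {t0<..<t0 + d}" for t
      using that d by (auto simp: dist_real_def)
    have L: "t \<in> ball t0 e \<and> a < t \<and> t < t0" if "t \<in> {t0 - d<..<t0}" for t
      using that d by (auto simp: dist_real_def)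
    have "(\<forall>t\<in>{t0<..<t0 + d}. f i t = 0) \<or> (\<forall>t\<in>{t0<..<t0 + d}. f i t \<noteq> 0)"
      using b(2) R by blast
    moreover have "(\<forall>t\<in>{t0 - d<..<t0}. f i t = 0) \<or> (\<forall>t\<in>{t0 - d<..<t0}. f i t \<noteq> 0)"
      using a(2) L by blast
    ultimately show "\<exists>d>0. ?Q i d" using d(1) by blast
  qed (rule anti)
  then obtain d where d: "d > 0" "\<forall>i\<in>A. ?Q i d" by blast
  have "\<forall>i\<in>A. ?Q i (min d e)"
  proof
    fix i assume "i \<in> A"
    with d(2) have "?Q i d" by (rule bspec)
    then show "?Q i (min d e)" by (rule anti) simp
  qed
  with d(1) assms(1) show ?thesis by (intro exI[of _ "min d e"]) simp
qed

lemma punctured_ball_eq: "ball t0 d - {t0} = {t0<..<t0 + d} \<union> {t0 - d<..<t0}" for t0 :: real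
  by (auto simp: dist_real_def)

text \<open>By definability two roots either agree or differ throughout a one-sided neighbourhood of \<open>t0\<close>, so
all multiplicities are constant on each side.\<close>

lemma Ck_on_roots_punctured:
  assumes "e > 0" and u: "\<And>i. i < n \<Longrightarrow> definable_on M (ball t0 e) (u i)"
    "\<And>i. i < n \<Longrightarrow> continuous_on (ball t0 e) (u i)"
    and P: "\<And>t. t \<in> ball t0 e \<Longrightarrow> P t = root_prod {..<n} (\<lambda>i. u i t)"
    "coeffs_in (Ck_on k (ball t0 e - {t0})) P"
  shows "\<exists>d>0. d \<le> e \<and> (\<forall>i<n. Ck_on k (ball t0 d - {t0}) (u i))"
proof -
  have "\<exists>d>0. d \<le> e \<and> (\<forall>ij\<in>{..<n}\<times>{..<n}.
     ((\<forall>t\<in>{t0<..<t0 + d}. (\<lambda>(i, j) t. u j t - u i t) ij t = 0) \<or> (\<forall>t\<in>{t0<..<t0 + d}. (\<lambda>(i, j) t. u j t - u i t) ij t \<noteq> 0)) \<and>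
     ((\<forall>t\<in>{t0 - d<..<t0}. (\<lambda>(i, j) t. u j t - u i t) ij t = 0) \<or> (\<forall>t\<in>{t0 - d<..<t0}. (\<lambda>(i, j) t. u j t - u i t) ij t \<noteq> 0)))"
    by (rule zero_pattern_near[OF assms(1)]) (use u(1) in \<open>auto intro: definable_on_diff\<close>)
  then obtain d where d: "d > 0" "d \<le> e" and pat: "\<And>i j. i < n \<Longrightarrow> j < n \<Longrightarrow>
     ((\<forall>t\<in>{t0<..<t0 + d}. u j t = u i t) \<or> (\<forall>t\<in>{t0<..<t0 + d}. u j t \<noteq> u i t)) \<and>
     ((\<forall>t\<in>{t0 - d<..<t0}. u j t = u i t) \<or> (\<forall>t\<in>{t0 - d<..<t0}. u j t \<noteq> u i t))"
    by auto
  have "Ck_on k (ball t0 d - {t0}) (u i)" if i: "i < n" for i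
    unfolding punctured_ball_eq
  proof (rule Ck_on_Un)
    have *: "Ck_on k S (u i)" if S: "open S" "S \<subseteq> ball t0 d - {t0}"
      "\<And>j. j < n \<Longrightarrow> (\<forall>t\<in>S. u j t = u i t) \<or> (\<forall>t\<in>S. u j t \<noteq> u i t)" for S
    proof (rule Ck_on_roots_of_constant_multiplicity[where P = P and n = n])
      have sub: "S \<subseteq> ball t0 e" "S \<subseteq> ball t0 e - {t0}" using S(2) d(2) by auto
      show "continuous_on S (u i)" by (rule continuous_on_subset[OF u(2)[OF i] sub(1)])
      show "P t = root_prod {..<n} (\<lambda>i. u i t)" if "t \<in> S" for t
        using that sub(1) P(1) by blast
      show "coeffs_in (Ck_on k S) P" using P(2) Ck_on_subset[OF _ sub(2)] by blast
    qed (use S i in auto)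
    show "Ck_on k {t0<..<t0 + d} (u i)"
      by (rule *) (use pat[OF i] punctured_ball_eq[of t0 d] in auto)
    show "Ck_on k {t0 - d<..<t0} (u i)"
      by (rule *) (use pat[OF i] punctured_ball_eq[of t0 d] in auto)
  qed auto
  with d show ?thesis by blast
qed

end

section \<open>Smooth roots near a point\<close>

context o_minimal
begin

lemma coeffs_in_cong_near:
  assumes "\<And>f g. \<forall>\<^sub>F t in nhds t0. f t = g t \<Longrightarrow> K f \<Longrightarrow> K g"
    and "\<forall>\<^sub>F t in nhds t0. P t = Q t" "coeffs_in K P"
  shows "coeffs_in K Q"
proof
  fix j
  have "\<forall>\<^sub>F t in nhds t0. coeff (P t) j = coeff (Q t) j"
    using assms(2) by eventually_elim simp
  then show "K (\<lambda>t. coeff (Q t) j)"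
    by (rule assms(1)) (use assms(3) in blast)
qed

lemma desc_root_near:
  assumes "hyp_curve_near n t0 P" "coeffs_in (definable_near t0) P" "i < n"
  shows "definable_near t0 (\<lambda>t. desc_root i (P t))" "continuous_near t0 (\<lambda>t. desc_root i (P t))"
proof -
  have "coeffs_in (continuous_near t0) P"
    using assms(1) unfolding hyp_curve_near_def by blast
  then obtain e where e: "e > 0" "\<And>t. t \<in> ball t0 e \<Longrightarrow> hyperbolic (P t) \<and> degree (P t) = n"
    "coeffs_in (Ck_on 0 (ball t0 e)) P" "coeffs_in (definable_on M (ball t0 e)) P"
    using hyp_curve_near_definable_ball[OF assms(1) _ assms(2), where k = 0] by blast
  have "definable_on M (ball t0 e) (\<lambda>t. desc_root i (P t))"
    by (rule definable_on_desc_root[OF dreal_ball e(4,2) assms(3)])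
  with e(1) show "definable_near t0 (\<lambda>t. desc_root i (P t))"
    unfolding definable_near_def by blast
  have "continuous_on (ball t0 e) (\<lambda>t. desc_root i (P t))"
    by (rule continuous_on_desc_root[OF _ e(2) assms(3)]) (use e(3) in simp)
  with e(1) show "continuous_near t0 (\<lambda>t. desc_root i (P t))"
    unfolding Ck_near_def by auto
qed

text \<open>The coefficients of a factor are polynomials in the ordered roots of the product.\<close>

lemma factors_definable_near:
  assumes P: "hyp_curve_near n t0 P" "coeffs_in (definable_near t0) P"
    and P1: "hyp_curve_near n1 t0 P1" and P2: "hyp_curve_near n2 t0 P2"
    and eq: "\<forall>\<^sub>F t in nhds t0. P t = P1 t * P2 t"
    and nc: "\<nexists>x. poly (P1 t0) x = 0 \<and> poly (P2 t0) x = 0"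
  shows "coeffs_in (definable_near t0) P1" "coeffs_in (definable_near t0) P2"
proof -
  let ?u = "\<lambda>i t. desc_root i (P t)"
  have u: "isCont (?u i) t0" if "i \<in> {..<n}" for i
    using desc_root_near(2)[OF P, of i] that by (intro continuous_near_imp_isCont) simp
  have "\<forall>\<^sub>F t in nhds t0. hyperbolic (P t) \<and> degree (P t) = n"
    using P(1) unfolding hyp_curve_near_def by blast
  then have eq': "\<forall>\<^sub>F t in nhds t0. P1 t * P2 t = root_prod {..<n} (\<lambda>i. ?u i t)"
    using eq
  proof eventually_elim
    case (elim t)
    then show ?case using hyperbolic_eq_root_prod[of "P t" n] by simp
  qed
  obtain S where S: "S \<subseteq> {..<n}" "\<forall>\<^sub>F t in nhds t0. P1 t = root_prod S (\<lambda>i. ?u i t)"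
    "\<forall>\<^sub>F t in nhds t0. P2 t = root_prod ({..<n} - S) (\<lambda>i. ?u i t)"
    using factor_root_indices[OF finite_lessThan P1 P2 u eq' nc] by blast
  have R: "coeffs_in (definable_near t0) (\<lambda>t. root_prod T (\<lambda>i. ?u i t))" if "T \<subseteq> {..<n}" for T
    by (rule coeffs_in_root_prod[OF fun_ring_definable_near[of 1]]) (use that desc_root_near(1)[OF P] in auto)
  have S': "\<forall>\<^sub>F t in nhds t0. root_prod S (\<lambda>i. ?u i t) = P1 t"
    "\<forall>\<^sub>F t in nhds t0. root_prod ({..<n} - S) (\<lambda>i. ?u i t) = P2 t"
    using S(2,3) by (simp_all only: eq_commute)
  show "coeffs_in (definable_near t0) P1"
    by (rule coeffs_in_cong_near[OF definable_near_cong S'(1) R[OF S(1)]])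
  show "coeffs_in (definable_near t0) P2"
    by (rule coeffs_in_cong_near[OF definable_near_cong S'(2) R]) auto
qed

text \<open>Definable germs of class \<open>C\<^sup>k\<close> that form a complete list of the roots of \<open>P\<close>.\<close>

definition smooth_roots :: "nat \<Rightarrow> nat \<Rightarrow> real \<Rightarrow> (real \<Rightarrow> real poly) \<Rightarrow> bool" where
  "smooth_roots n k t0 P \<longleftrightarrow> (\<exists>u. (\<forall>i<n. definable_near t0 (u i) \<and> Ck_near k t0 (u i)) \<and>
     (\<forall>\<^sub>F t in nhds t0. P t = root_prod {..<n} (\<lambda>i. u i t)))"

lemma smooth_roots_linear:
  assumes "hyp_curve_near 1 t0 P" "coeffs_in (Ck_near k t0) P" "coeffs_in (definable_near t0) P"
  shows "smooth_roots 1 k t0 P"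
  unfolding smooth_roots_def
proof (intro exI[of _ "\<lambda>i t. - coeff (P t) 0"] conjI allI impI)
  show "definable_near t0 (\<lambda>t. - coeff (P t) 0)"
    by (rule fun_ring_on_uminus[OF fun_ring_definable_near[of 1]]) (use assms(3) in auto)
  show "Ck_near k t0 (\<lambda>t. - coeff (P t) 0)"
    by (rule fun_ring_on_uminus[OF fun_ring_Ck_near[of 1]]) (use assms(2) in auto)
  have "\<forall>\<^sub>F t in nhds t0. hyperbolic (P t) \<and> degree (P t) = 1"
    using assms(1) unfolding hyp_curve_near_def by blast
  then show "\<forall>\<^sub>F t in nhds t0. P t = root_prod {..<1} (\<lambda>i. - coeff (P t) 0)"
  proof eventually_elim
    case (elim t)
    then have "P t = root_prod {..<1} (\<lambda>i. desc_root i (P t))"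
      by (intro hyperbolic_eq_root_prod) auto
    then have "P t = [:- desc_root 0 (P t), 1:]" by simp
    then have "P t = [:coeff (P t) 0, 1:]" by (metis coeff_pCons_0)
    then show ?case by simp
  qed
qed

lemma smooth_roots_mult:
  assumes "smooth_roots n1 k t0 P1" "smooth_roots n2 k t0 P2" "\<forall>\<^sub>F t in nhds t0. P t = P1 t * P2 t"
  shows "smooth_roots (n1 + n2) k t0 P"
proof -
  obtain v w where v: "\<And>i. i < n1 \<Longrightarrow> definable_near t0 (v i) \<and> Ck_near k t0 (v i)"
    "\<forall>\<^sub>F t in nhds t0. P1 t = root_prod {..<n1} (\<lambda>i. v i t)"
    and w: "\<And>i. i < n2 \<Longrightarrow> definable_near t0 (w i) \<and> Ck_near k t0 (w i)"
    "\<forall>\<^sub>F t in nhds t0. P2 t = root_prod {..<n2} (\<lambda>i. w i t)"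
    using assms(1,2) unfolding smooth_roots_def by blast
  let ?u = "\<lambda>i. if i < n1 then v i else w (i - n1)"
  have "definable_near t0 (?u i) \<and> Ck_near k t0 (?u i)" if "i < n1 + n2" for i
    using v(1) w(1) that by simp
  moreover have "\<forall>\<^sub>F t in nhds t0. P t = root_prod {..<n1 + n2} (\<lambda>i. ?u i t)"
    using assms(3) v(2) w(2)
  proof eventually_elim
    case (elim t)
    have "root_prod {..<n1 + n2} (\<lambda>i. ?u i t)
        = root_prod {..<n1 + n2} (\<lambda>i. if i < n1 then v i t else w (i - n1) t)"
      by (intro prod.cong) auto
    also have "\<dots> = root_prod {..<n1} (\<lambda>i. v i t) * root_prod {..<n2} (\<lambda>i. w i t)"
      by (rule root_prod_append)
    also have "\<dots> = P t"
      using elim by simp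
    finally show ?case by simp
  qed
  ultimately show ?thesis
    unfolding smooth_roots_def by (intro exI[of _ ?u]) simp
qed

lemma coeffs_in_tschirnhausen:
  assumes K: "fun_ring_on S K" and P: "coeffs_in K P" "\<And>t. t \<in> S \<Longrightarrow> degree (P t) \<le> n"
  shows "K (\<lambda>t. sgn_coeff n 1 (P t) / real n)" "K (\<lambda>t. sgn_coeff n k (tschirnhausen n P t))"
proof -
  have sg: "K (\<lambda>t. sgn_coeff n j (R t))" if "coeffs_in K R" for R j
    unfolding sgn_coeff_def by (rule fun_ring_on_scale[OF K]) (rule that[THEN spec])
  show c: "K (\<lambda>t. sgn_coeff n 1 (P t) / real n)"
    using fun_ring_on_scale[OF K sg[OF P(1), of 1], of "1 / real n"] by simp
  have "coeffs_in K (\<lambda>t. pcompose (P t) [:sgn_coeff n 1 (P t) / real n, 1:])"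
    by (rule coeffs_in_pcompose[where S = S and n = n, OF K]) (use P c in \<open>simp_all\<close>)
  then have "coeffs_in K (tschirnhausen n P)"
    unfolding tschirnhausen_def .
  then show "K (\<lambda>t. sgn_coeff n k (tschirnhausen n P t))"
    by (rule sg)
qed

text \<open>By Newton's identity the centered roots \<open>w\<close> satisfy \<open>\<Sum> w\<^sup>2 = - 2 a\<close>, where \<open>a\<close> is the second
coefficient of the centered polynomial. Since \<open>a\<close> is divisible by arbitrarily high powers of
\<open>t - t0\<close>, so is each \<open>w\<close>. Writing \<open>w = (t - t0)\<^sup>q v\<close> with \<open>v\<close> continuous, the smoothing effect of
\<open>(t - t0)\<^sup>q\<close> on definable functions makes \<open>w\<close> of class \<open>C\<^sup>q\<close>.\<close>

lemma smooth_roots_flat: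
  assumes P: "hyp_curve_near n t0 P" "coeffs_in (Ck_near q t0) P" "coeffs_in (definable_near t0) P"
    and n: "n > 1" and flat: "mult_at t0 (\<lambda>t. sgn_coeff n 2 (tschirnhausen n P t)) = \<infinity>"
  shows "smooth_roots n q t0 P"
proof -
  let ?a = "\<lambda>t. sgn_coeff n 2 (tschirnhausen n P t)"
  \<comment> \<open>The squares of the centered roots are at most a multiple of the \<open>N\<close>-th power of the distance; two powers beyond \<open>2 q\<close> make the quotients tend to \<open>0\<close> and force the roots to agree at \<open>t0\<close> even for \<open>q = 0\<close>.\<close>
  obtain N g where N: "N \<ge> 2 * q + 2" and g: "continuous_near t0 g"
    and ag: "\<forall>\<^sub>F t in nhds t0. ?a t = (t - t0) ^ N * g t"
  proof -
    have "enat (2 * q + 2) < Sup {enat m |m. \<exists>g. continuous_near t0 g \<and> (\<forall>\<^sub>F t in nhds t0. ?a t = (t - t0) ^ m * g t)}"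
      using flat unfolding mult_at_def by simp
    then obtain x where "x \<in> {enat m |m. \<exists>g. continuous_near t0 g \<and> (\<forall>\<^sub>F t in nhds t0. ?a t = (t - t0) ^ m * g t)}"
      "enat (2 * q + 2) < x"
      unfolding less_Sup_iff by blast
    then obtain m g where "x = enat m" "continuous_near t0 g" "\<forall>\<^sub>F t in nhds t0. ?a t = (t - t0) ^ m * g t"
      "enat (2 * q + 2) < x" by blast
    then show ?thesis by (intro that[of m g]) auto
  qed
  obtain e1 where e1: "e1 > 0" "\<And>t. t \<in> ball t0 e1 \<Longrightarrow> hyperbolic (P t) \<and> degree (P t) = n"
    "coeffs_in (Ck_on q (ball t0 e1)) P" "coeffs_in (definable_on M (ball t0 e1)) P"
    using hyp_curve_near_definable_ball[OF P] by blast
  obtain e2 where e2: "e2 > 0" "continuous_on (ball t0 e2) g"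
    using g unfolding Ck_near_def by auto
  obtain e3 where e3: "e3 > 0" "\<And>t. dist t t0 < e3 \<Longrightarrow> ?a t = (t - t0) ^ N * g t"
    using ag unfolding eventually_nhds_metric by blast
  define e where "e = min e1 (min e2 e3)"
  have e: "e > 0" "e \<le> e1" "e \<le> e2" "e \<le> e3" using e1(1) e2(1) e3(1) by (auto simp: e_def)
  let ?B = "ball t0 e"
  have hyp: "hyperbolic (P t)" "degree (P t) = n" if "t \<in> ?B" for t
    using e1(2)[of t] that e(2) by auto
  have Ck: "coeffs_in (Ck_on q ?B) P"
    using e1(3) e(2) by (auto intro: Ck_on_subset)
  have df: "coeffs_in (definable_on M ?B) P"
    using e1(4) e(2) by (auto intro: definable_on_smaller_ball)
  let ?u = "\<lambda>i t. desc_root i (P t)" and ?c = "\<lambda>t. sgn_coeff n 1 (P t) / real n"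
  have u_def: "definable_on M ?B (?u i)" if "i < n" for i
    by (rule definable_on_desc_root[OF dreal_ball df _ that]) (use hyp in auto)
  have "coeffs_in (continuous_on ?B) P"
    using Ck Ck_on_imp_continuous_on by blast
  then have u_cont: "continuous_on ?B (?u i)" if "i < n" for i
    by (rule continuous_on_desc_root[OF _ _ that]) (use hyp in auto)
  have Pu: "P t = root_prod {..<n} (\<lambda>i. ?u i t)" if "t \<in> ?B" for t
    by (rule hyperbolic_eq_root_prod) (use hyp that in auto)
  have c_Ck: "Ck_on q ?B ?c"
    by (rule coeffs_in_tschirnhausen(1)[OF fun_ring_Ck_on Ck]) (use hyp in auto)
  have c_def: "definable_on M ?B ?c"
    by (rule coeffs_in_tschirnhausen(1)[OF fun_ring_definable_on[OF dreal_ball] df]) (use hyp in auto)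
  let ?w = "\<lambda>i t. ?u i t - ?c t"
  have w_cont: "continuous_on ?B (?w i)" if "i < n" for i
    using u_cont[OF that] Ck_on_imp_continuous_on[OF c_Ck] by (rule continuous_on_diff)
  have w_small: "(?w i t)\<^sup>2 \<le> 2 * \<bar>t - t0\<bar> ^ N * \<bar>g t\<bar>" if i: "i < n" and t: "t \<in> ?B" for i t
  proof -
    note tsch = tschirnhausen_root_prod[of n P t, OF _ Pu[OF t]]
    have cs: "?c t = (\<Sum>i<n. ?u i t) / real n"
      using tsch(1) n by simp
    have Q: "tschirnhausen n P t = root_prod {..<n} (\<lambda>i. ?w i t)"
      unfolding cs using tsch(2) n by simp
    have "(\<Sum>i<n. ?w i t) = 0"
      using n tsch(1) by (simp add: sum_subtractf)
    then have "2 * ?a t = - (\<Sum>i<n. (?w i t)\<^sup>2)"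
      using coeff_root_prod_sub2[of n "\<lambda>i. ?w i t"] n unfolding Q sgn_coeff_def by simp
    moreover have "(?w i t)\<^sup>2 \<le> (\<Sum>i<n. (?w i t)\<^sup>2)"
      using i by (intro member_le_sum) auto
    ultimately have "(?w i t)\<^sup>2 \<le> \<bar>2 * ?a t\<bar>" by linarith
    also have "?a t = (t - t0) ^ N * g t"
      using e3(2)[of t] t e(4) by (simp add: dist_commute)
    finally show ?thesis by (simp add: abs_mult power_abs)
  qed
  define v where "v i t = (if t = t0 then 0 else ?w i t / (t - t0) ^ q)" for i t
  have wv: "?w i t = (t - t0) ^ q * v i t" if i: "i < n" and t: "t \<in> ?B" for i t
  proof (cases "t = t0")
    case True
    have "(?w i t0)\<^sup>2 \<le> 0"
      using w_small[OF i, of t0] e(1) N by (simp add: zero_power)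
    then show ?thesis using True by (simp add: v_def)
  next
    case False
    then show ?thesis by (simp add: v_def)
  qed
  have v_def': "definable_on M ?B (v i)" if "i < n" for i
    by (rule definable_on_divide_power[of t0 e "?w i" q])
       (use wv that u_def c_def in \<open>auto intro!: definable_on_diff\<close>)
  have g_cont: "isCont g t0"
    using g by (rule continuous_near_imp_isCont)
  have v_lim: "(v i \<longlongrightarrow> 0) (at t0)" if i: "i < n" for i
  proof -
    have "((\<lambda>t. 2 * \<bar>t - t0\<bar> ^ (N - 2 * q) * \<bar>g t\<bar>) \<longlongrightarrow> 2 * \<bar>t0 - t0\<bar> ^ (N - 2 * q) * \<bar>g t0\<bar>) (at t0)"
      using g_cont by (intro tendsto_intros) (auto simp: isCont_def)
    moreover have "2 * \<bar>t0 - t0\<bar> ^ (N - 2 * q) * \<bar>g t0\<bar> = 0"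
      using N by (simp add: zero_power)
    ultimately have lim: "((\<lambda>t. 2 * \<bar>t - t0\<bar> ^ (N - 2 * q) * \<bar>g t\<bar>) \<longlongrightarrow> 0) (at t0)"
      by (simp only:)
    have "\<forall>\<^sub>F t in at t0. norm ((v i t)\<^sup>2) \<le> 2 * \<bar>t - t0\<bar> ^ (N - 2 * q) * \<bar>g t\<bar>"
    proof (rule eventually_at_ball[OF e(1)])
      fix t assume t: "t \<in> ?B" "t \<noteq> t0"
      let ?s = "\<bar>t - t0\<bar>"
      have s: "?s > 0" using t by simp
      have "(v i t)\<^sup>2 * ?s ^ (2 * q) = (?w i t)\<^sup>2"
        unfolding wv[OF i t(1)] by (simp add: power_mult_distrib power_even_abs power_mult[symmetric] mult.commute)
      also have "\<dots> \<le> 2 * ?s ^ N * \<bar>g t\<bar>" by (rule w_small[OF i t(1)])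
      also have "?s ^ N = ?s ^ (N - 2 * q) * ?s ^ (2 * q)"
        using N by (simp flip: power_add)
      finally have "(v i t)\<^sup>2 * ?s ^ (2 * q) \<le> (2 * ?s ^ (N - 2 * q) * \<bar>g t\<bar>) * ?s ^ (2 * q)"
        by (simp add: algebra_simps)
      moreover have "0 < ?s ^ (2 * q)" using s by (rule zero_less_power)
      ultimately have "(v i t)\<^sup>2 \<le> 2 * ?s ^ (N - 2 * q) * \<bar>g t\<bar>"
        by (rule mult_right_le_imp_le)
      then show "norm ((v i t)\<^sup>2) \<le> 2 * ?s ^ (N - 2 * q) * \<bar>g t\<bar>" by simp
    qed
    then have "((\<lambda>t. (v i t)\<^sup>2) \<longlongrightarrow> 0) (at t0)"
      using lim by (rule Lim_null_comparison)
    then have "((\<lambda>t. sqrt ((v i t)\<^sup>2)) \<longlongrightarrow> sqrt 0) (at t0)"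
      by (rule tendsto_real_sqrt)
    then show ?thesis by (simp add: tendsto_rabs_zero_iff)
  qed
  have v_cont: "continuous_on ?B (v i)" if i: "i < n" for i
  proof (intro continuous_at_imp_continuous_on ballI)
    fix t assume t: "t \<in> ?B"
    show "isCont (v i) t"
    proof (cases "t = t0")
      case True
      then show ?thesis using v_lim[OF i] by (simp add: isCont_def v_def)
    next
      case False
      have "isCont (?w i) t"
        using w_cont[OF i] t by (simp add: continuous_on_eq_continuous_at)
      then have "isCont (\<lambda>t. ?w i t / (t - t0) ^ q) t"
        by (rule isCont_divide) (use False in \<open>auto intro!: continuous_intros\<close>)
      moreover have "\<forall>\<^sub>F s in nhds t. ?w i s / (s - t0) ^ q = v i s"
        using t1_space_nhds[OF False] by eventually_elim (simp add: v_def)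
      ultimately show ?thesis
        using isCont_cong[of "\<lambda>s. ?w i s / (s - t0) ^ q" "v i" t] by (simp only:)
    qed
  qed
  have Ck': "coeffs_in (Ck_on q (?B - {t0})) P"
    using Ck by (auto intro: Ck_on_subset)
  obtain d where d: "d > 0" "d \<le> e" "\<And>i. i < n \<Longrightarrow> Ck_on q (ball t0 d - {t0}) (?u i)"
    using Ck_on_roots_punctured[OF e(1) u_def u_cont Pu Ck'] by blast
  have "Ck_near q t0 (?u i)" if i: "i < n" for i
  proof -
    let ?D = "ball t0 d"
    have sub: "?D \<subseteq> ?B" using d(2) by auto
    have "Ck_on q (?D - {t0}) (\<lambda>t. (?u i t + (- 1) * ?c t) * inverse ((t - t0) ^ q))"
      using c_Ck sub d(3)[OF i]
      by (intro Ck_on_mult Ck_on_add Ck_on_const Ck_on_inverse Ck_on_linear_power) (auto intro: Ck_on_subset)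
    then have "Ck_on q (?D - {t0}) (v i)"
      by (subst (asm) Ck_on_cong[of _ _ "v i"]) (auto simp: v_def open_delete divide_inverse)
    then have "Ck_on (0 + q) ?D (\<lambda>t. (t - t0) ^ q * v i t)"
      using v_cont[OF i] sub
      by (intro Ck_on_power_times[OF d(1)] definable_on_smaller_ball[OF v_def'[OF i] d(2)])
         (auto intro: continuous_on_subset)
    moreover have "Ck_on q ?D ?c" by (rule Ck_on_subset[OF c_Ck sub])
    ultimately have "Ck_on q ?D (\<lambda>t. (t - t0) ^ q * v i t + ?c t)"
      by (intro Ck_on_add) simp_all
    moreover have "(t - t0) ^ q * v i t + ?c t = ?u i t" if "t \<in> ?D" for t
      using wv[OF i, of t] sub that by (simp add: subset_iff)
    ultimately have "Ck_on q ?D (?u i)"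
      by (subst (asm) Ck_on_cong[of _ _ "?u i"]) auto
    with d(1) show ?thesis unfolding Ck_near_def by blast
  qed
  moreover have "definable_near t0 (?u i)" if "i < n" for i
    using u_def[OF that] e(1) unfolding definable_near_def by blast
  moreover have "\<forall>\<^sub>F t in nhds t0. P t = root_prod {..<n} (\<lambda>i. ?u i t)"
    using eventually_ball_nhds[OF e(1), of t0] by eventually_elim (rule Pu)
  ultimately show ?thesis unfolding smooth_roots_def by (intro exI[of _ ?u]) simp
qed

lemma pcompose_shift_inverse: "pcompose (pcompose p [:c, 1:]) [:- c, 1:] = (p :: real poly)"
proof -
  have "pcompose [:c, 1:] [:- c, 1:] = [:0, 1:]" by (simp add: pcompose_pCons)
  then show ?thesis by (simp flip: pcompose_assoc)
qed

text \<open>One reduction step, read backwards: roots of class \<open>C\<^sup>m\<close> of the reduced polynomial give roots of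
class \<open>C\<^bsup>m+r\<^esup>\<close>, provided that the coefficients are regular enough for the roots to have this
class off \<open>t0\<close>.\<close>

lemma smooth_roots_reduce:
  assumes P: "hyp_curve_near n t0 P" "coeffs_in (Ck_near (K + n * r) t0) P" "coeffs_in (definable_near t0) P"
    and n: "n > 1" and mK: "m \<le> K"
    and b: "\<And>k. k \<in> {2..n} \<Longrightarrow> continuous_near t0 (b k)"
    "\<And>k. k \<in> {2..n} \<Longrightarrow> \<forall>\<^sub>F t in nhds t0. sgn_coeff n k (tschirnhausen n P t) = (t - t0) ^ (k * r) * b k t"
    and IH: "coeffs_in (Ck_near K t0) (\<lambda>t. reduced_poly n (\<lambda>k. b k t)) \<Longrightarrow>
      coeffs_in (definable_near t0) (\<lambda>t. reduced_poly n (\<lambda>k. b k t)) \<Longrightarrow>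
      smooth_roots n m t0 (\<lambda>t. reduced_poly n (\<lambda>k. b k t))"
  shows "smooth_roots n (m + r) t0 P"
proof -
  let ?R = "\<lambda>t. reduced_poly n (\<lambda>k. b k t)"
  let ?a = "\<lambda>k t. sgn_coeff n k (tschirnhausen n P t)" and ?c = "\<lambda>t. sgn_coeff n 1 (P t) / real n"
  obtain e1 where e1: "e1 > 0" "\<And>t. t \<in> ball t0 e1 \<Longrightarrow> hyperbolic (P t) \<and> degree (P t) = n"
    "coeffs_in (Ck_on (K + n * r) (ball t0 e1)) P" "coeffs_in (definable_on M (ball t0 e1)) P"
    using hyp_curve_near_definable_ball[OF P] by blast
  have a_Ck: "Ck_on (K + n * r) (ball t0 e1) (?a k)" for k
    by (rule coeffs_in_tschirnhausen(2)[OF fun_ring_Ck_on[OF open_ball] e1(3)]) (use e1(2) in auto)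
  have a_def: "definable_on M (ball t0 e1) (?a k)" for k
    by (rule coeffs_in_tschirnhausen(2)[OF fun_ring_definable_on[OF dreal_ball] e1(4)]) (use e1(2) in auto)
  have c_Ck: "Ck_on (K + n * r) (ball t0 e1) ?c"
    by (rule coeffs_in_tschirnhausen(1)[OF fun_ring_Ck_on[OF open_ball] e1(3)]) (use e1(2) in auto)
  have c_def: "definable_on M (ball t0 e1) ?c"
    by (rule coeffs_in_tschirnhausen(1)[OF fun_ring_definable_on[OF dreal_ball] e1(4)]) (use e1(2) in auto)
  have b_def: "definable_near t0 (b k)" if "k \<in> {2..n}" for k
    by (rule definable_near_divide_power[OF _ b(2)[OF that]]) (use a_def e1(1) in \<open>auto simp: definable_near_def\<close>)
  have b_Ck: "Ck_near K t0 (b k)" if k: "k \<in> {2..n}" for k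
  proof -
    \<comment> \<open>The \<open>k\<close>-th coefficient needs only \<open>k r\<close> of the \<open>n r\<close> derivatives that are given up.\<close>
    have "k * r \<le> n * r" using k by simp
    then have "K + n * r = (K + (n * r - k * r)) + k * r" by linarith
    then have "Ck_near ((K + (n * r - k * r)) + k * r) t0 (?a k)"
      using a_Ck[of k] e1(1) unfolding Ck_near_def by metis
    then have "Ck_near (K + (n * r - k * r)) t0 (b k)"
      using b(1)[OF k] b(2)[OF k] by (rule Ck_near_divide_power)
    then show ?thesis by (rule Ck_near_mono) simp
  qed
  have "smooth_roots n m t0 ?R"
    by (rule IH; rule coeffs_in_monic[OF fun_ring_Ck_near[of 1] _ refl] coeffs_in_monic[OF fun_ring_definable_near[of 1] _ refl])
       (use b_def b_Ck in auto)
  then obtain v where v: "\<And>i. i < n \<Longrightarrow> definable_near t0 (v i)" "\<And>i. i < n \<Longrightarrow> Ck_near m t0 (v i)"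
    "\<forall>\<^sub>F t in nhds t0. ?R t = root_prod {..<n} (\<lambda>i. v i t)"
    unfolding smooth_roots_def by blast
  have "\<exists>e>0. \<forall>i\<in>{..<n}. definable_on M (ball t0 e) (v i)"
    by (rule common_ball) (use v(1) in \<open>auto simp: definable_near_def intro: definable_on_smaller_ball\<close>)
  then obtain e2 where e2: "e2 > 0" "\<And>i. i < n \<Longrightarrow> definable_on M (ball t0 e2) (v i)" by auto
  have "\<exists>e>0. \<forall>i\<in>{..<n}. Ck_on m (ball t0 e) (v i)"
    by (rule common_ball) (use v(2) in \<open>auto simp: Ck_near_def intro: Ck_on_subset\<close>)
  then obtain e3 where e3: "e3 > 0" "\<And>i. i < n \<Longrightarrow> Ck_on m (ball t0 e3) (v i)" by auto
  have "\<forall>\<^sub>F t in nhds t0. \<forall>k\<in>{2..n}. ?a k t = (t - t0) ^ (k * r) * b k t"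
    by (rule eventually_ball_finite) (use b(2) in auto)
  with v(3) have "\<forall>\<^sub>F t in nhds t0. ?R t = root_prod {..<n} (\<lambda>i. v i t) \<and>
      (\<forall>k\<in>{2..n}. ?a k t = (t - t0) ^ (k * r) * b k t)"
    by (rule eventually_conj)
  then obtain e4 where e4: "e4 > 0" "\<And>t. dist t t0 < e4 \<Longrightarrow> ?R t = root_prod {..<n} (\<lambda>i. v i t) \<and>
      (\<forall>k\<in>{2..n}. ?a k t = (t - t0) ^ (k * r) * b k t)"
    unfolding eventually_nhds_metric by blast
  define e where "e = min (min e1 e2) (min e3 e4)"
  have e: "e > 0" "e \<le> e1" "e \<le> e2" "e \<le> e3" "e \<le> e4"
    using e1(1) e2(1) e3(1) e4(1) by (auto simp: e_def)
  let ?B = "ball t0 e"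
  have sub: "?B \<subseteq> ball t0 e1" "?B \<subseteq> ball t0 e3" using e by auto
  have R_eq: "?R t = root_prod {..<n} (\<lambda>i. v i t)" and a_eq: "\<And>k. k \<in> {2..n} \<Longrightarrow> ?a k t = (t - t0) ^ (k * r) * b k t"
    if "t \<in> ?B" for t
    using e4(2)[of t] that e(5) by (auto simp: dist_commute)
  have v_def: "definable_on M ?B (v i)" and v_Ck: "Ck_on m ?B (v i)" if "i < n" for i
    using definable_on_smaller_ball[OF e2(2)[OF that] e(3)] Ck_on_subset[OF e3(2)[OF that] sub(2)] by auto
  have "Ck_on (K + n * r) (?B - {t0}) (b k)" if k: "k \<in> {2..n}" for k
  proof -
    have "Ck_on (K + n * r) (?B - {t0}) (\<lambda>t. ?a k t * inverse ((t - t0) ^ (k * r)))"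
      by (intro Ck_on_mult Ck_on_inverse Ck_on_linear_power Ck_on_subset[OF a_Ck]) (use sub in auto)
    then show ?thesis
      by (subst (asm) Ck_on_cong[of _ _ "b k"]) (use a_eq[OF _ k] in \<open>auto simp: open_delete\<close>)
  qed
  then have "coeffs_in (Ck_on (K + n * r) (?B - {t0})) ?R"
    by (intro coeffs_in_monic[OF fun_ring_Ck_on _ refl]) (auto simp: open_delete)
  then obtain d where d: "d > 0" "d \<le> e" "\<And>i. i < n \<Longrightarrow> Ck_on (K + n * r) (ball t0 d - {t0}) (v i)"
    using Ck_on_roots_punctured[OF e(1) v_def Ck_on_imp_continuous_on[OF v_Ck] R_eq] by blast
  let ?D = "ball t0 d"
  have D: "?D \<subseteq> ?B" "?D \<subseteq> ball t0 e1" using d(2) e(2) by auto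
  have le: "m + r \<le> K + n * r"
    using mK n by (simp add: add_mono)
  let ?l = "\<lambda>i t. (t - t0) ^ r * v i t + ?c t"
  have "Ck_near (m + r) t0 (?l i)" if i: "i < n" for i
  proof -
    have "Ck_on (m + r) ?D (\<lambda>t. (t - t0) ^ r * v i t)"
      by (rule Ck_on_power_times[OF d(1) definable_on_smaller_ball[OF v_def[OF i] d(2)]
            Ck_on_subset[OF v_Ck[OF i] D(1)] Ck_on_mono[OF d(3)[OF i] le]])
    moreover have "Ck_on (m + r) ?D ?c"
      by (rule Ck_on_mono[OF Ck_on_subset[OF c_Ck D(2)] le])
    ultimately have "Ck_on (m + r) ?D (?l i)" by (rule Ck_on_add)
    with d(1) show ?thesis unfolding Ck_near_def by blast
  qed
  moreover have "definable_near t0 (?l i)" if i: "i < n" for i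
  proof -
    have "definable_on M ?B (?l i)"
      by (intro definable_on_add definable_on_mult definable_on_linear_power dreal_ball v_def i
            definable_on_smaller_ball[OF c_def e(2)])
    with e(1) show ?thesis unfolding definable_near_def by blast
  qed
  moreover have "\<forall>\<^sub>F t in nhds t0. P t = root_prod {..<n} (\<lambda>i. ?l i t)"
    using eventually_ball_nhds[OF e(1), of t0]
  proof eventually_elim
    case (elim t)
    let ?Q = "tschirnhausen n P t" and ?s = "(t - t0) ^ r"
    have "hyperbolic (P t)" "degree (P t) = n"
      using e1(2)[of t] elim sub(1) by auto
    then have "P t = root_prod {..<n} (\<lambda>i. desc_root i (P t))"
      by (rule hyperbolic_eq_root_prod)
    note tsch = tschirnhausen_root_prod[of n P t, OF _ this]
    have Q: "?Q = root_prod {..<n} (\<lambda>i. ?s * v i t)"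
    proof (rule poly_eq_of_scaled_reduced[OF n R_eq[OF elim]])
      show "sgn_coeff n k ?Q = ?s ^ k * b k t" if "k \<in> {2..n}" for k
        using a_eq[OF elim that] by (simp add: power_mult mult.commute[of k r])
    qed (use tsch n in auto)
    have "P t = pcompose ?Q [:- ?c t, 1:]"
      unfolding tschirnhausen_def by (rule pcompose_shift_inverse[symmetric])
    also have "\<dots> = root_prod {..<n} (\<lambda>i. ?s * v i t - (- ?c t))"
      unfolding Q by (rule pcompose_root_prod)
    finally show ?case by simp
  qed
  ultimately show ?thesis unfolding smooth_roots_def by (intro exI[of _ ?l]) simp
qed

text \<open>The number \<open>q\<close> varies along the induction: a factor with smaller \<open>\<Gamma>\<close> than the product is used
with a larger \<open>q\<close>, which pays for the maximum in the definition of \<open>\<gamma>\<close>.\<close>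

lemma Gamma_rel_smooth_roots:
  assumes "Gamma_rel t0 P G g" "hyp_curve_near n t0 P"
    "coeffs_in (Ck_near (q + G) t0) P" "coeffs_in (definable_near t0) P"
  shows "smooth_roots n (q + g) t0 P"
  using assms
proof (induction arbitrary: n q rule: Gamma_rel.induct)
  case (split n' P n1 P1 n2 P2 G1 g1 G2 g2)
  let ?G = "max G1 G2" and ?D = "max (G1 - g1) (G2 - g2)"
  have def12: "coeffs_in (definable_near t0) P1" "coeffs_in (definable_near t0) P2"
    using factors_definable_near[OF split.prems(1,3) split.hyps(4,6,8,9)] by auto
  have Ck12: "coeffs_in (Ck_near (q + ?G) t0) P1" "coeffs_in (Ck_near (q + ?G) t0) P2"
    using split.hyps(7)[OF split.prems(2)] by auto
  have g: "g1 \<le> G1" "g2 \<le> G2"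
    using split.hyps(10,11) by (auto intro: Gamma_rel_le)
  have mono: "smooth_roots m k t0 R" if "smooth_roots m l t0 R" "k \<le> l" for m k l R
    using that Ck_near_mono unfolding smooth_roots_def by blast
  have "smooth_roots n1 (q + (?G - G1) + g1) t0 P1"
    by (rule split.IH(1)[OF split.hyps(4) _ def12(1)]) (use Ck12(1) in \<open>simp add: add.assoc\<close>)
  then have 1: "smooth_roots n1 (q + (?G - ?D)) t0 P1"
    by (rule mono) (use g in auto)
  have "smooth_roots n2 (q + (?G - G2) + g2) t0 P2"
    by (rule split.IH(2)[OF split.hyps(6) _ def12(2)]) (use Ck12(2) in \<open>simp add: add.assoc\<close>)
  then have 2: "smooth_roots n2 (q + (?G - ?D)) t0 P2"
    by (rule mono) (use g in auto)
  have "P t0 = P1 t0 * P2 t0" using split.hyps(8) by (rule eventually_nhds_x_imp_x)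
  then have "n = n1 + n2"
    using hyp_curve_near_at[OF split.prems(1)] hyp_curve_near_at[OF split.hyps(4)] hyp_curve_near_at[OF split.hyps(6)]
    by (auto simp: degree_mult_eq hyperbolic_nonzero)
  then show ?case
    using smooth_roots_mult[OF 1 2 split.hyps(8)] by simp
next
  case (reduce n' P Q r b G g)
  have n': "n' = n" using reduce.hyps(1) reduce.prems(1) by (rule hyp_curve_near_unique)
  have "g \<le> G" using reduce.hyps(9) by (rule Gamma_rel_le)
  obtain l where l: "hyp_curve_near l t0 (\<lambda>t. reduced_poly n (\<lambda>k. b k t))"
    using Gamma_rel_hyp[OF reduce.hyps(9)] n' by auto
  have "l = n"
    using hyp_curve_near_at(2)[OF l] coeff_reduced_poly(4)[of n] reduce.hyps(2) n' by simp
  have "smooth_roots n ((q + g) + r) t0 P"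
  proof (rule smooth_roots_reduce[where K = "q + G" and b = b])
    show "coeffs_in (Ck_near (q + G + n * r) t0) P"
      using reduce.prems(2) n' by (simp add: add.assoc)
    show "smooth_roots n (q + g) t0 (\<lambda>t. reduced_poly n (\<lambda>k. b k t))"
      if "coeffs_in (Ck_near (q + G) t0) (\<lambda>t. reduced_poly n (\<lambda>k. b k t))"
        "coeffs_in (definable_near t0) (\<lambda>t. reduced_poly n (\<lambda>k. b k t))"
      using reduce.IH[of n q] l that unfolding n' \<open>l = n\<close> by blast
  qed (use reduce.prems reduce.hyps n' \<open>g \<le> G\<close> in auto)
  then show ?case by (simp add: add.assoc)
next
  case (flat n' P)
  have "n' = n" using flat.hyps(1) flat.prems(1) by (rule hyp_curve_near_unique)
  then show ?case using smooth_roots_flat[of n t0 P q] flat by simp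
next
  case (linear P)
  have "n = 1" using linear.prems(1) linear.hyps by (rule hyp_curve_near_unique)
  then show ?case using smooth_roots_linear[of t0 P q] linear by simp
qed

end

section \<open>Smooth roots on an interval\<close>

lemma single_root_reduction_zero:
  assumes "hyp_curve_near n t0 P" "n > 1"
    and P: "\<forall>\<^sub>F t in nhds t0. P t = root_prod A (\<lambda>i. u i t)" "finite A"
    and single: "\<forall>\<^sub>F t in nhds t0. \<forall>i\<in>A. u i t = u i0 t"
  shows "\<forall>\<^sub>F t in nhds t0. sgn_coeff n 2 (tschirnhausen n P t) = 0"
proof -
  have "\<forall>\<^sub>F t in nhds t0. hyperbolic (P t) \<and> degree (P t) = n"
    using assms(1) unfolding hyp_curve_near_def by blast
  then show ?thesis
    using P(1) single
  proof eventually_elim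
    case (elim t)
    have "n = card A"
      using elim(1,2) degree_root_prod[of "\<lambda>i. u i t" A] by simp
    moreover have "P t = (\<Prod>i\<in>A. [:- u i0 t, 1:])"
      unfolding elim(2) by (rule prod.cong) (use elim(3) in auto)
    ultimately have "P t = root_prod {..<n} (\<lambda>_. u i0 t)" by simp
    then have "tschirnhausen n P t = root_prod {..<n} (\<lambda>_. u i0 t - (\<Sum>i<n. u i0 t) / real n)"
      using \<open>n > 1\<close> by (intro tschirnhausen_root_prod(2)) auto
    then have "tschirnhausen n P t = root_prod {..<n} (\<lambda>_. 0)"
      using \<open>n > 1\<close> by simp
    then show ?case
      using coeff_root_prod_sub2[of n "\<lambda>_. 0"] \<open>n > 1\<close> unfolding sgn_coeff_def by simp
  qed
qed

text \<open>If roots that agree at \<open>t0\<close> agree near \<open>t0\<close>, no reduction step can occur: the second coefficient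
of the centered polynomial would vanish identically near \<open>t0\<close>, contrary to \<open>b\<^sub>2(t0) \<noteq> 0\<close>.\<close>

lemma Gamma_rel_constant_multiplicities:
  assumes "Gamma_rel t0 P G g" "finite A"
    and "\<And>i. i \<in> A \<Longrightarrow> continuous_near t0 (u i)"
    and "\<forall>\<^sub>F t in nhds t0. P t = root_prod A (\<lambda>i. u i t)"
    and "\<And>i j. i \<in> A \<Longrightarrow> j \<in> A \<Longrightarrow> u i t0 = u j t0 \<Longrightarrow> \<forall>\<^sub>F t in nhds t0. u i t = u j t"
  shows "G = 0"
  using assms
proof (induction arbitrary: A rule: Gamma_rel.induct)
  case (split n P n1 P1 n2 P2 G1 g1 G2 g2)
  have e: "\<forall>\<^sub>F t in nhds t0. P1 t * P2 t = root_prod A (\<lambda>i. u i t)"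
    using split.hyps(8) split.prems(3) by eventually_elim simp
  obtain S where S: "S \<subseteq> A" "\<forall>\<^sub>F t in nhds t0. P1 t = root_prod S (\<lambda>i. u i t)"
    "\<forall>\<^sub>F t in nhds t0. P2 t = root_prod (A - S) (\<lambda>i. u i t)"
    using factor_root_indices[OF split.prems(1) split.hyps(4,6) continuous_near_imp_isCont[OF split.prems(2)] e
        split.hyps(9)] by blast
  have "G1 = 0"
  proof (rule split.IH(1)[OF _ _ S(2)])
    show "finite S" using S(1) split.prems(1) by (rule finite_subset)
    show "continuous_near t0 (u i)" if "i \<in> S" for i
      by (rule split.prems(2)) (use that S(1) in blast)
    show "\<forall>\<^sub>F t in nhds t0. u i t = u j t" if "i \<in> S" "j \<in> S" "u i t0 = u j t0" for i j
      by (rule split.prems(4)[OF _ _ that(3)]) (use that S(1) in blast)+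
  qed
  moreover have "G2 = 0"
  proof (rule split.IH(2)[OF _ _ S(3)])
    show "finite (A - S)" using split.prems(1) by (rule finite_Diff)
    show "continuous_near t0 (u i)" if "i \<in> A - S" for i
      by (rule split.prems(2)) (use that in blast)
    show "\<forall>\<^sub>F t in nhds t0. u i t = u j t" if "i \<in> A - S" "j \<in> A - S" "u i t0 = u j t0" for i j
      by (rule split.prems(4)[OF _ _ that(3)]) (use that in blast)+
  qed
  ultimately show ?case by simp
next
  case (reduce n P Q r b G g)
  have P0: "P t0 = root_prod A (\<lambda>i. u i t0)"
    using reduce.prems(3) by (rule eventually_nhds_x_imp_x)
  obtain x where x: "{x. poly (P t0) x = 0} = {x}"
    using reduce.hyps(3) by (rule card_1_singletonE)
  have ux: "u i t0 = x" if "i \<in> A" for i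
  proof -
    have "poly (P t0) (u i t0) = 0"
      unfolding P0 using that reduce.prems(1) by (auto simp: poly_root_prod_eq_0)
    with x show ?thesis by blast
  qed
  have "\<exists>i\<in>A. u i t0 = x"
    using x P0 reduce.prems(1) poly_root_prod_eq_0[of A "\<lambda>i. u i t0" x] by (simp add: set_eq_iff)
  then obtain i0 where i0: "i0 \<in> A" by blast
  have "\<forall>\<^sub>F t in nhds t0. \<forall>i\<in>A. u i t = u i0 t"
    by (rule eventually_ball_finite[OF reduce.prems(1)]) (use reduce.prems(4) i0 ux in auto)
  then have "\<forall>\<^sub>F t in nhds t0. sgn_coeff n 2 (tschirnhausen n P t) = 0"
    by (rule single_root_reduction_zero[OF reduce.hyps(1,2) reduce.prems(3,1)])
  moreover have "\<forall>\<^sub>F t in nhds t0. sgn_coeff n 2 (Q t) = (t - t0) ^ (2 * r) * b 2 t"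
    using reduce.hyps(7)[of 2] reduce.hyps(2) by simp
  ultimately have "\<forall>\<^sub>F t in nhds t0. (t - t0) ^ (2 * r) * b 2 t = (t - t0) ^ (2 * r) * 0"
    unfolding reduce.hyps(4) by eventually_elim simp
  then have "\<forall>\<^sub>F t in nhds t0. b 2 t = 0"
    by (rule continuous_near_eq_of_power_multiples[rotated 2])
       (use reduce.hyps(2,6) Ck_near_of_all[OF Ck_on_const] in auto)
  then have "b 2 t0 = 0" by (rule eventually_nhds_x_imp_x)
  with reduce.hyps(8) show ?case by simp
qed auto

lemma root_prod_eq_imp_bij:
  assumes "finite A" "finite B" "root_prod A x = root_prod B y"
  shows "\<exists>\<sigma>. bij_betw \<sigma> B A \<and> (\<forall>j\<in>B. x (\<sigma> j) = y j)"
  using assms(2,1,3)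
proof (induction B arbitrary: A rule: finite_induct)
  case empty
  then have "card A = 0"
    using degree_root_prod[of x A] by simp
  with empty.prems(1) have "A = {}" by simp
  then show ?case by (auto simp: bij_betw_def)
next
  case (insert b B)
  have "poly (root_prod A x) (y b) = 0"
    unfolding insert.prems(2) using insert.hyps by (subst poly_root_prod_eq_0) auto
  then obtain a where a: "a \<in> A" "x a = y b"
    using poly_root_prod_eq_0[OF insert.prems(1)] by blast
  have "[:- y b, 1:] * root_prod (A - {a}) x = root_prod A x"
    using prod.remove[OF insert.prems(1) a(1), of "\<lambda>i. [:- x i, 1:]"] a(2) by simp
  also have "\<dots> = [:- y b, 1:] * root_prod B y"
    using insert.prems(2) insert.hyps by simp
  finally have "root_prod (A - {a}) x = root_prod B y"
    using mult_left_cancel[of "[:- y b, 1:]"] by (simp del: mult_pCons_left)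
  then obtain \<sigma> where \<sigma>: "bij_betw \<sigma> B (A - {a})" "\<forall>j\<in>B. x (\<sigma> j) = y j"
    using insert.IH[of "A - {a}"] insert.prems(1) by auto
  let ?\<sigma> = "\<sigma>(b := a)"
  have "bij_betw ?\<sigma> B (A - {a})"
    using \<sigma>(1) insert.hyps(2) by (subst bij_betw_cong[of B ?\<sigma> \<sigma>]) auto
  then have "bij_betw ?\<sigma> (B \<union> {b}) ((A - {a}) \<union> {a})"
    by (rule bij_betw_combine) (auto simp: bij_betw_def)
  moreover have "(A - {a}) \<union> {a} = A" "B \<union> {b} = insert b B" using a(1) by auto
  ultimately have "bij_betw ?\<sigma> (insert b B) A" by simp
  moreover have "\<forall>j\<in>insert b B. x (?\<sigma> j) = y j"
    using \<sigma>(2) a(2) insert.hyps(2) by auto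
  ultimately show ?case by blast
qed

text \<open>At a single point two lists of the roots differ by a permutation. The dichotomy says that an
equation between members of the lists that holds at a generic point holds eventually, so one
permutation works eventually.\<close>

lemma root_families_permutation:
  assumes "F \<noteq> bot" and eq: "\<forall>\<^sub>F t in F. root_prod {..<n} (\<lambda>i. u i t) = root_prod {..<n} (\<lambda>i. v i t)"
    and dich: "\<And>i j. i < n \<Longrightarrow> j < n \<Longrightarrow> (\<forall>\<^sub>F t in F. u i t = v j t) \<or> (\<forall>\<^sub>F t in F. u i t \<noteq> v j t)"
  shows "\<exists>\<sigma>. bij_betw \<sigma> {..<n} {..<n} \<and> (\<forall>j<n. \<forall>\<^sub>F t in F. u (\<sigma> j) t = v j t)"
proof -
  have "\<forall>\<^sub>F t in F. \<forall>(i, j)\<in>{..<n}\<times>{..<n}. u i t = v j t \<longrightarrow> (\<forall>\<^sub>F t in F. u i t = v j t)"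
  proof (rule eventually_ball_finite, simp, intro ballI)
    fix ij assume "ij \<in> {..<n} \<times> {..<n}"
    then obtain i j where ij: "ij = (i, j)" "i < n" "j < n" by auto
    show "\<forall>\<^sub>F t in F. case ij of (i, j) \<Rightarrow> u i t = v j t \<longrightarrow> (\<forall>\<^sub>F t in F. u i t = v j t)"
      using dich[OF ij(2,3)] unfolding ij(1) prod.case
    proof
      assume "\<forall>\<^sub>F t in F. u i t \<noteq> v j t"
      then show "\<forall>\<^sub>F t in F. u i t = v j t \<longrightarrow> (\<forall>\<^sub>F t in F. u i t = v j t)"
        by eventually_elim simp
    qed simp
  qed
  with eq have "\<forall>\<^sub>F t in F. root_prod {..<n} (\<lambda>i. u i t) = root_prod {..<n} (\<lambda>i. v i t) \<and>
      (\<forall>(i, j)\<in>{..<n}\<times>{..<n}. u i t = v j t \<longrightarrow> (\<forall>\<^sub>F t in F. u i t = v j t))"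
    by (rule eventually_conj)
  then obtain t where t: "root_prod {..<n} (\<lambda>i. u i t) = root_prod {..<n} (\<lambda>i. v i t)"
    "\<And>i j. i < n \<Longrightarrow> j < n \<Longrightarrow> u i t = v j t \<Longrightarrow> (\<forall>\<^sub>F t in F. u i t = v j t)"
    using eventually_happens'[OF assms(1)] by fastforce
  obtain \<sigma> where \<sigma>: "bij_betw \<sigma> {..<n} {..<n}" "\<forall>j\<in>{..<n}. u (\<sigma> j) t = v j t"
    using root_prod_eq_imp_bij[OF _ _ t(1)] by auto
  have "\<sigma> j < n" if "j < n" for j
    using \<sigma>(1) that by (auto simp: bij_betw_def)
  with \<sigma> t(2) show ?thesis by (intro exI[of _ \<sigma>]) auto
qed

lemma degree_monic_poly:
  fixes c :: "nat \<Rightarrow> real"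
  assumes "p = monom 1 n + (\<Sum>k=1..n. monom (c k) (n - k))"
  shows "degree p = n"
proof -
  have c: "coeff p j = (if j = n then 1 else 0) + (\<Sum>k=1..n. if n - k = j then c k else 0)" for j
    unfolding assms by (auto simp: coeff_sum)
  have "degree p \<le> n"
  proof (rule degree_le, intro allI impI)
    fix j assume "n < j"
    then show "coeff p j = 0" unfolding c by (auto intro!: sum.neutral)
  qed
  moreover have "(\<Sum>k=1..n. if n - k = n then c k else 0) = 0"
    by (intro sum.neutral) auto
  then have "coeff p n = 1" unfolding c by simp
  then have "n \<le> degree p" by (intro le_degree) simp
  ultimately show ?thesis by simp
qed

context o_minimal
begin

definition global_roots :: "nat \<Rightarrow> nat \<Rightarrow> real set \<Rightarrow> (real \<Rightarrow> real poly) \<Rightarrow> bool" where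
  "global_roots n k J P \<longleftrightarrow> (\<exists>u. (\<forall>i<n. definable_on M J (u i) \<and> Ck_on k J (u i)) \<and>
     (\<forall>t\<in>J. P t = root_prod {..<n} (\<lambda>i. u i t)))"

text \<open>The filter will be a one-sided neighbourhood filter.\<close>

lemma definable_eq_dichotomy:
  assumes "definable_on M J f" "definable_on M J g" "\<forall>\<^sub>F t in F. t \<in> J"
    and "\<And>S. dreal S \<Longrightarrow> (\<forall>\<^sub>F t in F. t \<in> S) \<or> (\<forall>\<^sub>F t in F. t \<notin> S)"
  shows "(\<forall>\<^sub>F t in F. f t = g t) \<or> (\<forall>\<^sub>F t in F. f t \<noteq> g t)"
proof -
  have "dreal {t\<in>J. f t - g t = 0}"
    by (intro dreal_zero_set definable_on_diff assms(1,2))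
  then show ?thesis
  proof (rule disjE[OF assms(4)])
    assume "\<forall>\<^sub>F t in F. t \<in> {t\<in>J. f t - g t = 0}"
    then have "\<forall>\<^sub>F t in F. f t = g t" by eventually_elim simp
    then show ?thesis ..
  next
    assume "\<forall>\<^sub>F t in F. t \<notin> {t\<in>J. f t - g t = 0}"
    then have "\<forall>\<^sub>F t in F. f t \<noteq> g t" using assms(3) by eventually_elim simp
    then show ?thesis ..
  qed
qed

text \<open>The choice of roots near \<open>b\<close> agrees on the left of \<open>b\<close> with a permutation of the left choice, and
on the right with a permutation of the right choice. Renumbering the middle and the right choice
accordingly extends the left choice across \<open>b\<close> without loss of regularity.\<close>

lemma global_roots_glue:
  assumes J: "open J" "b \<in> J"
    and left: "global_roots n k (J \<inter> {..<b}) P" and right: "global_roots n k (J \<inter> {b<..}) P"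
    and at_b: "smooth_roots n k b P"
  shows "global_roots n k J P"
proof -
  let ?L = "J \<inter> {..<b}" and ?R = "J \<inter> {b<..}"
  obtain v where v: "\<And>i. i < n \<Longrightarrow> definable_near b (v i)" "\<And>i. i < n \<Longrightarrow> Ck_near k b (v i)"
    "\<forall>\<^sub>F t in nhds b. P t = root_prod {..<n} (\<lambda>i. v i t)"
    using at_b unfolding smooth_roots_def by blast
  obtain l where l: "\<And>i. i < n \<Longrightarrow> definable_on M ?L (l i)" "\<And>i. i < n \<Longrightarrow> Ck_on k ?L (l i)"
    "\<And>t. t \<in> ?L \<Longrightarrow> P t = root_prod {..<n} (\<lambda>i. l i t)"
    using left unfolding global_roots_def by blast
  obtain r where r: "\<And>i. i < n \<Longrightarrow> definable_on M ?R (r i)" "\<And>i. i < n \<Longrightarrow> Ck_on k ?R (r i)"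
    "\<And>t. t \<in> ?R \<Longrightarrow> P t = root_prod {..<n} (\<lambda>i. r i t)"
    using right unfolding global_roots_def by blast
  have nearJ: "\<forall>\<^sub>F t in nhds b. t \<in> J" using J by (rule eventually_nhds_in_open)
  have side: "\<forall>\<^sub>F t in F. X t" if "\<forall>\<^sub>F t in nhds b. X t" "F \<le> nhds b" for F X
    using that filter_leD by blast
  have le: "at_left b \<le> nhds b" "at_right b \<le> nhds b"
    unfolding at_within_def by (rule inf_le1)+
  have side_less: "\<forall>\<^sub>F t in at_left b. t < b" "\<forall>\<^sub>F t in at_right b. b < t"
    by (simp_all add: eventually_at_filter)
  have inL: "\<forall>\<^sub>F t in at_left b. t \<in> ?L"
    using side[OF nearJ le(1)] side_less(1) by eventually_elim simp
  have inR: "\<forall>\<^sub>F t in at_right b. t \<in> ?R"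
    using side[OF nearJ le(2)] side_less(2) by eventually_elim simp
  have vball: "\<exists>e>0. definable_on M (ball b e) (v i)" if "i < n" for i
    using v(1)[OF that] unfolding definable_near_def .
  have dichL: "(\<forall>\<^sub>F t in at_left b. v i t = l j t) \<or> (\<forall>\<^sub>F t in at_left b. v i t \<noteq> l j t)"
    if ij: "i < n" "j < n" for i j
  proof -
    obtain e where e: "e > 0" "definable_on M (ball b e) (v i)" using vball[OF ij(1)] by blast
    have D: "dreal (?L \<inter> ball b e)"
      by (rule dset_cong[OF dset_conj[OF _ definable_on_domain[OF l(1)[OF ij(2)]] dreal_ball[of b e]]]) auto
    have "definable_on M (?L \<inter> ball b e) (v i)" "definable_on M (?L \<inter> ball b e) (l j)"
      using definable_on_subset[OF e(2) D] definable_on_subset[OF l(1)[OF ij(2)] D] by auto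
    moreover have "\<forall>\<^sub>F t in at_left b. t \<in> ?L \<inter> ball b e"
      using inL side[OF eventually_ball_nhds[OF e(1)] le(1)] by eventually_elim simp
    ultimately show ?thesis by (rule definable_eq_dichotomy) (rule dreal_at_left)
  qed
  have dichR: "(\<forall>\<^sub>F t in at_right b. r i t = v j t) \<or> (\<forall>\<^sub>F t in at_right b. r i t \<noteq> v j t)"
    if ij: "i < n" "j < n" for i j
  proof -
    obtain e where e: "e > 0" "definable_on M (ball b e) (v j)" using vball[OF ij(2)] by blast
    have D: "dreal (?R \<inter> ball b e)"
      by (rule dset_cong[OF dset_conj[OF _ definable_on_domain[OF r(1)[OF ij(1)]] dreal_ball[of b e]]]) auto
    have "definable_on M (?R \<inter> ball b e) (r i)" "definable_on M (?R \<inter> ball b e) (v j)"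
      using definable_on_subset[OF e(2) D] definable_on_subset[OF r(1)[OF ij(1)] D] by auto
    moreover have "\<forall>\<^sub>F t in at_right b. t \<in> ?R \<inter> ball b e"
      using inR side[OF eventually_ball_nhds[OF e(1)] le(2)] by eventually_elim simp
    ultimately show ?thesis by (rule definable_eq_dichotomy) (rule dreal_at_right)
  qed
  have eqL: "\<forall>\<^sub>F t in at_left b. root_prod {..<n} (\<lambda>i. v i t) = root_prod {..<n} (\<lambda>i. l i t)"
    using inL side[OF v(3) le(1)] by eventually_elim (use l(3) in simp)
  have eqR: "\<forall>\<^sub>F t in at_right b. root_prod {..<n} (\<lambda>i. r i t) = root_prod {..<n} (\<lambda>i. v i t)"
    using inR side[OF v(3) le(2)] by eventually_elim (use r(3) in simp)
  obtain \<sigma> where \<sigma>: "bij_betw \<sigma> {..<n} {..<n}" "\<And>j. j < n \<Longrightarrow> \<forall>\<^sub>F t in at_left b. v (\<sigma> j) t = l j t"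
    using root_families_permutation[OF trivial_limit_at_left_real eqL dichL] by blast
  obtain \<tau> where \<tau>: "bij_betw \<tau> {..<n} {..<n}" "\<And>j. j < n \<Longrightarrow> \<forall>\<^sub>F t in at_right b. r (\<tau> j) t = v j t"
    using root_families_permutation[OF trivial_limit_at_right_real eqR dichR] by blast
  have \<sigma>n: "\<sigma> j < n" and \<tau>n: "\<tau> j < n" if "j < n" for j
    using \<sigma>(1) \<tau>(1) that by (auto simp: bij_betw_def)
  \<comment> \<open>The left choice keeps its numbering.\<close>
  define u where "u j t = (if t < b then l j t else if t = b then v (\<sigma> j) t else r (\<tau> (\<sigma> j)) t)" for j t
  have u_near: "\<forall>\<^sub>F t in nhds b. v (\<sigma> j) t = u j t" if j: "j < n" for j
  proof -
    have "\<forall>\<^sub>F t in at_left b. v (\<sigma> j) t = u j t"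
      using \<sigma>(2)[OF j] side_less(1) by eventually_elim (simp add: u_def)
    moreover have "\<forall>\<^sub>F t in at_right b. v (\<sigma> j) t = u j t"
      using \<tau>(2)[OF \<sigma>n[OF j]] side_less(2) by eventually_elim (simp add: u_def)
    ultimately have "\<forall>\<^sub>F t in at b. v (\<sigma> j) t = u j t"
      by (simp add: eventually_at_split)
    moreover have "v (\<sigma> j) b = u j b" by (simp add: u_def)
    ultimately show ?thesis
      unfolding eventually_at_filter by (auto elim!: eventually_mono)
  qed
  have open_sides: "open ?L" "open ?R" using J(1) by auto
  have "Ck_on k J (u j)" if j: "j < n" for j
  proof (rule Ck_on_local)
    fix t assume t: "t \<in> J"
    consider "t \<in> ?L" | "t = b" | "t \<in> ?R" using t by force
    then show "Ck_near k t (u j)"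
    proof cases
      case 1
      have "Ck_on k ?L (u j)"
        using l(2)[OF j] by (subst Ck_on_cong[OF open_sides(1), of _ "l j"]) (auto simp: u_def)
      then show ?thesis using open_sides(1) 1 by (intro Ck_on_imp_near)
    next
      case 2
      then show ?thesis using Ck_near_cong[OF u_near[OF j] v(2)[OF \<sigma>n[OF j]]] by simp
    next
      case 3
      have "Ck_on k ?R (u j)"
        using r(2)[OF \<tau>n[OF \<sigma>n[OF j]]]
        by (subst Ck_on_cong[OF open_sides(2), of _ "r (\<tau> (\<sigma> j))"]) (auto simp: u_def)
      then show ?thesis using open_sides(2) 3 by (intro Ck_on_imp_near)
    qed
  qed
  moreover have "definable_on M J (u j)" if j: "j < n" for j
  proof -
    have "definable_on M ?L (u j)"
      by (rule definable_on_cong[OF l(1)[OF j]]) (simp add: u_def)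
    moreover have "definable_on M ?R (u j)"
      by (rule definable_on_cong[OF r(1)[OF \<tau>n[OF \<sigma>n[OF j]]]]) (simp add: u_def)
    moreover have "definable_on M {b} (u j)"
      by (rule definable_on_cong[OF definable_on_const[OF dreal_singleton, of b "u j b"]]) simp
    ultimately have "definable_on M (?L \<union> {b} \<union> ?R) (u j)"
      by (intro definable_on_Un)
    moreover have "?L \<union> {b} \<union> ?R = J" using J(2) by auto
    ultimately show ?thesis by simp
  qed
  moreover have "P t = root_prod {..<n} (\<lambda>i. u i t)" if t: "t \<in> J" for t
  proof -
    consider "t \<in> ?L" | "t = b" | "t \<in> ?R" using t by force
    then show ?thesis
    proof cases
      case 1
      then show ?thesis using l(3)[OF 1] by (simp add: u_def)
    next
      case 2
      have "P b = root_prod {..<n} (\<lambda>i. v i b)" using v(3) by (rule eventually_nhds_x_imp_x)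
      also have "\<dots> = root_prod {..<n} (\<lambda>i. v (\<sigma> i) b)"
        by (rule prod.reindex_bij_betw[OF \<sigma>(1), symmetric])
      finally show ?thesis using 2 by (simp add: u_def)
    next
      case 3
      have "P t = root_prod {..<n} (\<lambda>i. r i t)" by (rule r(3)[OF 3])
      also have "\<dots> = root_prod {..<n} (\<lambda>i. r (\<tau> i) t)"
        by (rule prod.reindex_bij_betw[OF \<tau>(1), symmetric])
      also have "\<dots> = root_prod {..<n} (\<lambda>i. r (\<tau> (\<sigma> i)) t)"
        by (rule prod.reindex_bij_betw[OF \<sigma>(1), symmetric])
      finally show ?thesis using 3 by (simp add: u_def)
    qed
  qed
  ultimately show ?thesis unfolding global_roots_def by (intro exI[of _ u]) simp
qed

text \<open>Cutting at an exceptional point leaves fewer exceptional points on either side.\<close>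

lemma global_roots_of_local:
  assumes "finite E"
    and local: "\<And>t. t \<in> I \<Longrightarrow> smooth_roots n k t P"
    and generic: "\<And>J. open J \<Longrightarrow> is_interval J \<Longrightarrow> J \<subseteq> I \<Longrightarrow> E \<inter> J = {} \<Longrightarrow> global_roots n k J P"
    and "open J" "is_interval J" "J \<subseteq> I"
  shows "global_roots n k J P"
  using assms(4-6)
proof (induction "card (E \<inter> J)" arbitrary: J rule: less_induct)
  case less
  show ?case
  proof (cases "E \<inter> J = {}")
    case True
    then show ?thesis using generic less.prems by blast
  next
    case False
    then obtain b where b: "b \<in> E" "b \<in> J" by blast
    have sub: "global_roots n k (J \<inter> T) P" if T: "open T" "is_interval T" "b \<notin> T" for T
    proof (rule less.hyps)
      have "E \<inter> (J \<inter> T) \<subset> E \<inter> J" using b T(3) by blast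
      then show "card (E \<inter> (J \<inter> T)) < card (E \<inter> J)"
        using assms(1) by (intro psubset_card_mono) auto
    qed (use T less.prems in \<open>auto intro: is_interval_Int\<close>)
    show ?thesis
    proof (rule global_roots_glue[OF less.prems(1) b(2)])
      show "global_roots n k (J \<inter> {..<b}) P" "global_roots n k (J \<inter> {b<..}) P"
        by (rule sub; simp add: is_interval_1)+
      show "smooth_roots n k b P" using local b less.prems by blast
    qed
  qed
qed

text \<open>The exceptional set consists of the frontier points of the sets where two ordered roots agree.
Off this set \<open>\<Gamma>\<close> vanishes, hence \<open>\<Gamma>\<close> has only finitely many values and its supremum bounds them.\<close>

lemma global_roots_Gamma:
  fixes I :: "real set" and a :: "nat \<Rightarrow> real \<Rightarrow> real"
  assumes I: "open I" "is_interval I"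
    and P: "\<And>t. t \<in> I \<Longrightarrow> P t = monom 1 n + (\<Sum>j=1..n. monom ((-1) ^ j * a j t) (n - j))"
    and hyp: "\<And>t. t \<in> I \<Longrightarrow> hyperbolic (P t)"
    and a_def: "\<And>j. j \<in> {1..n} \<Longrightarrow> definable_on M I (a j)"
    and Gdef: "\<And>t0. t0 \<in> I \<Longrightarrow> Gamma_defined t0 P"
    and a_Ck: "\<And>j. j \<in> {1..n} \<Longrightarrow> Ck_on (p + Gamma_on I P) I (a j)"
  shows "global_roots n (p + gamma_on I P) I P"
proof -
  let ?K = "p + Gamma_on I P"
  have deg: "degree (P t) = n" if "t \<in> I" for t
    by (rule degree_monic_poly[OF P[OF that]])
  have P_def: "coeffs_in (definable_on M I) P"
    by (rule coeffs_in_monic[OF fun_ring_definable_on[OF dreal_interval[OF I]] a_def P])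
  have P_Ck: "coeffs_in (Ck_on ?K I) P"
    by (rule coeffs_in_monic[OF fun_ring_Ck_on[OF I(1)] a_Ck P])
  have near_I: "\<exists>e>0. ball t e \<subseteq> I" if "t \<in> I" for t
    using I(1) that by (auto elim: openE)
  have near_Ck: "coeffs_in (Ck_near ?K t) P" if "t \<in> I" for t
    using P_Ck Ck_on_imp_near[OF I(1) that] by blast
  have near_def: "definable_near t f" if "t \<in> I" "definable_on M I f" for t f
    using near_I[OF that(1)] definable_on_subset[OF that(2) dreal_ball] unfolding definable_near_def by blast
  have hyp_near: "hyp_curve_near n t P" if t: "t \<in> I" for t
    unfolding hyp_curve_near_def
  proof (intro conjI allI)
    show "\<forall>\<^sub>F t in nhds t. hyperbolic (P t) \<and> degree (P t) = n"
      using eventually_nhds_in_open[OF I(1) t] by eventually_elim (simp add: hyp deg)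
    show "continuous_near t (\<lambda>t. coeff (P t) j)" for j
      using near_Ck[OF t] Ck_near_mono by blast
  qed
  let ?u = "\<lambda>i t. desc_root i (P t)"
  have u_def: "definable_on M I (?u i)" if "i < n" for i
    by (rule definable_on_desc_root[OF dreal_interval[OF I] P_def _ that]) (simp add: hyp deg)
  have "coeffs_in (continuous_on I) P"
    using P_Ck Ck_on_imp_continuous_on by blast
  then have u_cont: "continuous_on I (?u i)" if "i < n" for i
    by (rule continuous_on_desc_root[OF _ _ that]) (simp add: hyp deg)
  have Pu: "P t = root_prod {..<n} (\<lambda>i. ?u i t)" if "t \<in> I" for t
    by (rule hyperbolic_eq_root_prod[OF hyp[OF that] deg[OF that]])
  have u_near: "continuous_near t (?u i)" if "t \<in> I" "i < n" for t i
    by (rule Ck_on_imp_near[OF I(1) that(1)]) (simp add: u_cont[OF that(2)])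
  define E where "E = (\<Union>i<n. \<Union>j<n. frontier {t\<in>I. ?u i t - ?u j t = 0})"
  have E: "finite E"
    unfolding E_def
    by (intro finite_UN_I finite_lessThan finite_frontier_dreal dreal_zero_set definable_on_diff u_def) simp_all
  have pattern: "\<forall>\<^sub>F s in nhds t. ?u i s = ?u j s"
    if t: "t \<in> I - E" and ij: "i < n" "j < n" and eq: "?u i t = ?u j t" for t i j
  proof -
    let ?Z = "{t\<in>I. ?u i t - ?u j t = 0}"
    have "t \<in> ?Z" using t eq by simp
    moreover have "t \<notin> frontier ?Z" using t ij by (auto simp: E_def)
    ultimately have "t \<in> interior ?Z"
      using closure_subset[of ?Z] by (auto simp: frontier_def)
    then have "\<forall>\<^sub>F s in nhds t. s \<in> interior ?Z"
      by (intro eventually_nhds_in_open) auto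
    then show ?thesis
      by eventually_elim (use interior_subset[of ?Z] in auto)
  qed
  have rel: "Gamma_rel t P (Gamma_at t P) (gamma_at t P)" if "t \<in> I" for t
    using Gdef[OF that] Gamma_at_eq unfolding Gamma_defined_def by metis
  have zero: "Gamma_at t P = 0" if t: "t \<in> I - E" for t
  proof (rule Gamma_rel_constant_multiplicities[OF rel finite_lessThan[of n]])
    show "\<forall>\<^sub>F s in nhds t. P s = root_prod {..<n} (\<lambda>i. ?u i s)"
      using eventually_nhds_in_open[OF I(1), of t] t by (auto elim!: eventually_mono intro: Pu)
  qed (use t u_near pattern in auto)
  have fin: "finite (f ` I)" if "\<And>t. t \<in> I - E \<Longrightarrow> f t = 0" for f :: "real \<Rightarrow> nat"
  proof (rule finite_subset)
    show "f ` I \<subseteq> insert 0 (f ` E)"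
    proof (rule image_subsetI)
      fix t assume "t \<in> I"
      then show "f t \<in> insert 0 (f ` E)" using that[of t] by (cases "t \<in> E") simp_all
    qed
  qed (use E in simp)
  have le_G: "Gamma_at t P \<le> Gamma_on I P" if "t \<in> I" for t
    unfolding Gamma_on_def by (rule cSUP_upper[OF that bdd_above_finite[OF fin[OF zero]]])
  have le_D: "Gamma_at t P - gamma_at t P \<le> (SUP t\<in>I. Gamma_at t P - gamma_at t P)" if "t \<in> I" for t
    by (rule cSUP_upper[OF that bdd_above_finite[OF fin]]) (simp add: zero)
  have local: "smooth_roots n (p + gamma_on I P) t P" if t: "t \<in> I" for t
  proof -
    \<comment> \<open>With \<open>?q\<close> derivatives to spare, the roots near \<open>t\<close> get class \<open>?q + gamma_at t P\<close>. This is at least \<open>p + gamma_on I P\<close>, which subtracts the largest value of \<open>\<Gamma> - \<gamma>\<close>.\<close>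
    let ?q = "p + Gamma_on I P - Gamma_at t P"
    have "?q + Gamma_at t P = ?K" using le_G[OF t] by simp
    then have "smooth_roots n (?q + gamma_at t P) t P"
      using near_Ck[OF t] P_def near_def[OF t] by (intro Gamma_rel_smooth_roots[OF rel[OF t] hyp_near[OF t]]) simp_all
    moreover have "p + gamma_on I P \<le> ?q + gamma_at t P"
      using le_G[OF t] le_D[OF t] Gamma_rel_le[OF rel[OF t]] unfolding gamma_on_def by linarith
    ultimately show ?thesis
      using Ck_near_mono unfolding smooth_roots_def by blast
  qed
  have generic: "global_roots n (p + gamma_on I P) J P"
    if J: "open J" "is_interval J" "J \<subseteq> I" "E \<inter> J = {}" for J
    unfolding global_roots_def
  proof (intro exI[of _ ?u] conjI allI impI ballI)
    fix i assume i: "i < n"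
    show "definable_on M J (?u i)"
      by (rule definable_on_subset[OF u_def[OF i] dreal_interval[OF J(1,2)] J(3)])
    show "Ck_on (p + gamma_on I P) J (?u i)"
    proof (rule Ck_on_local)
      fix t assume t: "t \<in> J"
      have tI: "t \<in> I - E" using t J by blast
      have "\<forall>\<^sub>F s in nhds t. \<forall>j\<in>{..<n}. ?u j s = ?u i s \<longleftrightarrow> ?u j t = ?u i t"
      proof (rule eventually_ball_finite, simp, intro ballI)
        fix j assume "j \<in> {..<n}"
        then have j: "j < n" by simp
        show "\<forall>\<^sub>F s in nhds t. ?u j s = ?u i s \<longleftrightarrow> ?u j t = ?u i t"
        proof (cases "?u j t = ?u i t")
          case True
          show ?thesis
            using pattern[OF tI j i True] by eventually_elim (simp add: True)
        next
          case False
          have "isCont (\<lambda>s. ?u j s - ?u i s) t"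
            using u_near[of t] tI i j by (intro continuous_intros continuous_near_imp_isCont) auto
          then have "\<forall>\<^sub>F s in nhds t. ?u j s - ?u i s \<noteq> 0"
            using False by (intro isCont_eventually_nonzero) auto
          then show ?thesis by eventually_elim (simp add: False)
        qed
      qed
      then obtain d where d: "d > 0" "\<And>s. dist s t < d \<Longrightarrow> \<forall>j\<in>{..<n}. ?u j s = ?u i s \<longleftrightarrow> ?u j t = ?u i t"
        unfolding eventually_nhds_metric by blast
      obtain e where e: "e > 0" "ball t e \<subseteq> I" using near_I tI by blast
      let ?B = "ball t (min d e)"
      have B: "?B \<subseteq> I" using e(2) by auto
      have "Ck_on ?K ?B (?u i)"
      proof (rule Ck_on_roots_of_constant_multiplicity[where P = P and n = n])
        show "continuous_on ?B (?u i)" by (rule continuous_on_subset[OF u_cont[OF i] B])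
        show "P s = root_prod {..<n} (\<lambda>i. ?u i s)" if "s \<in> ?B" for s using Pu B that by blast
        show "coeffs_in (Ck_on ?K ?B) P" using P_Ck Ck_on_subset[OF _ B] by blast
        show "(\<forall>s\<in>?B. ?u j s = ?u i s) \<or> (\<forall>s\<in>?B. ?u j s \<noteq> ?u i s)" if "j < n" for j
          using d(2) that by (auto simp: dist_commute)
      qed (use i in auto)
      then have "Ck_near ?K t (?u i)"
        unfolding Ck_near_def using d(1) e(1) by (intro exI[of _ "min d e"]) auto
      then show "Ck_near (p + gamma_on I P) t (?u i)"
        by (rule Ck_near_mono) (simp add: gamma_on_def)
    qed
  qed (use Pu J(3) in blast)
  show ?thesis
    by (rule global_roots_of_local[OF E local generic I]) auto
qed

end

theorem theorem5p2:
  fixes M :: "nat \<Rightarrow> real list set set" and I :: "real set" and n p :: nat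
    and a :: "nat \<Rightarrow> real \<Rightarrow> real" and P :: "real \<Rightarrow> real poly"
  assumes "o_minimal M"
    and "open I" and "is_interval I"
    and "\<And>t. t \<in> I \<Longrightarrow> P t = monom 1 n + (\<Sum>j=1..n. monom ((-1) ^ j * a j t) (n - j))"
    and "\<And>t. t \<in> I \<Longrightarrow> hyperbolic (P t)"
    and "\<And>j. j \<in> {1..n} \<Longrightarrow> definable_on M I (a j)"
    and "p > 0"
    and "\<And>t0. t0 \<in> I \<Longrightarrow> Gamma_defined t0 P"
    and "\<And>j. j \<in> {1..n} \<Longrightarrow> Ck_on (p + Gamma_on I P) I (a j)"
  shows "\<exists>lam :: nat \<Rightarrow> real \<Rightarrow> real.
           (\<forall>j\<in>{1..n}. definable_on M I (lam j) \<and> Ck_on (p + gamma_on I P) I (lam j)) \<and>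
           (\<forall>t\<in>I. P t = (\<Prod>j=1..n. [:- lam j t, 1:]))"
proof -
  interpret o_minimal M by fact
  have "global_roots n (p + gamma_on I P) I P"
    by (rule global_roots_Gamma[OF assms(2-6,8,9)])
  then obtain u where u: "\<And>i. i < n \<Longrightarrow> definable_on M I (u i) \<and> Ck_on (p + gamma_on I P) I (u i)"
    "\<And>t. t \<in> I \<Longrightarrow> P t = root_prod {..<n} (\<lambda>i. u i t)"
    unfolding global_roots_def by blast
  show ?thesis
  proof (intro exI[of _ "\<lambda>j. u (j - 1)"] conjI ballI)
    fix t assume "t \<in> I"
    then show "P t = (\<Prod>j=1..n. [:- u (j - 1) t, 1:])"
      using u(2) prod.atLeast1_atMost_eq[of "\<lambda>j. [:- u (j - 1) t, 1:]" n] by simp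
  qed (use u(1) in auto)
qed

end
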